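(* Let $a$ be a self-adjoint Hilbert-Schmidt operator on $H$. If the $C^*$-algebra $C^*(a)$ generated by $a$ and $1$ is finite dimensional, then the orbit $$S_a=\{gag^* : g\in \mathsf{U}\mathsf{H}_{\mathbb C}\}\subset \mathsf{HS}^h$$ can be given an analytic submanifold structure (as a submanifold of $\mathsf{HS}^h$).
   Context: $H$ is a complex separable Hilbert space, $\mathsf{B}(H)$ the bounded operators on $H$, and $1$ the identity operator. $\mathsf{HS}\subset\mathsf{B}(H)$ is the ideal of Hilbert-Schmidt operators with norm $\|x\|_2=2\,\mathrm{tr}(x^*x)^{1/2}$, and $\mathsf{HS}^h$ is the closed real subspace of self-adjoint Hilbert-Schmidt operators, a real Hilbert space with inner product $\langle x,y\rangle_2=4\,\mathrm{tr}(yx)$. The Hilbert-Schmidt unitary group is $\mathsf{U}\mathsf{H}_{\mathbb C}=\{g=1+x : x\in\mathsf{HS},\ g^*=g^{-1}\}$. Analytic means real analytic. *)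

theory Defs
  imports "HOL-Analysis.Analysis"
begin

section \<open>Complex Hilbert spaces\<close>

text \<open>
  A complex inner product space carries its underlying real inner product
  \<open>inner x y = Re (cinner x y)\<close>, so that the norm, the topology and completeness are those of
  the library classes. The complex inner product is linear in the first argument.
  Separability is the class \<open>second_countable_topology\<close>.
\<close>

class complex_inner = real_inner +
  fixes scaleC :: "complex \<Rightarrow> 'a \<Rightarrow> 'a" (infixr \<open>*\<^sub>C\<close> 75)
    and cinner :: "'a \<Rightarrow> 'a \<Rightarrow> complex"
  assumes scaleC_add_right: "c *\<^sub>C (x + y) = c *\<^sub>C x + c *\<^sub>C y"
    and scaleC_add_left: "(c + d) *\<^sub>C x = c *\<^sub>C x + d *\<^sub>C x"
    and scaleC_scaleC: "c *\<^sub>C d *\<^sub>C x = (c * d) *\<^sub>C x"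
    and scaleC_of_real: "complex_of_real r *\<^sub>C x = scaleR r x"
    and cinner_commute: "cinner x y = cnj (cinner y x)"
    and cinner_add_left: "cinner (x + y) z = cinner x z + cinner y z"
    and cinner_scaleC_left: "cinner (c *\<^sub>C x) y = c * cinner x y"
    and Re_cinner: "Re (cinner x y) = inner x y"

class complex_hilbert = complex_inner + complete_space

instance complex_hilbert \<subseteq> banach ..

instantiation complex :: complex_hilbert
begin

definition scaleC_complex :: "complex \<Rightarrow> complex \<Rightarrow> complex"
  where "scaleC_complex c x = c * x"

definition cinner_complex :: "complex \<Rightarrow> complex \<Rightarrow> complex"
  where "cinner_complex x y = x * cnj y"

instance
  by standard (auto simp: scaleC_complex_def cinner_complex_def algebra_simps inner_complex_def
      scaleR_conv_of_real)

end

lemma scaleC_one: "1 *\<^sub>C (x::'a::complex_inner) = x"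
  using scaleC_of_real[of 1 x] by simp

global_interpretation complex_vec: vector_space "scaleC :: complex \<Rightarrow> 'a \<Rightarrow> 'a::complex_inner"
  defines cspan = complex_vec.span
  by unfold_locales (simp_all add: scaleC_add_right scaleC_add_left scaleC_scaleC scaleC_one)

lemma cinner_add_right: "cinner x (y + z) = cinner x y + cinner x z"
  by (metis cinner_add_left cinner_commute complex_cnj_add)

lemma cinner_scaleC_right: "cinner x (c *\<^sub>C y) = cnj c * cinner x y"
  by (metis cinner_commute cinner_scaleC_left complex_cnj_mult)

lemma cinner_zero_left [simp]: "cinner 0 x = 0"
  using cinner_add_left[of 0 0 x] by simp

lemma cinner_zero_right [simp]: "cinner x 0 = 0"
  using cinner_add_right[of x 0 0] by simp

lemma cinner_minus_left: "cinner (- x) y = - cinner x y"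
  using cinner_add_left[of x "- x" y] by (simp add: eq_neg_iff_add_eq_0 add.commute)

lemma cinner_minus_right: "cinner x (- y) = - cinner x y"
  using cinner_add_right[of x y "- y"] by (simp add: eq_neg_iff_add_eq_0 add.commute)

lemma cinner_diff_left: "cinner (x - y) z = cinner x z - cinner y z"
  using cinner_add_left[of x "- y" z] by (simp add: cinner_minus_left)

lemma cinner_diff_right: "cinner x (y - z) = cinner x y - cinner x z"
  using cinner_add_right[of x y "- z"] by (simp add: cinner_minus_right)

lemma cinner_sum_left: "cinner (sum f A) y = (\<Sum>i\<in>A. cinner (f i) y)"
  by (induction A rule: infinite_finite_induct) (simp_all add: cinner_add_left)

lemma cinner_sum_right: "cinner x (sum f A) = (\<Sum>i\<in>A. cinner x (f i))"
  by (induction A rule: infinite_finite_induct) (simp_all add: cinner_add_right)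

lemma cinner_self: "cinner x x = complex_of_real ((norm x)\<^sup>2)"
proof -
  have "Im (cinner x x) = 0"
    by (metis cinner_commute cnj.simps(2) equal_neg_zero)
  then show ?thesis
    by (simp add: complex_eq_iff Re_cinner power2_norm_eq_inner)
qed

lemma Im_cinner: "Im (cinner x y) = inner x (\<i> *\<^sub>C y)"
proof -
  have "cinner x (\<i> *\<^sub>C y) = - \<i> * cinner x y"
    by (simp add: cinner_scaleC_right)
  then show ?thesis
    by (simp flip: Re_cinner)
qed

lemma cinner_eqI: "(\<And>y. cinner x y = cinner x' y) \<Longrightarrow> x = x'"
  by (metis Re_cinner inner_diff_left inner_eq_zero_iff right_minus_eq)

lemma cinner_eqI': "(\<And>y. cinner y x = cinner y x') \<Longrightarrow> x = x'"
  by (metis cinner_commute cinner_eqI)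

lemma norm_scaleC: "norm (c *\<^sub>C x) = cmod c * norm x"
proof -
  have "complex_of_real ((norm (c *\<^sub>C x))\<^sup>2) = c * cnj c * cinner x x"
    by (simp only: cinner_self[symmetric] cinner_scaleC_left cinner_scaleC_right mult_ac)
  also have "\<dots> = complex_of_real ((cmod c * norm x)\<^sup>2)"
    by (simp only: complex_norm_square[symmetric] cinner_self power_mult_distrib of_real_mult)
  finally have "complex_of_real ((norm (c *\<^sub>C x))\<^sup>2) = complex_of_real ((cmod c * norm x)\<^sup>2)" .
  then show ?thesis
    by (simp only: of_real_eq_iff) (simp add: power2_eq_iff_nonneg)
qed

lemma cmod_cinner_le: "cmod (cinner x y) \<le> norm x * norm y"
proof (cases "cinner x y = 0")
  case False
  define c where "c = cnj (cinner x y) / cmod (cinner x y)"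
  have "cmod c = 1"
    using False by (simp add: c_def norm_divide)
  have "cinner (c *\<^sub>C x) y = complex_of_real (cmod (cinner x y))"
    using False complex_norm_square[of "cinner x y"]
    by (simp add: cinner_scaleC_left c_def field_simps power2_eq_square)
  then have "cmod (cinner x y) = inner (c *\<^sub>C x) y"
    by (metis Re_cinner Re_complex_of_real)
  also have "\<dots> \<le> norm (c *\<^sub>C x) * norm y"
    by (rule norm_cauchy_schwarz)
  finally show ?thesis
    by (simp add: norm_scaleC \<open>cmod c = 1\<close>)
qed simp

lemma closed_subspace_projection:
  fixes M :: "'a::{real_inner,complete_space} set"
  assumes M: "subspace M" "closed M"
  shows "\<exists>p\<in>M. \<forall>y\<in>M. inner (v - p) y = 0"
proof -
  define d where "d = infdist v M"
  have ne: "M \<noteq> {}" and d0: "0 \<le> d"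
    using M(1) subspace_0 by (auto simp: d_def infdist_nonneg)
  have dle: "d \<le> norm (v - y)" if "y \<in> M" for y
    using infdist_le[OF that, of v] by (simp add: d_def dist_norm)
  have "\<exists>y\<in>M. norm (v - y) < d + 1 / real (Suc n)" for n
  proof -
    have "(INF y\<in>M. dist v y) < d + 1 / real (Suc n)"
      using ne by (simp add: d_def infdist_def)
    then show ?thesis
      using cINF_less_iff[OF ne bdd_belowI2[of M 0 "dist v"]] by (auto simp: dist_norm)
  qed
  then obtain y where yM: "\<And>n. y n \<in> M" and yd: "\<And>n. norm (v - y n) < d + 1 / real (Suc n)"
    by metis
  have par: "(norm (y m - y n))\<^sup>2 \<le> 2 * (norm (v - y m))\<^sup>2 + 2 * (norm (v - y n))\<^sup>2 - 4 * d\<^sup>2" for m n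
  proof -
    have "(1/2) *\<^sub>R (y m + y n) \<in> M"
      using M(1) yM by (simp add: subspace_add subspace_scale)
    then have "d\<^sup>2 \<le> (norm (v - (1/2) *\<^sub>R (y m + y n)))\<^sup>2"
      using dle d0 by (simp add: power_mono)
    moreover have "(norm (y m - y n))\<^sup>2 = 2 * (norm (v - y m))\<^sup>2 + 2 * (norm (v - y n))\<^sup>2
       - 4 * (norm (v - (1/2) *\<^sub>R (y m + y n)))\<^sup>2"
      by (simp add: power2_norm_eq_inner algebra_simps inner_commute)
    ultimately show ?thesis by simp
  qed
  have lim: "(\<lambda>n. norm (v - y n)) \<longlonglongrightarrow> d"
  proof (rule tendsto_sandwich[of "\<lambda>_. d"])
    show "(\<lambda>n. d + 1 / real (Suc n)) \<longlonglongrightarrow> d"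
      using tendsto_add[OF tendsto_const LIMSEQ_inverse_real_of_nat, of d] by (simp add: inverse_eq_divide)
    show "\<forall>\<^sub>F n in sequentially. norm (v - y n) \<le> d + 1 / real (Suc n)"
      using yd by (intro always_eventually allI less_imp_le)
  qed (use dle yM in auto)
  have "Cauchy y"
  proof (rule metric_CauchyI)
    fix e :: real assume e: "0 < e"
    have "(\<lambda>n. (norm (v - y n))\<^sup>2) \<longlonglongrightarrow> d\<^sup>2"
      using lim by (rule tendsto_power)
    then have "\<forall>\<^sub>F n in sequentially. (norm (v - y n))\<^sup>2 < d\<^sup>2 + e\<^sup>2 / 4"
      using e by (intro order_tendstoD(2)[where y = "d\<^sup>2"]) auto
    then obtain N where N: "\<And>n. n \<ge> N \<Longrightarrow> (norm (v - y n))\<^sup>2 < d\<^sup>2 + e\<^sup>2 / 4"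
      by (auto simp: eventually_sequentially)
    have "dist (y m) (y n) < e" if "m \<ge> N" "n \<ge> N" for m n
    proof -
      have "(norm (y m - y n))\<^sup>2 < e\<^sup>2"
        using par[of m n] N[OF that(1)] N[OF that(2)] by simp
      then show ?thesis
        using e by (simp add: dist_norm power2_less_imp_less)
    qed
    then show "\<exists>M. \<forall>m\<ge>M. \<forall>n\<ge>M. dist (y m) (y n) < e"
      by blast
  qed
  then obtain p where p: "y \<longlonglongrightarrow> p"
    using Cauchy_convergent_iff convergent_def by blast
  have pM: "p \<in> M"
    using closed_sequentially[OF M(2)] yM p by blast
  have pd: "norm (v - p) = d"
    by (rule LIMSEQ_unique[OF _ lim]) (intro tendsto_intros p)
  have "inner (v - p) z = 0" if z: "z \<in> M" for z
  proof (cases "z = 0")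
    case False
    define t where "t = inner (v - p) z / (norm z)\<^sup>2"
    have "p + t *\<^sub>R z \<in> M"
      using M(1) pM z by (simp add: subspace_add subspace_scale)
    then have "d\<^sup>2 \<le> (norm (v - (p + t *\<^sub>R z)))\<^sup>2"
      using dle d0 by (simp add: power_mono)
    also have "\<dots> = d\<^sup>2 - 2 * t * inner (v - p) z + t\<^sup>2 * (norm z)\<^sup>2"
      unfolding pd[symmetric] power2_norm_eq_inner
      by (simp add: algebra_simps inner_commute power2_eq_square)
    also have "\<dots> = d\<^sup>2 - (inner (v - p) z)\<^sup>2 / (norm z)\<^sup>2"
      using False by (simp add: t_def field_simps power2_eq_square)
    finally have "(inner (v - p) z)\<^sup>2 / (norm z)\<^sup>2 \<le> 0" by simp
    then show ?thesis
      using False by (simp add: divide_le_0_iff)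
  qed simp
  then show ?thesis using pM by blast
qed

lemma riesz_representation:
  fixes f :: "'a::{real_inner,complete_space} \<Rightarrow> real"
  assumes f: "bounded_linear f"
  shows "\<exists>u. \<forall>x. f x = inner x u"
proof (cases "\<forall>x. f x = 0")
  case True
  then show ?thesis by (auto intro: exI[of _ 0])
next
  case False
  then obtain v where v: "f v \<noteq> 0" by blast
  interpret f: bounded_linear f by fact
  let ?M = "f -` {0}"
  have "subspace ?M"
    by (auto simp: subspace_def f.add f.scaleR f.zero)
  moreover have "closed ?M"
    by (intro continuous_closed_vimage closed_singleton)
      (simp add: f.isCont)
  ultimately obtain p where p: "p \<in> ?M" "\<forall>y\<in>?M. inner (v - p) y = 0"
    using closed_subspace_projection by blast
  define w where "w = v - p"
  have fw: "f w = f v" using p by (simp add: w_def f.diff)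
  then have w0: "w \<noteq> 0" using v f.zero by auto
  have "f x = inner x ((f w / (norm w)\<^sup>2) *\<^sub>R w)" for x
  proof -
    have "x - (f x / f w) *\<^sub>R w \<in> ?M"
      using v fw by (simp add: f.diff f.scaleR)
    then have "inner w (x - (f x / f w) *\<^sub>R w) = 0"
      using p w_def by blast
    then have "inner x w = (f x / f w) * (norm w)\<^sup>2"
      by (simp add: inner_diff_right inner_commute power2_norm_eq_inner)
    then show ?thesis
      using v fw w0 by simp
  qed
  then show ?thesis by blast
qed


section \<open>Bounded operators\<close>

text \<open>
  The type \<^typ>\<open>'a \<Rightarrow>\<^sub>L 'a\<close> consists of the bounded \<^emph>\<open>real\<close>-linear maps; the bounded operators
  of the complex Hilbert space are the complex-linear ones among them.
\<close>

definition bounded_ops :: "('a::complex_inner \<Rightarrow>\<^sub>L 'a) set"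
  where "bounded_ops = {T::'a \<Rightarrow>\<^sub>L 'a. \<forall>c x. T (c *\<^sub>C x) = c *\<^sub>C T x}"

definition adj :: "('a::complex_inner \<Rightarrow>\<^sub>L 'a) \<Rightarrow> ('a \<Rightarrow>\<^sub>L 'a)"
  where "adj T = (THE S::'a \<Rightarrow>\<^sub>L 'a. \<forall>x y. cinner (T x) y = cinner x (S y))"

lemma bounded_linear_scaleC: "bounded_linear (\<lambda>x. c *\<^sub>C (x::'a::complex_inner))"
proof
  fix r :: real and x y :: 'a
  show "c *\<^sub>C (r *\<^sub>R x) = r *\<^sub>R (c *\<^sub>C x)"
    by (simp add: scaleC_scaleC mult.commute flip: scaleC_of_real)
  show "\<exists>K. \<forall>x::'a. norm (c *\<^sub>C x) \<le> norm x * K"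
    by (auto simp: norm_scaleC mult.commute intro!: exI[of _ "cmod c"])
qed (simp add: scaleC_add_right)

lift_definition scaleC_op :: "complex \<Rightarrow> ('a::complex_inner \<Rightarrow>\<^sub>L 'a) \<Rightarrow> ('a \<Rightarrow>\<^sub>L 'a)"
  is "\<lambda>c T x. c *\<^sub>C T x"
  by (rule bounded_linear_compose[OF bounded_linear_scaleC])

global_interpretation complex_op: vector_space "scaleC_op :: complex \<Rightarrow> _ \<Rightarrow> 'a::complex_inner \<Rightarrow>\<^sub>L 'a"
  defines op_span = complex_op.span
  by unfold_locales
    (auto intro!: blinfun_eqI simp: scaleC_op.rep_eq blinfun.add_left scaleC_add_right
      scaleC_add_left scaleC_scaleC scaleC_one)

lemma bounded_opsD: "T \<in> bounded_ops \<Longrightarrow> T (c *\<^sub>C x) = c *\<^sub>C T x"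
  by (simp add: bounded_ops_def)

lemma bounded_ops_simps [simp]:
  "0 \<in> bounded_ops" "id_blinfun \<in> bounded_ops"
  "S \<in> bounded_ops \<Longrightarrow> T \<in> bounded_ops \<Longrightarrow> S + T \<in> bounded_ops"
  "S \<in> bounded_ops \<Longrightarrow> T \<in> bounded_ops \<Longrightarrow> S - T \<in> bounded_ops"
  "S \<in> bounded_ops \<Longrightarrow> - S \<in> bounded_ops"
  "S \<in> bounded_ops \<Longrightarrow> r *\<^sub>R S \<in> bounded_ops"
  "S \<in> bounded_ops \<Longrightarrow> scaleC_op c S \<in> bounded_ops"
  "S \<in> bounded_ops \<Longrightarrow> T \<in> bounded_ops \<Longrightarrow> S o\<^sub>L T \<in> bounded_ops"
  by (simp_all add: bounded_ops_def blinfun.bilinear_simps scaleC_op.rep_eq scaleC_add_right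
      complex_vec.scale_right_diff_distrib scaleC_scaleC mult.commute flip: scaleC_of_real)

lemma adj_unique:
  fixes S T :: "'a::complex_inner \<Rightarrow>\<^sub>L 'a"
  assumes "\<And>x y. cinner (T x) y = cinner x (S y)"
  shows "adj T = S"
  unfolding adj_def
proof (rule the_equality)
  fix S' :: "'a \<Rightarrow>\<^sub>L 'a" assume "\<forall>x y. cinner (T x) y = cinner x (S' y)"
  with assms show "S' = S"
    by (metis blinfun_eqI cinner_eqI')
qed (use assms in blast)

lemma adj_exists:
  fixes T :: "'a::complex_hilbert \<Rightarrow>\<^sub>L 'a"
  assumes "T \<in> bounded_ops"
  shows "\<exists>S. \<forall>x y. cinner (T x) y = cinner x (blinfun_apply S y)"
proof -
  have "\<exists>u. \<forall>x. inner (T x) y = inner x u" for y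
    by (intro riesz_representation bounded_linear_intros)
  then obtain s where s: "\<And>x y. inner (T x) y = inner x (s y)"
    by metis
  have eqI: "u = v" if "\<And>x. inner x u = inner x v" for u v :: 'a
    using that by (metis inner_commute inner_diff_left inner_eq_zero_iff right_minus_eq)
  have "bounded_linear s"
  proof
    fix x y :: 'a and r :: real
    show "s (x + y) = s x + s y"
      by (rule eqI) (simp add: inner_add_right flip: s)
    show "s (r *\<^sub>R x) = r *\<^sub>R s x"
      by (rule eqI) (simp flip: s)
    have "norm (s y) \<le> norm y * norm T" for y
    proof (cases "s y = 0")
      case False
      have "(norm (s y))\<^sup>2 = inner (T (s y)) y"
        by (simp add: s power2_norm_eq_inner)
      also have "\<dots> \<le> norm (T (s y)) * norm y"
        by (rule norm_cauchy_schwarz)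
      also have "\<dots> \<le> (norm T * norm (s y)) * norm y"
        by (intro mult_right_mono norm_blinfun) simp
      finally show ?thesis
        using False by (simp add: power2_eq_square mult_ac)
    qed simp
    then show "\<exists>K. \<forall>x. norm (s x) \<le> norm x * K" by blast
  qed
  then have app: "blinfun_apply (Blinfun s) = s"
    by (rule bounded_linear_Blinfun_apply)
  have s2: "s (\<i> *\<^sub>C y) = \<i> *\<^sub>C s y" for y
  proof (rule eqI)
    fix x
    have "inner (T x) (\<i> *\<^sub>C y) = - inner (\<i> *\<^sub>C T x) y" for x y
      by (simp add: cinner_scaleC_left cinner_scaleC_right flip: Re_cinner)
    also have "- inner (\<i> *\<^sub>C T x) y = - inner (\<i> *\<^sub>C x) (s y)" for x y
      by (simp add: bounded_opsD[OF assms, symmetric] s)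
    also have "- inner (\<i> *\<^sub>C x) y = inner x (\<i> *\<^sub>C y)" for x y :: 'a
      by (simp add: cinner_scaleC_left cinner_scaleC_right flip: Re_cinner)
    finally show "inner x (s (\<i> *\<^sub>C y)) = inner x (\<i> *\<^sub>C s y)"
      by (simp add: s)
  qed
  have "cinner (T x) y = cinner x (s y)" for x y
    by (simp add: complex_eq_iff Re_cinner Im_cinner s s2)
  then show ?thesis
    by (metis app)
qed

lemma cinner_adj:
  fixes T :: "'a::complex_hilbert \<Rightarrow>\<^sub>L 'a"
  assumes "T \<in> bounded_ops"
  shows "cinner (T x) y = cinner x (adj T y)"
  using adj_exists[OF assms] adj_unique by metis

lemma cinner_adj':
  fixes T :: "'a::complex_hilbert \<Rightarrow>\<^sub>L 'a"
  assumes "T \<in> bounded_ops"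
  shows "cinner (adj T x) y = cinner x (T y)"
  by (metis assms cinner_adj cinner_commute)

lemma adj_in_bounded_ops [simp]:
  fixes T :: "'a::complex_hilbert \<Rightarrow>\<^sub>L 'a"
  assumes T: "T \<in> bounded_ops"
  shows "adj T \<in> bounded_ops"
  unfolding bounded_ops_def
  by (intro CollectI allI, rule cinner_eqI) (simp add: cinner_scaleC_left cinner_adj'[OF T])

lemma adj_adj:
  fixes T :: "'a::complex_hilbert \<Rightarrow>\<^sub>L 'a"
  shows "T \<in> bounded_ops \<Longrightarrow> adj (adj T) = T"
  by (rule adj_unique) (rule cinner_adj')

lemma adj_id: "adj (id_blinfun :: 'a::complex_inner \<Rightarrow>\<^sub>L 'a) = id_blinfun"
  by (rule adj_unique) simp

lemma adj_zero: "adj (0 :: 'a::complex_inner \<Rightarrow>\<^sub>L 'a) = 0"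
  by (rule adj_unique) simp

lemma adj_add:
  fixes S T :: "'a::complex_hilbert \<Rightarrow>\<^sub>L 'a"
  shows "S \<in> bounded_ops \<Longrightarrow> T \<in> bounded_ops \<Longrightarrow> adj (S + T) = adj S + adj T"
  by (rule adj_unique) (simp add: blinfun.add_left cinner_add_left cinner_add_right cinner_adj)

lemma adj_scaleC:
  fixes T :: "'a::complex_hilbert \<Rightarrow>\<^sub>L 'a"
  shows "T \<in> bounded_ops \<Longrightarrow> adj (scaleC_op c T) = scaleC_op (cnj c) (adj T)"
  by (rule adj_unique) (simp add: scaleC_op.rep_eq cinner_scaleC_left cinner_scaleC_right cinner_adj)

lemma scaleR_op: "r *\<^sub>R T = scaleC_op (complex_of_real r) T"
  by (rule blinfun_eqI) (simp add: scaleC_op.rep_eq blinfun.scaleR_left scaleC_of_real)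

lemma adj_scaleR:
  fixes T :: "'a::complex_hilbert \<Rightarrow>\<^sub>L 'a"
  shows "T \<in> bounded_ops \<Longrightarrow> adj (r *\<^sub>R T) = r *\<^sub>R adj T"
  by (simp add: scaleR_op adj_scaleC)

lemma adj_comp:
  fixes S T :: "'a::complex_hilbert \<Rightarrow>\<^sub>L 'a"
  shows "S \<in> bounded_ops \<Longrightarrow> T \<in> bounded_ops \<Longrightarrow> adj (S o\<^sub>L T) = adj T o\<^sub>L adj S"
  by (rule adj_unique) (simp add: cinner_adj)

section \<open>Orthonormal bases\<close>

definition orthonormal :: "'a::complex_inner set \<Rightarrow> bool"
  where "orthonormal E \<longleftrightarrow> (\<forall>e\<in>E. norm e = 1) \<and> (\<forall>e\<in>E. \<forall>f\<in>E. e \<noteq> f \<longrightarrow> cinner e f = 0)"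

definition is_onb :: "'a::complex_inner set \<Rightarrow> bool"
  where "is_onb E \<longleftrightarrow> orthonormal E \<and> closure (cspan E) = UNIV"

lemma orthonormal_subset: "orthonormal E \<Longrightarrow> F \<subseteq> E \<Longrightarrow> orthonormal F"
  by (auto simp: orthonormal_def)

lemma cinner_proj_orthogonal:
  assumes F: "finite F" "orthonormal F" and u: "u \<in> cspan F"
  shows "cinner (v - (\<Sum>e\<in>F. cinner v e *\<^sub>C e)) u = 0"
  using u
proof (induction rule: complex_vec.span_induct_alt)
  case base
  show ?case by simp
next
  case (step c x y)
  have "cinner (\<Sum>e\<in>F. cinner v e *\<^sub>C e) x = (\<Sum>e\<in>F. cinner v e * cinner e x)"
    by (simp add: cinner_sum_left cinner_scaleC_left)
  also have "\<dots> = (\<Sum>e\<in>F. if e = x then cinner v x else 0)"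
    using F(2) step(1) by (intro sum.cong) (auto simp: orthonormal_def cinner_self)
  also have "\<dots> = cinner v x"
    using F(1) step(1) by simp
  finally show ?case
    using step by (simp add: cinner_add_right cinner_scaleC_right cinner_diff_left)
qed

lemma norm_proj:
  assumes F: "finite F" "orthonormal F"
  shows "(norm (v - (\<Sum>e\<in>F. cinner v e *\<^sub>C e)))\<^sup>2 = (norm v)\<^sup>2 - (\<Sum>e\<in>F. (cmod (cinner v e))\<^sup>2)"
proof -
  let ?p = "\<Sum>e\<in>F. cinner v e *\<^sub>C e"
  have "?p \<in> cspan F"
    by (intro complex_vec.span_sum complex_vec.span_scale complex_vec.span_base)
  then have "cinner (v - ?p) ?p = 0"
    by (rule cinner_proj_orthogonal[OF F])
  then have "complex_of_real ((norm (v - ?p))\<^sup>2) = cinner (v - ?p) v"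
    by (simp only: cinner_self[symmetric] cinner_diff_right) simp
  also have "\<dots> = complex_of_real ((norm v)\<^sup>2) - (\<Sum>e\<in>F. cinner v e * cinner e v)"
    by (simp only: cinner_self[symmetric] cinner_diff_left cinner_sum_left cinner_scaleC_left)
  also have "(\<Sum>e\<in>F. cinner v e * cinner e v) = complex_of_real (\<Sum>e\<in>F. (cmod (cinner v e))\<^sup>2)"
    by (simp only: of_real_sum complex_norm_square cinner_commute[of v, symmetric])
      (auto intro!: sum.cong simp: cinner_commute[of _ v])
  finally show ?thesis
    by (simp only: of_real_diff[symmetric] of_real_eq_iff)
qed

lemma bessel:
  assumes "finite F" "orthonormal F"
  shows "(\<Sum>e\<in>F. (cmod (cinner v e))\<^sup>2) \<le> (norm v)\<^sup>2"
  using norm_proj[OF assms, of v] zero_le_power2[of "norm (v - (\<Sum>e\<in>F. cinner v e *\<^sub>C e))"]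
  by linarith

lemma parseval:
  assumes "is_onb E"
  shows "((\<lambda>e. (cmod (cinner v e))\<^sup>2) has_sum (norm v)\<^sup>2) E"
proof -
  have on: "orthonormal F" if "F \<subseteq> E" for F
    using assms that orthonormal_subset by (auto simp: is_onb_def)
  have "\<exists>X. finite X \<and> X \<subseteq> E \<and> (\<forall>Y. finite Y \<and> X \<subseteq> Y \<and> Y \<subseteq> E \<longrightarrow>
          dist (\<Sum>e\<in>Y. (cmod (cinner v e))\<^sup>2) ((norm v)\<^sup>2) < r)" if "r > 0" for r :: real
  proof -
    have "v \<in> closure (cspan E)" using assms by (simp add: is_onb_def)
    moreover have "sqrt r > 0" using that by simp
    ultimately obtain u where u: "u \<in> cspan E" "dist u v < sqrt r"
      unfolding closure_approachable by blast
    from u(1) obtain t c where t: "finite t" "t \<subseteq> E" "u = (\<Sum>a\<in>t. c a *\<^sub>C a)"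
      by (auto simp: complex_vec.span_explicit)
    have "dist (\<Sum>e\<in>Y. (cmod (cinner v e))\<^sup>2) ((norm v)\<^sup>2) < r"
      if Y: "finite Y" "t \<subseteq> Y" "Y \<subseteq> E" for Y
    proof -
      let ?p = "\<Sum>e\<in>Y. cinner v e *\<^sub>C e"
      have "u \<in> cspan Y" and "?p \<in> cspan Y"
        unfolding t(3) using t(2) Y
        by (blast intro: complex_vec.span_sum complex_vec.span_scale complex_vec.span_base)+
      then have "cinner (v - ?p) (?p - u) = 0"
        using cinner_proj_orthogonal[OF Y(1) on[OF Y(3)]] complex_vec.span_diff by blast
      then have "inner (v - ?p) (?p - u) = 0"
        by (simp flip: Re_cinner)
      then have "(norm ((v - ?p) + (?p - u)))\<^sup>2 = (norm (v - ?p))\<^sup>2 + (norm (?p - u))\<^sup>2"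
        unfolding power2_norm_eq_inner by (simp only: inner_add inner_commute[of "?p - u" "v - ?p"])
      then have "(norm (v - ?p))\<^sup>2 \<le> (norm (v - u))\<^sup>2" by simp
      also have "\<dots> < (sqrt r)\<^sup>2"
        using u(2) by (intro power_strict_mono) (auto simp: dist_norm norm_minus_commute)
      also have "\<dots> = r" using \<open>r > 0\<close> by simp
      finally have "(norm v)\<^sup>2 - (\<Sum>e\<in>Y. (cmod (cinner v e))\<^sup>2) < r"
        by (simp add: norm_proj[OF Y(1) on[OF Y(3)]])
      with bessel[OF Y(1) on[OF Y(3)], of v] show ?thesis
        by (simp add: dist_real_def)
    qed
    with t show ?thesis by blast
  qed
  then show ?thesis
    unfolding has_sum_def tendsto_iff eventually_finite_subsets_at_top by blast
qed

lemma closure_subspace: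
  fixes S :: "'a::real_normed_vector set"
  assumes S: "subspace S"
  shows "subspace (closure S)"
  unfolding subspace_def
proof (intro conjI ballI allI)
  show "0 \<in> closure S"
    using subspace_0[OF S] closure_subset by blast
next
  fix x y assume "x \<in> closure S" "y \<in> closure S"
  then obtain f g where "\<And>n. f n \<in> S" "f \<longlonglongrightarrow> x" "\<And>n. g n \<in> S" "g \<longlonglongrightarrow> y"
    by (meson closure_sequential)
  then have "\<forall>n. f n + g n \<in> S" "(\<lambda>n. f n + g n) \<longlonglongrightarrow> x + y"
    using S by (auto intro: subspace_add tendsto_add)
  then show "x + y \<in> closure S"
    by (subst closure_sequential) (rule exI[of _ "\<lambda>n. f n + g n"], simp)
next
  fix r x assume "x \<in> closure S"
  then obtain f where "\<And>n. f n \<in> S" "f \<longlonglongrightarrow> x"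
    by (meson closure_sequential)
  then have "\<forall>n. r *\<^sub>R f n \<in> S" "(\<lambda>n. r *\<^sub>R f n) \<longlonglongrightarrow> r *\<^sub>R x"
    using S by (auto intro: subspace_scale tendsto_scaleR)
  then show "r *\<^sub>R x \<in> closure S"
    by (subst closure_sequential) (rule exI[of _ "\<lambda>n. r *\<^sub>R f n"], simp)
qed

lemma ex_onb: "\<exists>E::'a::complex_hilbert set. is_onb E"
proof -
  let ?O = "{E::'a set. orthonormal E}"
  have "\<exists>M\<in>?O. \<forall>X\<in>?O. M \<subseteq> X \<longrightarrow> X = M"
  proof (rule subset_Zorn')
    fix C assume C: "subset.chain ?O C"
    have on: "orthonormal X" if "X \<in> C" for X
      using C that by (auto simp: subset.chain_def)
    have "cinner e f = 0" if ef: "e \<in> \<Union>C" "f \<in> \<Union>C" "e \<noteq> f" for e f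
    proof -
      obtain X Y where "X \<in> C" "e \<in> X" "Y \<in> C" "f \<in> Y" using ef(1,2) by (elim UnionE)
      moreover from this C have "X \<subseteq> Y \<or> Y \<subseteq> X"
        by (simp add: subset_chain_def)
      ultimately show ?thesis
        using on ef(3) by (metis orthonormal_def subsetD)
    qed
    moreover have "norm e = 1" if "e \<in> \<Union>C" for e
      using that on by (auto simp: orthonormal_def)
    ultimately show "\<Union>C \<in> ?O"
      unfolding orthonormal_def by blast
  qed
  then obtain E :: "'a set" where E: "orthonormal E" and
    max: "\<And>X. orthonormal X \<Longrightarrow> E \<subseteq> X \<Longrightarrow> X = E" by auto
  let ?M = "closure (cspan E)"
  have "subspace (cspan E)"
    by (auto simp: subspace_def complex_vec.span_zero complex_vec.span_add complex_vec.span_scale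
        simp flip: scaleC_of_real)
  then have M: "subspace ?M" by (rule closure_subspace)
  have "v \<in> ?M" for v
  proof (rule ccontr)
    assume v: "v \<notin> ?M"
    obtain p where p: "p \<in> ?M" "\<forall>y\<in>?M. inner (v - p) y = 0"
      using closed_subspace_projection[OF M closed_closure] by blast
    define w where "w = v - p"
    have w0: "w \<noteq> 0" using v p by (auto simp: w_def)
    have wE: "cinner w e = 0" if "e \<in> E" for e
    proof -
      have "e \<in> ?M" "\<i> *\<^sub>C e \<in> ?M"
        using that by (meson closure_subset complex_vec.span_scale complex_vec.span_base subsetD)+
      then show ?thesis
        using p by (simp add: complex_eq_iff Re_cinner Im_cinner w_def)
    qed
    define z where "z = complex_of_real (inverse (norm w)) *\<^sub>C w"
    have z: "norm z = 1" "\<And>e. e \<in> E \<Longrightarrow> cinner z e = 0"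
      using w0 wE by (simp_all add: z_def norm_scaleC cinner_scaleC_left norm_inverse)
    then have z': "\<And>e. e \<in> E \<Longrightarrow> cinner e z = 0"
      by (metis cinner_commute complex_cnj_zero)
    have "orthonormal (insert z E)"
      using E z z' by (auto simp: orthonormal_def)
    then have "z \<in> E" using max by blast
    then have "cinner z z = 0" using z by blast
    with z(1) show False by (simp add: cinner_self)
  qed
  then show ?thesis using E by (auto simp: is_onb_def)
qed

section \<open>Hilbert-Schmidt operators\<close>

definition hilbert_schmidt :: "('a::complex_inner \<Rightarrow>\<^sub>L 'a) \<Rightarrow> bool"
  where "hilbert_schmidt x \<longleftrightarrow> x \<in> bounded_ops \<and>
    (\<exists>E. is_onb E \<and> (\<lambda>e. (norm (x e))\<^sup>2) summable_on E)"

definition some_onb :: "'a::complex_inner set"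
  where "some_onb = (SOME E. is_onb E)"

text \<open>
  The trace is only applied below to products of two Hilbert-Schmidt operators. There the sum
  converges absolutely (\<open>hs_abs_summable\<close>) and does not depend on the chosen basis (for
  \<open>y = x\<close> this is \<open>hs_sum_adj_eq\<close>, and the general case follows by polarization).
\<close>

definition trace_op :: "('a::complex_inner \<Rightarrow>\<^sub>L 'a) \<Rightarrow> complex"
  where "trace_op T = (\<Sum>\<^sub>\<infinity>e\<in>some_onb. cinner (T e) e)"

lemma is_onb_some_onb: "is_onb (some_onb :: 'a::complex_hilbert set)"
  unfolding some_onb_def by (rule someI_ex[OF ex_onb])

lemma has_sum_finite_sum:
  fixes g :: "'a \<Rightarrow> 'b \<Rightarrow> real"
  assumes "\<And>i. i \<in> I \<Longrightarrow> (g i has_sum s i) A"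
  shows "((\<lambda>x. \<Sum>i\<in>I. g i x) has_sum (\<Sum>i\<in>I. s i)) A"
  using assms by (induction I rule: infinite_finite_induct) (auto intro!: has_sum_add)

lemma hs_sum_adj:
  fixes x :: "'a::complex_hilbert \<Rightarrow>\<^sub>L 'a"
  assumes x: "x \<in> bounded_ops" and E: "is_onb E" and F: "is_onb F"
    and s: "(\<lambda>e. (norm (x e))\<^sup>2) summable_on E"
  shows "(\<lambda>f. (norm (adj x f))\<^sup>2) summable_on F"
    and "(\<Sum>\<^sub>\<infinity>f\<in>F. (norm (adj x f))\<^sup>2) \<le> (\<Sum>\<^sub>\<infinity>e\<in>E. (norm (x e))\<^sup>2)"
proof -
  have *: "(\<Sum>f\<in>G. (norm (adj x f))\<^sup>2) \<le> (\<Sum>\<^sub>\<infinity>e\<in>E. (norm (x e))\<^sup>2)"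
    if G: "finite G" "G \<subseteq> F" for G
  proof (rule has_sum_mono)
    have oG: "orthonormal G"
      using F G orthonormal_subset by (auto simp: is_onb_def)
    show "((\<lambda>e. \<Sum>f\<in>G. (cmod (cinner (adj x f) e))\<^sup>2) has_sum (\<Sum>f\<in>G. (norm (adj x f))\<^sup>2)) E"
      by (intro has_sum_finite_sum parseval E)
    show "((\<lambda>e. (norm (x e))\<^sup>2) has_sum (\<Sum>\<^sub>\<infinity>e\<in>E. (norm (x e))\<^sup>2)) E"
      by (rule has_sum_infsum[OF s])
    fix e
    have "cmod (cinner (adj x f) e) = cmod (cinner (x e) f)" for f
      by (metis cinner_adj'[OF x] cinner_commute complex_mod_cnj)
    then show "(\<Sum>f\<in>G. (cmod (cinner (adj x f) e))\<^sup>2) \<le> (norm (x e))\<^sup>2"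
      using bessel[OF G(1) oG, of "x e"] by simp
  qed
  then show sF: "(\<lambda>f. (norm (adj x f))\<^sup>2) summable_on F"
    by (intro nonneg_bdd_above_summable_on bdd_aboveI2) auto
  then show "(\<Sum>\<^sub>\<infinity>f\<in>F. (norm (adj x f))\<^sup>2) \<le> (\<Sum>\<^sub>\<infinity>e\<in>E. (norm (x e))\<^sup>2)"
    by (rule infsum_le_finite_sums) (use * in blast)
qed

lemma hilbert_schmidt_bounded_ops: "hilbert_schmidt x \<Longrightarrow> x \<in> bounded_ops"
  by (simp add: hilbert_schmidt_def)

lemma hilbert_schmidt_adj:
  fixes x :: "'a::complex_hilbert \<Rightarrow>\<^sub>L 'a"
  assumes "hilbert_schmidt x"
  shows "hilbert_schmidt (adj x)"
  using assms hs_sum_adj(1) unfolding hilbert_schmidt_def by (blast intro: adj_in_bounded_ops)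

lemma hilbert_schmidt_summable:
  fixes x :: "'a::complex_hilbert \<Rightarrow>\<^sub>L 'a"
  assumes x: "hilbert_schmidt x" and F: "is_onb F"
  shows "(\<lambda>e. (norm (x e))\<^sup>2) summable_on F"
proof -
  have x': "adj x \<in> bounded_ops"
    using x by (simp add: hilbert_schmidt_bounded_ops)
  obtain E where E: "is_onb E" "(\<lambda>e. (norm (adj x e))\<^sup>2) summable_on E"
    using hilbert_schmidt_adj[OF x] by (auto simp: hilbert_schmidt_def)
  have "(\<lambda>f. (norm (adj (adj x) f))\<^sup>2) summable_on F"
    by (rule hs_sum_adj(1)[OF x' E(1) F E(2)])
  then show ?thesis
    using x by (simp add: adj_adj hilbert_schmidt_bounded_ops)
qed

lemma hs_sum_adj_eq:
  fixes x :: "'a::complex_hilbert \<Rightarrow>\<^sub>L 'a"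
  assumes x: "hilbert_schmidt x" and E: "is_onb E" and F: "is_onb F"
  shows "(\<Sum>\<^sub>\<infinity>f\<in>F. (norm (adj x f))\<^sup>2) = (\<Sum>\<^sub>\<infinity>e\<in>E. (norm (x e))\<^sup>2)"
  using hs_sum_adj(2)[of x E F] hs_sum_adj(2)[of "adj x" F E] assms
    hilbert_schmidt_summable[OF x E] hilbert_schmidt_summable[OF hilbert_schmidt_adj[OF x] F]
  by (simp add: hilbert_schmidt_bounded_ops adj_adj)

lemma hilbert_schmidtI:
  "x \<in> bounded_ops \<Longrightarrow> is_onb E \<Longrightarrow> (\<lambda>e. (norm (x e))\<^sup>2) summable_on E \<Longrightarrow> hilbert_schmidt x"
  by (auto simp: hilbert_schmidt_def)

lemma hilbert_schmidt_zero: "hilbert_schmidt (0 :: 'a::complex_hilbert \<Rightarrow>\<^sub>L 'a)"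
  by (rule hilbert_schmidtI[OF _ is_onb_some_onb]) simp_all

lemma hilbert_schmidt_add:
  fixes x y :: "'a::complex_hilbert \<Rightarrow>\<^sub>L 'a"
  assumes x: "hilbert_schmidt x" and y: "hilbert_schmidt y"
  shows "hilbert_schmidt (x + y)"
proof (rule hilbert_schmidtI[OF _ is_onb_some_onb])
  show "x + y \<in> bounded_ops"
    using x y by (simp add: hilbert_schmidt_bounded_ops)
  have "(\<lambda>e. 2 * (norm (x e))\<^sup>2 + 2 * (norm (y e))\<^sup>2) summable_on some_onb"
    by (intro summable_on_add summable_on_cmult_right hilbert_schmidt_summable x y is_onb_some_onb)
  moreover have "(norm ((x + y) e))\<^sup>2 \<le> 2 * (norm (x e))\<^sup>2 + 2 * (norm (y e))\<^sup>2" for e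
  proof -
    have "0 \<le> inner (x e - y e) (x e - y e)" by simp
    then show ?thesis
      by (simp only: blinfun.add_left power2_norm_eq_inner) (simp add: algebra_simps inner_commute)
  qed
  ultimately show "(\<lambda>e. (norm ((x + y) e))\<^sup>2) summable_on some_onb"
    by (rule summable_on_comparison_test) auto
qed

lemma hilbert_schmidt_comp_left:
  fixes x T :: "'a::complex_hilbert \<Rightarrow>\<^sub>L 'a"
  assumes x: "hilbert_schmidt x" and T: "T \<in> bounded_ops"
  shows "hilbert_schmidt (T o\<^sub>L x)"
proof (rule hilbert_schmidtI[OF _ is_onb_some_onb])
  show "T o\<^sub>L x \<in> bounded_ops"
    using x T by (simp add: hilbert_schmidt_bounded_ops)
  have "(\<lambda>e. (norm T)\<^sup>2 * (norm (x e))\<^sup>2) summable_on some_onb"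
    by (intro summable_on_cmult_right hilbert_schmidt_summable x is_onb_some_onb)
  moreover have "(norm ((T o\<^sub>L x) e))\<^sup>2 \<le> (norm T)\<^sup>2 * (norm (x e))\<^sup>2" for e
    using norm_blinfun[of T "x e"] by (simp add: power_mono flip: power_mult_distrib)
  ultimately show "(\<lambda>e. (norm ((T o\<^sub>L x) e))\<^sup>2) summable_on some_onb"
    by (rule summable_on_comparison_test) auto
qed

lemma hilbert_schmidt_comp_right:
  fixes x T :: "'a::complex_hilbert \<Rightarrow>\<^sub>L 'a"
  assumes x: "hilbert_schmidt x" and T: "T \<in> bounded_ops"
  shows "hilbert_schmidt (x o\<^sub>L T)"
proof -
  have "hilbert_schmidt (adj (adj T o\<^sub>L adj x))"
    by (intro hilbert_schmidt_adj hilbert_schmidt_comp_left adj_in_bounded_ops x T)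
  also have "adj (adj T o\<^sub>L adj x) = x o\<^sub>L T"
    using x T by (simp add: adj_comp adj_adj hilbert_schmidt_bounded_ops)
  finally show ?thesis .
qed

lemma hilbert_schmidt_scaleC:
  fixes x :: "'a::complex_hilbert \<Rightarrow>\<^sub>L 'a"
  assumes "hilbert_schmidt x"
  shows "hilbert_schmidt (scaleC_op c x)"
proof -
  have "scaleC_op c x = scaleC_op c id_blinfun o\<^sub>L x"
    by (rule blinfun_eqI) (simp add: scaleC_op.rep_eq)
  then show ?thesis
    using hilbert_schmidt_comp_left[OF assms, of "scaleC_op c id_blinfun"] by simp
qed

lemma hilbert_schmidt_scaleR:
  fixes x :: "'a::complex_hilbert \<Rightarrow>\<^sub>L 'a"
  shows "hilbert_schmidt x \<Longrightarrow> hilbert_schmidt (r *\<^sub>R x)"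
  by (simp add: scaleR_op hilbert_schmidt_scaleC)

lemma hs_abs_summable:
  fixes x y :: "'a::complex_hilbert \<Rightarrow>\<^sub>L 'a"
  assumes x: "hilbert_schmidt x" and y: "hilbert_schmidt y" and E: "is_onb E"
  shows "(\<lambda>e. norm (cinner (x e) (y e))) summable_on E"
proof -
  have "(\<lambda>e. (norm (x e))\<^sup>2 + (norm (y e))\<^sup>2) summable_on E"
    by (intro summable_on_add hilbert_schmidt_summable x y E)
  moreover have "norm (cinner (x e) (y e)) \<le> (norm (x e))\<^sup>2 + (norm (y e))\<^sup>2" for e
  proof -
    have "2 * (norm (x e) * norm (y e)) \<le> (norm (x e))\<^sup>2 + (norm (y e))\<^sup>2"
      using sum_squares_bound[of "norm (x e)" "norm (y e)"] by simp
    moreover have "0 \<le> norm (x e) * norm (y e)" by simp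
    ultimately show ?thesis
      using cmod_cinner_le[of "x e" "y e"] by linarith
  qed
  ultimately show ?thesis
    by (rule summable_on_comparison_test) auto
qed

lemma trace_adj_comp:
  fixes x y :: "'a::complex_hilbert \<Rightarrow>\<^sub>L 'a"
  assumes x: "hilbert_schmidt x" and y: "hilbert_schmidt y"
  shows "((\<lambda>e. cinner (x e) (y e)) has_sum trace_op (adj y o\<^sub>L x)) some_onb"
proof -
  have "trace_op (adj y o\<^sub>L x) = (\<Sum>\<^sub>\<infinity>e\<in>some_onb. cinner (x e) (y e))"
    using y by (simp add: trace_op_def cinner_adj' hilbert_schmidt_bounded_ops)
  then show ?thesis
    using abs_summable_summable[OF hs_abs_summable[OF x y is_onb_some_onb]] by simp
qed

section \<open>The real Hilbert space of self-adjoint Hilbert-Schmidt operators\<close>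

typedef (overloaded) 'a hs_sa =
  "{x :: 'a::complex_hilbert \<Rightarrow>\<^sub>L 'a. hilbert_schmidt x \<and> adj x = x}"
  morphisms hs_op Abs_hs_sa
  by (rule exI[of _ 0]) (simp add: hilbert_schmidt_zero adj_zero)

setup_lifting type_definition_hs_sa

lemma hilbert_schmidt_hs_op: "hilbert_schmidt (hs_op x)"
  and adj_hs_op: "adj (hs_op x) = hs_op x"
  using hs_op[of x] by simp_all

lemma hs_op_bounded_ops [simp]: "hs_op x \<in> bounded_ops"
  by (simp add: hilbert_schmidt_bounded_ops hilbert_schmidt_hs_op)

instantiation hs_sa :: (complex_hilbert) real_vector
begin

lift_definition zero_hs_sa :: "'a hs_sa" is 0
  by (simp add: hilbert_schmidt_zero adj_zero)

lift_definition plus_hs_sa :: "'a hs_sa \<Rightarrow> 'a hs_sa \<Rightarrow> 'a hs_sa" is "\<lambda>x y. x + y"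
  by (simp add: hilbert_schmidt_add adj_add hilbert_schmidt_bounded_ops)

lift_definition scaleR_hs_sa :: "real \<Rightarrow> 'a hs_sa \<Rightarrow> 'a hs_sa" is "\<lambda>r x. r *\<^sub>R x"
  by (simp add: hilbert_schmidt_scaleR adj_scaleR hilbert_schmidt_bounded_ops)

lift_definition uminus_hs_sa :: "'a hs_sa \<Rightarrow> 'a hs_sa" is "\<lambda>x. (-1) *\<^sub>R x"
  by (simp only: hilbert_schmidt_scaleR adj_scaleR hilbert_schmidt_bounded_ops simp_thms)

lift_definition minus_hs_sa :: "'a hs_sa \<Rightarrow> 'a hs_sa \<Rightarrow> 'a hs_sa" is "\<lambda>x y. x + (-1) *\<^sub>R y"
  by (simp only: hilbert_schmidt_scaleR adj_scaleR hilbert_schmidt_add adj_add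
      hilbert_schmidt_bounded_ops bounded_ops_simps simp_thms)

instance
  by standard (transfer, simp add: algebra_simps)+

end

lemma hs_op_simps:
  "hs_op 0 = 0" "hs_op (x + y) = hs_op x + hs_op y" "hs_op (x - y) = hs_op x - hs_op y"
  "hs_op (- x) = - hs_op x" "hs_op (r *\<^sub>R x) = r *\<^sub>R hs_op x"
  by (simp_all add: zero_hs_sa.rep_eq plus_hs_sa.rep_eq minus_hs_sa.rep_eq uminus_hs_sa.rep_eq
      scaleR_hs_sa.rep_eq)

text \<open>
  The real part below is only there to obtain a real number: the trace is real, see
  \<open>inner_hs_sa\<close>.
\<close>

instantiation hs_sa :: (complex_hilbert) real_inner
begin

definition inner_hs_sa_def: "inner x y = 4 * Re (trace_op (hs_op y o\<^sub>L hs_op x))"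

definition norm_hs_sa_def: "norm (x :: 'a hs_sa) = sqrt (inner x x)"

definition sgn_hs_sa_def: "sgn (x :: 'a hs_sa) = x /\<^sub>R norm x"

definition dist_hs_sa_def: "dist x (y :: 'a hs_sa) = norm (x - y)"

definition uniformity_hs_sa_def [code del]:
  "(uniformity :: ('a hs_sa \<times> 'a hs_sa) filter) = (INF e\<in>{0<..}. principal {(x, y). dist x y < e})"

definition open_hs_sa_def [code del]:
  "open (S :: 'a hs_sa set) \<longleftrightarrow> (\<forall>x\<in>S. \<forall>\<^sub>F (x', y) in uniformity. x' = x \<longrightarrow> y \<in> S)"

lemma inner_hs_sa_has_sum:
  "((\<lambda>e. 4 * inner (hs_op x e) (hs_op y e)) has_sum inner x (y::'a hs_sa)) some_onb"
proof -
  have "((\<lambda>e. cinner (hs_op x e) (hs_op y e)) has_sum trace_op (adj (hs_op y) o\<^sub>L hs_op x)) some_onb"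
    by (intro trace_adj_comp hilbert_schmidt_hs_op)
  then have "((\<lambda>e. Re (cinner (hs_op x e) (hs_op y e))) has_sum Re (trace_op (hs_op y o\<^sub>L hs_op x))) some_onb"
    unfolding adj_hs_op by (rule has_sum_Re)
  then show ?thesis
    unfolding inner_hs_sa_def Re_cinner by (rule has_sum_cmult_right)
qed

instance
proof
  fix x y z :: "'a hs_sa" and r :: real
  show "inner x y = inner y x"
    using inner_hs_sa_has_sum[of x y] inner_hs_sa_has_sum[of y x]
    by (simp add: inner_commute has_sum_unique)
  have "((\<lambda>e. 4 * inner (hs_op x e) (hs_op z e) + 4 * inner (hs_op y e) (hs_op z e))
      has_sum (inner x z + inner y z)) some_onb"
    by (intro has_sum_add inner_hs_sa_has_sum)
  then show "inner (x + y) z = inner x z + inner y z"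
    using inner_hs_sa_has_sum[of "x + y" z]
    by (simp add: hs_op_simps blinfun.add_left inner_add_left distrib_left has_sum_unique)
  have "((\<lambda>e. r * (4 * inner (hs_op x e) (hs_op y e))) has_sum (r * inner x y)) some_onb"
    by (intro has_sum_cmult_right inner_hs_sa_has_sum)
  then show "inner (r *\<^sub>R x) y = r * inner x y"
    using inner_hs_sa_has_sum[of "r *\<^sub>R x" y]
    by (simp add: hs_op_simps blinfun.scaleR_left mult.left_commute has_sum_unique)
  show pos: "0 \<le> inner x x"
    by (rule has_sum_nonneg[OF inner_hs_sa_has_sum]) simp
  show "inner x x = 0 \<longleftrightarrow> x = 0"
  proof
    assume "inner x x = 0"
    then have "hs_op x e = 0" if "e \<in> some_onb" for e
      using nonneg_has_sum_le_0D[OF inner_hs_sa_has_sum[of x x], of e] that by simp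
    then have e0: "cinner (hs_op x v) e = 0" if "e \<in> some_onb" for v e
      using that cinner_adj[of "hs_op x" v e] by (simp add: adj_hs_op)
    have "hs_op x v = 0" for v
    proof -
      have "((\<lambda>e. 0) has_sum (norm (hs_op x v))\<^sup>2) (some_onb :: 'a set)"
        using parseval[OF is_onb_some_onb, of "hs_op x v"] e0 by (simp cong: has_sum_cong)
      then have "(norm (hs_op x v))\<^sup>2 = 0"
        by (rule has_sum_unique) simp
      then show ?thesis by simp
    qed
    then have "hs_op x = hs_op 0"
      by (intro blinfun_eqI) (simp add: hs_op_simps)
    then show "x = 0" by (simp add: hs_op_inject)
  next
    assume "x = 0"
    then show "inner x x = 0"
      using inner_hs_sa_has_sum[of x x] by (simp add: hs_op_simps has_sum_unique)
  qed
qed (simp_all add: norm_hs_sa_def sgn_hs_sa_def dist_hs_sa_def uniformity_hs_sa_def open_hs_sa_def)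

end

lemma norm_hs_sa_has_sum:
  "((\<lambda>e. 4 * (norm (hs_op x e))\<^sup>2) has_sum (norm (x::'a::complex_hilbert hs_sa))\<^sup>2) some_onb"
  using inner_hs_sa_has_sum[of x x] by (simp add: power2_norm_eq_inner)

lemma norm_hs_op_le: "norm (hs_op x) \<le> norm (x::'a::complex_hilbert hs_sa)"
proof (rule norm_blinfun_bound)
  fix v
  have "(norm (hs_op x v))\<^sup>2 \<le> (norm v)\<^sup>2 * (norm x)\<^sup>2"
  proof (rule has_sum_mono)
    show "((\<lambda>e. (cmod (cinner (hs_op x v) e))\<^sup>2) has_sum (norm (hs_op x v))\<^sup>2) some_onb"
      by (rule parseval[OF is_onb_some_onb])
    show "((\<lambda>e. (norm v)\<^sup>2 * (4 * (norm (hs_op x e))\<^sup>2)) has_sum (norm v)\<^sup>2 * (norm x)\<^sup>2) some_onb"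
      by (intro has_sum_cmult_right norm_hs_sa_has_sum)
    fix e
    have "cmod (cinner (hs_op x v) e) \<le> norm v * norm (hs_op x e)"
      using cmod_cinner_le[of v "hs_op x e"] cinner_adj[of "hs_op x" v e] by (simp add: adj_hs_op)
    then have "(cmod (cinner (hs_op x v) e))\<^sup>2 \<le> (norm v)\<^sup>2 * (norm (hs_op x e))\<^sup>2"
      by (simp add: power_mono flip: power_mult_distrib)
    also have "\<dots> \<le> (norm v)\<^sup>2 * (4 * (norm (hs_op x e))\<^sup>2)"
      by (intro mult_left_mono) simp_all
    finally show "(cmod (cinner (hs_op x v) e))\<^sup>2 \<le> (norm v)\<^sup>2 * (4 * (norm (hs_op x e))\<^sup>2)" .
  qed
  then have "(norm (hs_op x v))\<^sup>2 \<le> (norm x * norm v)\<^sup>2"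
    by (simp only: power_mult_distrib mult.commute)
  then show "norm (hs_op x v) \<le> norm x * norm v"
    by (rule power2_le_imp_le) simp
qed simp

lemma norm_hs_sa: "norm x = 2 * sqrt (Re (trace_op (adj (hs_op x) o\<^sub>L hs_op x)))"
  by (simp add: norm_hs_sa_def inner_hs_sa_def adj_hs_op real_sqrt_mult)

lemma inner_hs_sa:
  fixes x y :: "'a::complex_hilbert hs_sa"
  shows "complex_of_real (inner x y) = 4 * trace_op (hs_op y o\<^sub>L hs_op x)"
proof -
  let ?x = "hs_op x" and ?y = "hs_op y"
  have HS: "hilbert_schmidt (?x + scaleC_op c ?y)" for c
    by (intro hilbert_schmidt_add hilbert_schmidt_scaleC hilbert_schmidt_hs_op)
  have ad: "adj (?x + scaleC_op \<i> ?y) = ?x + scaleC_op (- \<i>) ?y"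
    by (simp add: adj_add adj_scaleC adj_hs_op)
  define p where "p = (\<lambda>e. (norm ((?x + scaleC_op \<i> ?y) e))\<^sup>2)"
  define q where "q = (\<lambda>e. (norm ((?x + scaleC_op (- \<i>) ?y) e))\<^sup>2)"
  have "infsum q some_onb = infsum p some_onb"
    using hs_sum_adj_eq[OF HS[of \<i>] is_onb_some_onb is_onb_some_onb] by (simp only: ad p_def q_def)
  moreover have "(p has_sum infsum p some_onb) some_onb" "(q has_sum infsum q some_onb) some_onb"
    unfolding p_def q_def
    by (intro has_sum_infsum hilbert_schmidt_summable HS is_onb_some_onb)+
  ultimately have "((\<lambda>e. p e + - q e) has_sum (infsum p some_onb + - infsum p some_onb)) some_onb"
    by (intro has_sum_add has_sum_uminusI) simp_all
  moreover have "p e + - q e = 4 * Im (cinner (?x e) (?y e))" for e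
  proof -
    have *: "(norm (u + v))\<^sup>2 + - (norm (u + - v))\<^sup>2 = 4 * inner u v" for u v :: 'a
      by (simp add: power2_norm_eq_inner inner_add inner_diff inner_commute)
    have "- \<i> *\<^sub>C ?y e = - (\<i> *\<^sub>C ?y e)"
      by (rule complex_vec.scale_minus_left)
    then show ?thesis
      unfolding p_def q_def Im_cinner *[symmetric] blinfun.add_left scaleC_op.rep_eq by (simp only:)
  qed
  ultimately have "((\<lambda>e. 4 * Im (cinner (?x e) (?y e))) has_sum 0) some_onb"
    by (simp only: add.right_inverse)
  moreover have "((\<lambda>e. cinner (?x e) (?y e)) has_sum trace_op (?y o\<^sub>L ?x)) some_onb"
    using trace_adj_comp[OF hilbert_schmidt_hs_op hilbert_schmidt_hs_op, of x y]
    by (simp only: adj_hs_op)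
  then have "((\<lambda>e. 4 * Im (cinner (?x e) (?y e))) has_sum 4 * Im (trace_op (?y o\<^sub>L ?x))) some_onb"
    by (rule has_sum_cmult_right[OF has_sum_Im])
  ultimately have "4 * Im (trace_op (?y o\<^sub>L ?x)) = 0"
    using has_sum_unique by blast
  then show ?thesis
    by (simp add: complex_eq_iff inner_hs_sa_def)
qed

instance hs_sa :: (complex_hilbert) complete_space
proof
  fix X :: "nat \<Rightarrow> 'a hs_sa" assume X: "Cauchy X"
  have "Cauchy (\<lambda>n. hs_op (X n))"
  proof (rule CauchyI)
    fix e :: real assume "0 < e"
    obtain M where M: "\<forall>m\<ge>M. \<forall>n\<ge>M. norm (X m - X n) < e"
      using CauchyD[OF X \<open>0 < e\<close>] by blast
    have "norm (hs_op (X m) - hs_op (X n)) \<le> norm (X m - X n)" for m n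
      using norm_hs_op_le[of "X m - X n"] by (simp add: hs_op_simps)
    then have "norm (hs_op (X m) - hs_op (X n)) < e" if "m \<ge> M" "n \<ge> M" for m n
      by (rule order_le_less_trans) (use M that in blast)
    then show "\<exists>M. \<forall>m\<ge>M. \<forall>n\<ge>M. norm (hs_op (X m) - hs_op (X n)) < e"
      by blast
  qed
  then obtain T where T: "(\<lambda>n. hs_op (X n)) \<longlonglongrightarrow> T"
    using Cauchy_convergent[of "\<lambda>n. hs_op (X n)"] by (auto simp: convergent_def)
  then have Tv: "(\<lambda>n. hs_op (X n) v) \<longlonglongrightarrow> T v" for v
    by (intro blinfun.tendsto) auto
  have Tb: "T \<in> bounded_ops"
    unfolding bounded_ops_def
  proof (intro CollectI allI)
    fix c v
    have "(\<lambda>n. c *\<^sub>C hs_op (X n) v) \<longlonglongrightarrow> c *\<^sub>C T v"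
      by (rule bounded_linear.tendsto[OF bounded_linear_scaleC Tv])
    moreover have "(\<lambda>n. c *\<^sub>C hs_op (X n) v) \<longlonglongrightarrow> T (c *\<^sub>C v)"
      using Tv[of "c *\<^sub>C v"] by (simp add: bounded_opsD)
    ultimately show "T (c *\<^sub>C v) = c *\<^sub>C T v"
      by (rule LIMSEQ_unique[symmetric])
  qed
  have sa: "inner (T u) v = inner u (T v)" for u v
  proof (rule LIMSEQ_unique)
    show "(\<lambda>n. inner (hs_op (X n) u) v) \<longlonglongrightarrow> inner (T u) v"
      by (intro tendsto_intros Tv)
    have "inner (hs_op (X n) u) v = inner u (hs_op (X n) v)" for n
      using cinner_adj[of "hs_op (X n)" u v] by (simp add: adj_hs_op flip: Re_cinner)
    then show "(\<lambda>n. inner (hs_op (X n) u) v) \<longlonglongrightarrow> inner u (T v)"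
      by (simp, intro tendsto_intros Tv)
  qed
  have Ta: "adj T = T"
    by (rule adj_unique) (simp add: complex_eq_iff Re_cinner Im_cinner sa flip: bounded_opsD[OF Tb])
  have fin: "(\<Sum>e\<in>F. 4 * (norm ((hs_op (X m) - T) e))\<^sup>2) \<le> r\<^sup>2"
    if F: "finite F" "F \<subseteq> some_onb" and r: "\<forall>n\<ge>m. norm (X m - X n) < r" for F m r
  proof (rule LIMSEQ_le_const2)
    show "(\<lambda>n. \<Sum>e\<in>F. 4 * (norm ((hs_op (X m) - hs_op (X n)) e))\<^sup>2)
        \<longlonglongrightarrow> (\<Sum>e\<in>F. 4 * (norm ((hs_op (X m) - T) e))\<^sup>2)"
      by (simp only: blinfun.diff_left) (intro tendsto_intros Tv)
    have "(\<Sum>e\<in>F. 4 * (norm ((hs_op (X m) - hs_op (X n)) e))\<^sup>2) \<le> r\<^sup>2" if "n \<ge> m" for n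
    proof -
      have "(\<Sum>e\<in>F. 4 * (norm (hs_op (X m - X n) e))\<^sup>2) \<le> (norm (X m - X n))\<^sup>2"
        by (rule finite_sum_le_has_sum[OF norm_hs_sa_has_sum F]) simp
      also have "\<dots> \<le> r\<^sup>2"
        using r that by (intro power_mono) (auto intro: less_imp_le)
      finally show ?thesis by (simp add: hs_op_simps)
    qed
    then show "\<exists>N. \<forall>n\<ge>N. (\<Sum>e\<in>F. 4 * (norm ((hs_op (X m) - hs_op (X n)) e))\<^sup>2) \<le> r\<^sup>2"
      by blast
  qed
  obtain m where m: "\<forall>n\<ge>m. norm (X m - X n) < 1"
    using CauchyD[OF X zero_less_one] by blast
  have "(\<lambda>e. 4 * (norm ((hs_op (X m) - T) e))\<^sup>2) summable_on some_onb"
  proof (rule nonneg_bdd_above_summable_on)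
    show "bdd_above (sum (\<lambda>e. 4 * (norm ((hs_op (X m) - T) e))\<^sup>2) ` {F. F \<subseteq> some_onb \<and> finite F})"
      by (rule bdd_aboveI2) (use fin[OF _ _ m] in blast)
  qed simp
  then have "(\<lambda>e. (1/4) * (4 * (norm ((hs_op (X m) - T) e))\<^sup>2)) summable_on some_onb"
    by (rule summable_on_cmult_right)
  then have "hilbert_schmidt (hs_op (X m) - T)"
    by (intro hilbert_schmidtI[OF _ is_onb_some_onb]) (simp_all add: Tb)
  then have "hilbert_schmidt (hs_op (X m) + (-1) *\<^sub>R (hs_op (X m) - T))"
    by (intro hilbert_schmidt_add hilbert_schmidt_scaleR hilbert_schmidt_hs_op)
  then have "hilbert_schmidt T" by simp
  then obtain t where t: "hs_op t = T"
    by (metis (mono_tags, lifting) Ta hs_op_cases mem_Collect_eq)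
  have "X \<longlonglongrightarrow> t"
  proof (rule LIMSEQ_I)
    fix e :: real assume e: "0 < e"
    obtain M where M: "\<forall>m\<ge>M. \<forall>n\<ge>M. norm (X m - X n) < e / 2"
      using CauchyD[OF X half_gt_zero[OF e]] by blast
    have "norm (X m - t) < e" if "m \<ge> M" for m
    proof -
      have "(norm (X m - t))\<^sup>2 \<le> (e/2)\<^sup>2"
      proof (rule has_sum_le_finite_sums[OF norm_hs_sa_has_sum])
        fix F assume F: "finite F" "F \<subseteq> (some_onb :: 'a set)"
        have "\<forall>n\<ge>m. norm (X m - X n) < e / 2"
        proof (intro allI impI)
          fix n assume "m \<le> n"
          with \<open>M \<le> m\<close> have "M \<le> n" by linarith
          with \<open>M \<le> m\<close> M show "norm (X m - X n) < e / 2" by blast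
        qed
        from fin[OF F this] show "(\<Sum>k\<in>F. 4 * (norm (hs_op (X m - t) k))\<^sup>2) \<le> (e/2)\<^sup>2"
          unfolding hs_op_simps t .
      qed
      then have "norm (X m - t) \<le> e / 2"
        by (rule power2_le_imp_le) (use e in simp)
      then show ?thesis using e by simp
    qed
    then show "\<exists>M. \<forall>m\<ge>M. norm (X m - t) < e" by blast
  qed
  then show "convergent X" by (rule convergentI)
qed

instance hs_sa :: (complex_hilbert) banach ..

section \<open>The unitary group and its orbits\<close>

definition unitary_hs :: "('a::complex_hilbert \<Rightarrow>\<^sub>L 'a) set"
  where "unitary_hs = {g. (\<exists>x. hilbert_schmidt x \<and> g = id_blinfun + x) \<and>
    adj g o\<^sub>L g = id_blinfun \<and> g o\<^sub>L adj g = id_blinfun}"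

definition unitary_orbit :: "'a::complex_hilbert hs_sa \<Rightarrow> 'a hs_sa set"
  where "unitary_orbit a = {b. \<exists>g\<in>unitary_hs. hs_op b = g o\<^sub>L hs_op a o\<^sub>L adj g}"

lemma unitary_hs_bounded_ops: "g \<in> unitary_hs \<Longrightarrow> g \<in> bounded_ops"
  unfolding unitary_hs_def using hilbert_schmidt_bounded_ops bounded_ops_simps(2,3) by blast

lemma hs_op_conj:
  assumes g: "g \<in> bounded_ops"
  shows "\<exists>b. hs_op b = g o\<^sub>L hs_op a o\<^sub>L adj g"
proof -
  let ?b = "g o\<^sub>L hs_op a o\<^sub>L adj g"
  have "hilbert_schmidt (g o\<^sub>L hs_op a)"
    by (rule hilbert_schmidt_comp_left[OF hilbert_schmidt_hs_op g])
  then have "hilbert_schmidt ?b"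
    by (rule hilbert_schmidt_comp_right) (rule adj_in_bounded_ops[OF g])
  moreover have "adj ?b = ?b"
    by (rule adj_unique) (simp add: g cinner_adj cinner_adj' adj_adj adj_hs_op)
  ultimately have "hs_op (Abs_hs_sa ?b) = ?b"
    by (intro Abs_hs_sa_inverse) simp
  then show ?thesis by blast
qed

lemma hs_op_unitary_orbit:
  "hs_op ` unitary_orbit a = {g o\<^sub>L hs_op a o\<^sub>L adj g | g. g \<in> unitary_hs}"
proof (intro equalityI subsetI)
  fix T assume "T \<in> {g o\<^sub>L hs_op a o\<^sub>L adj g | g. g \<in> unitary_hs}"
  then obtain g where g: "g \<in> unitary_hs" and T: "T = g o\<^sub>L hs_op a o\<^sub>L adj g" by blast
  obtain b where b: "hs_op b = T"
    unfolding T using hs_op_conj[OF unitary_hs_bounded_ops[OF g]] by blast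
  then have "b \<in> unitary_orbit a"
    using g T unfolding unitary_orbit_def by blast
  then show "T \<in> hs_op ` unitary_orbit a"
    using b by blast
next
  fix T assume "T \<in> hs_op ` unitary_orbit a"
  then show "T \<in> {g o\<^sub>L hs_op a o\<^sub>L adj g | g. g \<in> unitary_hs}"
    unfolding unitary_orbit_def by blast
qed

section \<open>C*-algebras of operators\<close>

definition cstar_subalgebra :: "('a::complex_hilbert \<Rightarrow>\<^sub>L 'a) set \<Rightarrow> bool"
  where "cstar_subalgebra A \<longleftrightarrow> A \<subseteq> bounded_ops \<and> 0 \<in> A \<and>
    (\<forall>S\<in>A. \<forall>T\<in>A. S + T \<in> A) \<and> (\<forall>c. \<forall>T\<in>A. scaleC_op c T \<in> A) \<and>
    (\<forall>S\<in>A. \<forall>T\<in>A. S o\<^sub>L T \<in> A) \<and> (\<forall>T\<in>A. adj T \<in> A) \<and> closed A"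

definition cstar_generated :: "('a::complex_hilbert \<Rightarrow>\<^sub>L 'a) \<Rightarrow> ('a \<Rightarrow>\<^sub>L 'a) set"
  where "cstar_generated a = cstar_subalgebra hull {id_blinfun, a}"

definition finite_dimensional_ops :: "('a::complex_hilbert \<Rightarrow>\<^sub>L 'a) set \<Rightarrow> bool"
  where "finite_dimensional_ops A \<longleftrightarrow> (\<exists>B. finite B \<and> A = op_span B)"

lemma cstar_subalgebra_bounded_ops: "cstar_subalgebra (bounded_ops :: ('a::complex_hilbert \<Rightarrow>\<^sub>L 'a) set)"
proof -
  have "bounded_ops = (\<Inter>c. \<Inter>x. {T :: 'a \<Rightarrow>\<^sub>L 'a. T (c *\<^sub>C x) = c *\<^sub>C T x})"
    by (auto simp: bounded_ops_def)
  moreover have "closed {T :: 'a \<Rightarrow>\<^sub>L 'a. T (c *\<^sub>C x) = c *\<^sub>C T x}" for c x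
    by (intro closed_Collect_eq bounded_linear.continuous_on[OF bounded_linear_scaleC] continuous_intros)
  then have "closed (\<Inter>c. \<Inter>x. {T :: 'a \<Rightarrow>\<^sub>L 'a. T (c *\<^sub>C x) = c *\<^sub>C T x})"
    by (intro closed_INT ballI)
  ultimately have "closed (bounded_ops :: ('a \<Rightarrow>\<^sub>L 'a) set)"
    by (simp only:)
  then show ?thesis by (simp add: cstar_subalgebra_def)
qed

lemma cstar_subalgebra_cstar_generated:
  fixes a :: "'a::complex_hilbert \<Rightarrow>\<^sub>L 'a"
  assumes "a \<in> bounded_ops"
  shows "cstar_subalgebra (cstar_generated a)"
proof -
  define \<A> where "\<A> = {A. cstar_subalgebra A \<and> {id_blinfun, a} \<subseteq> A}"
  have gen: "cstar_generated a = \<Inter>\<A>"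
    by (simp add: cstar_generated_def hull_def \<A>_def)
  have A: "cstar_subalgebra A" if "A \<in> \<A>" for A
    using that by (simp add: \<A>_def)
  note A = A[unfolded cstar_subalgebra_def]
  have "bounded_ops \<in> \<A>"
    using assms by (simp add: \<A>_def cstar_subalgebra_bounded_ops)
  then have "\<Inter>\<A> \<subseteq> bounded_ops"
    by (rule Inter_lower)
  moreover have "0 \<in> \<Inter>\<A>"
    by (rule InterI) (drule A, elim conjE)
  moreover have "closed (\<Inter>\<A>)"
    by (intro closed_Inter ballI) (drule A, elim conjE)
  moreover have "S + T \<in> \<Inter>\<A>" "S o\<^sub>L T \<in> \<Inter>\<A>" if ST: "S \<in> \<Inter>\<A>" "T \<in> \<Inter>\<A>" for S T
  proof (safe intro!: InterI)
    fix A assume "A \<in> \<A>"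
    then have "S \<in> A" "T \<in> A" using ST by blast+
    with A[OF \<open>A \<in> \<A>\<close>] show "S + T \<in> A" "S o\<^sub>L T \<in> A" by (elim conjE; metis)+
  qed
  moreover have "scaleC_op c T \<in> \<Inter>\<A>" "adj T \<in> \<Inter>\<A>" if T: "T \<in> \<Inter>\<A>" for c T
  proof (safe intro!: InterI)
    fix A assume "A \<in> \<A>"
    then have "T \<in> A" using T by blast
    with A[OF \<open>A \<in> \<A>\<close>] show "scaleC_op c T \<in> A" "adj T \<in> A" by (elim conjE; metis)+
  qed
  ultimately show ?thesis
    unfolding gen cstar_subalgebra_def by (intro conjI ballI allI)
qed

section \<open>Analytic maps and submanifolds\<close>

text \<open>
  An \<open>n\<close>-linear map takes its arguments from a sequence, of which only the first \<open>n\<close> entries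
  matter; it is bounded by \<open>C\<close> in the usual norm of multilinear maps.
\<close>

definition bounded_multilinear ::
    "nat \<Rightarrow> ((nat \<Rightarrow> 'a::real_normed_vector) \<Rightarrow> 'b::real_normed_vector) \<Rightarrow> real \<Rightarrow> bool"
  where "bounded_multilinear n A C \<longleftrightarrow>
    (\<forall>v w. (\<forall>i<n. v i = w i) \<longrightarrow> A v = A w) \<and>
    (\<forall>v. \<forall>i<n. linear (\<lambda>x. A (v(i := x)))) \<and>
    (\<forall>v. norm (A v) \<le> C * (\<Prod>i<n. norm (v i)))"

text \<open>
  Real analyticity between normed spaces: around every point of the open set \<open>U\<close> the map is the
  sum of a power series of bounded homogeneous polynomials \<open>A\<^sub>n(h, \<dots>, h)\<close> that converges normally
  on a ball.
\<close>

definition real_analytic_on ::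
    "('a::real_normed_vector \<Rightarrow> 'b::real_normed_vector) \<Rightarrow> 'a set \<Rightarrow> bool"
  where "real_analytic_on f U \<longleftrightarrow> open U \<and> (\<forall>p\<in>U. \<exists>A C. \<exists>r>0.
    (\<forall>n. bounded_multilinear n (A n) (C n)) \<and> summable (\<lambda>n. C n * r ^ n) \<and>
    (\<forall>h. norm h < r \<longrightarrow> (\<lambda>n. A n (\<lambda>_. h)) sums f (p + h)))"

definition analytic_diffeomorphism ::
    "'a::real_normed_vector set \<Rightarrow> 'b::real_normed_vector set \<Rightarrow> ('a \<Rightarrow> 'b) \<Rightarrow> ('b \<Rightarrow> 'a) \<Rightarrow> bool"
  where "analytic_diffeomorphism U V \<phi> \<psi> \<longleftrightarrow>
    real_analytic_on \<phi> U \<and> real_analytic_on \<psi> V \<and> \<phi> ` U = V \<and> \<psi> ` V = U \<and>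
    (\<forall>x\<in>U. \<psi> (\<phi> x) = x) \<and> (\<forall>y\<in>V. \<phi> (\<psi> y) = y)"

text \<open>
  Submanifolds are embedded: near each of its points, \<open>S\<close> is flattened by an analytic chart of the
  ambient space onto a closed subspace \<open>F\<close>, the model space of \<open>S\<close>, which is the same at all points.
  In a Hilbert space every closed subspace is complemented, so no splitting condition is needed.
\<close>

definition analytic_submanifold :: "'a::{real_inner,complete_space} set \<Rightarrow> bool"
  where "analytic_submanifold S \<longleftrightarrow> (\<exists>F :: 'a set. subspace F \<and> closed F \<and>
    (\<forall>p\<in>S. \<exists>U V \<phi> \<psi>. p \<in> U \<and> analytic_diffeomorphism U V \<phi> \<psi> \<and> \<phi> ` (S \<inter> U) = F \<inter> V))"

end

theory Submission
  imports Defs "HOL-Computational_Algebra.Fundamental_Theorem_Algebra"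
begin

text \<open>
  Finite dimensionality of \<open>C\<^sup>*(a)\<close> means that \<open>a = \<Sum> \<eta> E\<^sub>\<eta>\<close> is a finite sum. Let \<open>F\<close> be the space of
  operators \<open>z\<close> without diagonal blocks \<open>E\<^sub>\<eta> z E\<^sub>\<eta>\<close>. The commutator with \<open>a\<close> is invertible on \<open>F\<close>, so every
  \<open>z\<close> can be written as \<open>z = d - 2 [a, K]\<close> with \<open>d\<close> block diagonal and \<open>K\<close> skew-adjoint. The chart is the inverse
  of \<open>z \<mapsto> u (a + d) u\<^sup>* - a\<close>, where \<open>u = (1 - K)\<^sup>-\<^sup>1 (1 + K)\<close>. It flattens the orbit, since \<open>a + d\<close> with \<open>d\<close>
  smaller than the spectral gaps is unitarily equivalent to \<open>a\<close> only if \<open>d = 0\<close>.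

  Cleared of inverses, the equation \<open>a + b = u (a + d) u\<^sup>*\<close> is a polynomial relation between \<open>b\<close> and
  \<open>z\<close>. With two auxiliary unknowns it is quadratic, and it can be solved for \<open>z\<close> as well as for \<open>b\<close> by
  the power series of the inverse of a map \<open>x \<mapsto> x + Q x x\<close>, whose coefficients obey a recursion of
  Catalan type. Conjugation transports the chart to the other points of the orbit.
\<close>

text \<open>Analyticity means convergent power series here, so the chart is chosen to have an
  explicit series in both directions. The Cayley transform serves because it is rational: the
  factors 1 - K and 1 + K can be multiplied away, while an exponential would leave a transcendental
  relation. After that, affine substitutions into one family of inverse power series suffice.

  The factor 2 in z = d - 2 [a, K] is a normalisation. To first order u is 1 + 2 K, hence the
  parametrisation begins with z itself, and the equation to be solved has the identity as its linear
  part.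

  The obstacle to an embedded structure is that the orbit might return to a neighbourhood of a
  through unitaries far from 1. Conjugation by u only shows that small z in F give orbit points; the
  converse has to deal with an arbitrary g. There the positive distance between the finitely many
  eigenvalues enters, in an argument that puts no bound on g - 1.\<close>

section \<open>Power series solutions of quadratic equations\<close>

text \<open>M h is the fixed point of the contraction u |-> h - T u. Its uniqueness yields linearity
  and the left inverse property at once.\<close>

lemma bounded_linear_Neumann:
  fixes T :: "'a::banach \<Rightarrow> 'a"
  assumes T: "bounded_linear T" and le: "\<And>x. norm (T x) \<le> norm x / 2"
  obtains M where "bounded_linear M" "\<And>x. M x + T (M x) = x" "\<And>x. M (x + T x) = x"
proof -
  interpret T: bounded_linear T by fact
  have "\<exists>!u. h - T u = u" for h
  proof (rule banach_fix_type)
    show "\<forall>x y. dist (h - T x) (h - T y) \<le> (1/2) * dist x y"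
    proof (intro allI)
      fix x y
      have "dist (h - T x) (h - T y) = norm (T (y - x))"
        by (simp add: dist_norm T.diff)
      then show "dist (h - T x) (h - T y) \<le> (1/2) * dist x y"
        using le[of "y - x"] by (simp add: dist_norm norm_minus_commute)
    qed
  qed auto
  moreover have "h - T u = u \<longleftrightarrow> u + T u = h" for h u
    by (auto simp: algebra_simps)
  ultimately have ex1: "\<exists>!u. u + T u = h" for h
    by simp
  then obtain M where M: "M h + T (M h) = h" for h by metis
  have uniq: "M h = u" if "u + T u = h" for u h
    using ex1[of h] M[of h] that by blast
  have "bounded_linear M"
  proof (rule bounded_linear_intro)
    show "M (x + y) = M x + M y" for x y
      by (rule uniq) (metis M T.add add.assoc add.left_commute)
    show "M (r *\<^sub>R x) = r *\<^sub>R M x" for r x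
      by (rule uniq) (metis M T.scaleR scaleR_add_right)
    show "norm (M x) \<le> norm x * 2" for x
    proof -
      have "norm (M x) \<le> norm (M x + T (M x)) + norm (T (M x))"
        by (metis norm_triangle_ineq4 add_diff_cancel_right')
      also have "\<dots> \<le> norm x + norm (M x) / 2"
        using le[of "M x"] by (simp add: M)
      finally show ?thesis by simp
    qed
  qed
  then show ?thesis
    using that M uniq by blast
qed

text \<open>Square partial sums converge to Q x y because Q is continuous. They differ from the
  triangular ones by the terms with i + j >= n, and these are dominated by the same terms of the
  product of the two norm series, where the scalar Cauchy product applies.\<close>

lemma bounded_bilinear_Cauchy_product:
  assumes Q: "bounded_bilinear Q"
    and a: "summable (\<lambda>k. norm (a k))" "a sums x" and b: "summable (\<lambda>k. norm (b k))" "b sums y"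
  shows "(\<lambda>k. \<Sum>i\<le>k. Q (a i) (b (k - i))) sums Q x y"
proof -
  interpret Q: bounded_bilinear Q by fact
  obtain K where K: "\<And>x y. norm (Q x y) \<le> norm x * norm y * K"
    using Q.bounded by blast
  let ?D = "\<lambda>n. {..<n} \<times> {..<n} - {(i, j). i + j < n}"
  have diff: "(\<Sum>(i, j)\<in>?D n. g i j) = (\<Sum>i<n. \<Sum>j<n. g i j) - (\<Sum>k<n. \<Sum>i\<le>k. g i (k - i))"
    for g :: "nat \<Rightarrow> nat \<Rightarrow> 'd::ab_group_add" and n
    by (subst sum_diff) (auto simp: sum.cartesian_product sum.triangle_reindex)
  let ?p = "\<lambda>i j. norm (a i) * norm (b j)"
  have "(\<lambda>n. (\<Sum>i<n. norm (a i)) * (\<Sum>j<n. norm (b j)) - (\<Sum>k<n. \<Sum>i\<le>k. ?p i (k - i))) \<longlonglongrightarrow>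
     (\<Sum>i. norm (a i)) * (\<Sum>j. norm (b j)) - (\<Sum>i. norm (a i)) * (\<Sum>j. norm (b j))"
    using a b Cauchy_product_sums[of "\<lambda>k. norm (a k)" "\<lambda>k. norm (b k)"]
    by (intro tendsto_diff tendsto_mult) (simp_all add: sums_def[symmetric] summable_sums)
  then have "(\<lambda>n. \<Sum>(i, j)\<in>?D n. ?p i j) \<longlonglongrightarrow> 0"
    unfolding diff by (simp add: sum_product)
  then have "(\<lambda>n. (\<Sum>(i, j)\<in>?D n. ?p i j) * K) \<longlonglongrightarrow> 0"
    by (rule tendsto_mult_left_zero)
  then have "(\<lambda>n. \<Sum>(i, j)\<in>?D n. Q (a i) (b j)) \<longlonglongrightarrow> 0"
  proof (rule Lim_null_comparison[rotated])
    show "\<forall>\<^sub>F n in sequentially. norm (\<Sum>(i, j)\<in>?D n. Q (a i) (b j)) \<le> (\<Sum>(i, j)\<in>?D n. ?p i j) * K"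
      unfolding sum_distrib_right
      by (intro always_eventually allI sum_norm_le) (auto simp: K)
  qed
  moreover have prod_sum: "(\<Sum>i<n. \<Sum>j<n. Q (a i) (b j)) = Q (\<Sum>i<n. a i) (\<Sum>j<n. b j)" for n
    by (simp only: Q.sum_left) (simp only: Q.sum_right)
  ultimately have "(\<lambda>n. Q (\<Sum>i<n. a i) (\<Sum>j<n. b j) - (\<Sum>k<n. \<Sum>i\<le>k. Q (a i) (b (k - i)))) \<longlonglongrightarrow> 0"
    by (simp only: diff prod_sum)
  moreover have "(\<lambda>n. Q (\<Sum>i<n. a i) (\<Sum>j<n. b j)) \<longlonglongrightarrow> Q x y"
    using a(2) b(2) unfolding sums_def by (rule Q.tendsto)
  ultimately have "(\<lambda>n. Q (\<Sum>i<n. a i) (\<Sum>j<n. b j) - (Q (\<Sum>i<n. a i) (\<Sum>j<n. b j) -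
      (\<Sum>k<n. \<Sum>i\<le>k. Q (a i) (b (k - i))))) \<longlonglongrightarrow> Q x y - 0"
    by (intro tendsto_diff)
  then show ?thesis
    by (simp add: sums_def)
qed

text \<open>The homogeneous parts of the power series solution \<open>u\<close> of \<open>u = M h + Q u u\<close>, and their norm bounds.\<close>

function quadratic_coeff :: "('f \<Rightarrow> 'e::real_vector) \<Rightarrow> ('e \<Rightarrow> 'e \<Rightarrow> 'e) \<Rightarrow> nat \<Rightarrow> (nat \<Rightarrow> 'f) \<Rightarrow> 'e" where
  "quadratic_coeff M Q n v = (if n = 1 then M (v 0) else 0) +
    (\<Sum>k\<in>{1..<n}. Q (quadratic_coeff M Q k v) (quadratic_coeff M Q (n - k) (\<lambda>i. v (i + k))))"
  by auto
termination by (relation "Wellfounded.measure (\<lambda>(M, Q, n, v). n)") auto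

fun quadratic_bound :: "real \<Rightarrow> real \<Rightarrow> nat \<Rightarrow> real" where
  "quadratic_bound m K n = (if n = 1 then m else 0) +
    (\<Sum>k\<in>{1..<n}. K * (quadratic_bound m K k * quadratic_bound m K (n - k)))"

declare quadratic_coeff.simps [simp del] quadratic_bound.simps [simp del]

lemma quadratic_coeff_0: "quadratic_coeff M Q 0 v = 0"
  by (subst quadratic_coeff.simps) simp

lemma quadratic_bound_0: "quadratic_bound m K 0 = 0"
  by (subst quadratic_bound.simps) simp

lemma quadratic_bound_nonneg: "0 \<le> m \<Longrightarrow> 0 \<le> K \<Longrightarrow> 0 \<le> quadratic_bound m K n"
proof (induction n rule: less_induct)
  case (less n)
  then show ?case
    by (subst quadratic_bound.simps) (auto intro!: add_nonneg_nonneg sum_nonneg mult_nonneg_nonneg)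
qed

text \<open>In the k-th summand one factor reads the arguments 0, ..., k - 1 and the other, through
  the shift by k, the remaining ones. So every argument enters exactly one factor: this gives
  linearity in each slot, and the two products of norms multiply to the full one.\<close>

lemma bounded_multilinear_quadratic_coeff:
  fixes M :: "'f::real_normed_vector \<Rightarrow> 'e::real_normed_vector"
  assumes M: "bounded_linear M" "\<And>h. norm (M h) \<le> m * norm h"
    and Q: "bounded_bilinear Q" "\<And>x y. norm (Q x y) \<le> K * (norm x * norm y)"
    and nonneg: "0 \<le> m" "0 \<le> K"
  shows "bounded_multilinear n (quadratic_coeff M Q n) (quadratic_bound m K n)"
proof (induction n rule: less_induct)
  case (less n)
  let ?A = "quadratic_coeff M Q" and ?c = "quadratic_bound m K"
  interpret M: bounded_linear M by fact
  interpret Q: bounded_bilinear Q by fact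
  have loc: "?A k v = ?A k w" if "k < n" "\<And>i. i < k \<Longrightarrow> v i = w i" for k v w
    using less.IH[OF that(1)] that(2) unfolding bounded_multilinear_def by blast
  have lin: "linear (\<lambda>x. ?A k (v(i := x)))" if "k < n" "i < k" for k v i
    using less.IH[OF that(1)] that(2) unfolding bounded_multilinear_def by blast
  have bd: "norm (?A k v) \<le> ?c k * (\<Prod>i<k. norm (v i))" if "k < n" for k v
    using less.IH[OF that(1)] unfolding bounded_multilinear_def by blast
  show ?case
    unfolding bounded_multilinear_def
  proof (intro conjI allI impI)
    fix v w :: "nat \<Rightarrow> 'f" assume vw: "\<forall>i<n. v i = w i"
    have "Q (?A k v) (?A (n - k) (\<lambda>i. v (i + k))) = Q (?A k w) (?A (n - k) (\<lambda>i. w (i + k)))"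
      if "k \<in> {1..<n}" for k
      using that vw loc[of k v w] loc[of "n - k" "\<lambda>i. v (i + k)" "\<lambda>i. w (i + k)"] by simp
    then show "?A n v = ?A n w"
      using vw by (subst (1 2) quadratic_coeff.simps) simp
  next
    fix v :: "nat \<Rightarrow> 'f" and i assume i: "i < n"
    have "linear (\<lambda>x. Q (?A k (v(i := x))) (?A (n - k) (\<lambda>j. (v(i := x)) (j + k))))"
      if k: "k \<in> {1..<n}" for k
    proof (cases "i < k")
      case True
      have "(\<lambda>j. (v(i := x)) (j + k)) = (\<lambda>j. v (j + k))" for x
        using True by auto
      then show ?thesis
        using linear_compose[OF lin[OF _ True, of v] bounded_linear.linear[OF Q.bounded_linear_left]] k
        by (simp add: o_def)
    next
      case False
      have "(\<lambda>j. (v(i := x)) (j + k)) = (\<lambda>j. v (j + k))(i - k := x)" for x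
        using False by (auto simp: fun_eq_iff)
      moreover have "?A k (v(i := x)) = ?A k v" for x
        using False k by (intro loc) auto
      ultimately show ?thesis
        using linear_compose[OF lin[of "n - k" "i - k" "\<lambda>j. v (j + k)"]
            bounded_linear.linear[OF Q.bounded_linear_right]] k i False
        by (simp add: o_def)
    qed
    moreover have "linear (\<lambda>x. if n = 1 then M ((v(i := x)) 0) else 0)"
      using i by (cases "n = 1") (auto simp: linear_iff M.add M.scaleR)
    ultimately show "linear (\<lambda>x. ?A n (v(i := x)))"
      by (subst quadratic_coeff.simps) (intro linear_compose_add linear_compose_sum ballI)
  next
    fix v :: "nat \<Rightarrow> 'f"
    have prod_split: "(\<Prod>i<k. norm (v i)) * (\<Prod>i<n-k. norm (v (i + k))) = (\<Prod>i<n. norm (v i))"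
      if "k \<in> {1..<n}" for k
    proof -
      have "(\<Prod>i<n. norm (v i)) = (\<Prod>i\<in>{0..<k}. norm (v i)) * (\<Prod>i\<in>{k..<n}. norm (v i))"
        using that prod.atLeastLessThan_concat[of 0 k n "\<lambda>i. norm (v i)"] by (simp add: lessThan_atLeast0)
      also have "(\<Prod>i\<in>{k..<n}. norm (v i)) = (\<Prod>i<n-k. norm (v (i + k)))"
        using that prod.shift_bounds_nat_ivl[of "\<lambda>i. norm (v i)" 0 k "n - k"] by (simp add: lessThan_atLeast0)
      finally show ?thesis by (simp add: lessThan_atLeast0)
    qed
    have "norm (?A n v) \<le> (if n = 1 then m else 0) * (\<Prod>i<n. norm (v i)) +
        (\<Sum>k\<in>{1..<n}. K * (?c k * ?c (n - k)) * (\<Prod>i<n. norm (v i)))"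
    proof (subst quadratic_coeff.simps, intro order_trans[OF norm_triangle_ineq] add_mono sum_norm_le)
      show "norm (if n = 1 then M (v 0) else 0) \<le> (if n = 1 then m else 0) * (\<Prod>i<n. norm (v i))"
        using M(2)[of "v 0"] by simp
    next
      fix k assume k: "k \<in> {1..<n}"
      have "norm (Q (?A k v) (?A (n - k) (\<lambda>i. v (i + k)))) \<le>
          K * ((?c k * (\<Prod>i<k. norm (v i))) * (?c (n - k) * (\<Prod>i<n-k. norm (v (i + k)))))"
        using k nonneg by (intro order_trans[OF Q(2)] mult_left_mono mult_mono bd mult_nonneg_nonneg
          quadratic_bound_nonneg prod_nonneg) auto
      also have "\<dots> = K * (?c k * ?c (n - k)) * (\<Prod>i<n. norm (v i))"
        by (simp only: prod_split[OF k, symmetric] mult_ac)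
      finally show "norm (Q (?A k v) (?A (n - k) (\<lambda>i. v (i + k)))) \<le> \<dots>" .
    qed
    also have "\<dots> = ?c n * (\<Prod>i<n. norm (v i))"
      by (subst (3) quadratic_bound.simps) (simp only: sum_distrib_right distrib_right)
    finally show "norm (?A n v) \<le> ?c n * (\<Prod>i<n. norm (v i))" .
  qed
qed

text \<open>The pairs (k, n - k) are distinct and lie in a square. Since both entries are at least
  1, n <= N leaves both of them below N; this gain of one index drives the induction for
  \<open>sum_quadratic_bound_le\<close>.\<close>

lemma sum_convolution_le_power2:
  fixes f :: "nat \<Rightarrow> real"
  assumes "\<And>i. 0 \<le> f i"
  shows "(\<Sum>n<Suc N. \<Sum>k\<in>{1..<n}. f k * f (n - k)) \<le> (\<Sum>n<N. f n)\<^sup>2"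
proof -
  have "(\<Sum>n<Suc N. \<Sum>k\<in>{1..<n}. f k * f (n - k)) =
      (\<Sum>(n, k)\<in>(SIGMA n:{..<Suc N}. {1..<n}). f k * f (n - k))"
    by (subst sum.Sigma) auto
  also have "\<dots> = (\<Sum>(i, j)\<in>(\<lambda>(n, k). (k, n - k)) ` (SIGMA n:{..<Suc N}. {1..<n}). f i * f j)"
    by (subst sum.reindex) (auto simp: inj_on_def case_prod_unfold)
  also have "\<dots> \<le> (\<Sum>(i, j)\<in>{..<N} \<times> {..<N}. f i * f j)"
    using assms by (intro sum_mono2) auto
  also have "\<dots> = (\<Sum>n<N. f n)\<^sup>2"
    by (simp add: power2_eq_square sum_product sum.cartesian_product)
  finally show ?thesis .
qed

text \<open>The partial sums satisfy s(N + 1) <= m r + K s(N)^2, and the bound 2 m r reproduces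
  itself because K (2 m r)^2 = (4 K m r) (m r) <= m r. No closed form of the Catalan-type numbers is
  involved.\<close>

lemma sum_quadratic_bound_le:
  assumes "0 \<le> m" "0 \<le> K" "0 \<le> r" "4 * K * m * r \<le> 1"
  shows "(\<Sum>n<N. quadratic_bound m K n * r ^ n) \<le> 2 * m * r"
proof (induction N)
  case 0
  then show ?case using assms by simp
next
  case (Suc N)
  let ?f = "\<lambda>n. quadratic_bound m K n * r ^ n"
  have f0: "0 \<le> ?f n" for n
    using assms by (simp add: quadratic_bound_nonneg)
  have "?f n = (if n = 1 then m * r else 0) + K * (\<Sum>k\<in>{1..<n}. ?f k * ?f (n - k))" for n
  proof -
    have "K * (quadratic_bound m K k * quadratic_bound m K (n - k)) * r ^ n = K * (?f k * ?f (n - k))"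
      if "k \<in> {1..<n}" for k
    proof -
      have "r ^ n = r ^ k * r ^ (n - k)"
        using that by (simp flip: power_add)
      then show ?thesis by simp
    qed
    then have "(\<Sum>k\<in>{1..<n}. K * (quadratic_bound m K k * quadratic_bound m K (n - k))) * r ^ n =
        K * (\<Sum>k\<in>{1..<n}. ?f k * ?f (n - k))"
      unfolding sum_distrib_right sum_distrib_left by (rule sum.cong[OF refl])
    moreover have "(if n = 1 then m else 0) * r ^ n = (if n = 1 then m * r else 0)"
      by simp
    ultimately show ?thesis
      by (subst quadratic_bound.simps) (simp only: distrib_right)
  qed
  then have "(\<Sum>n<Suc N. ?f n) = (\<Sum>n<Suc N. (if n = 1 then m * r else 0) +
      K * (\<Sum>k\<in>{1..<n}. ?f k * ?f (n - k)))"
    by (rule sum.cong[OF refl])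
  also have "\<dots> = (\<Sum>n<Suc N. if n = 1 then m * r else 0)
      + K * (\<Sum>n<Suc N. \<Sum>k\<in>{1..<n}. ?f k * ?f (n - k))"
    by (simp only: sum.distrib sum_distrib_left)
  also have "\<dots> \<le> m * r + K * (\<Sum>n<N. ?f n)\<^sup>2"
  proof (rule add_mono)
    show "(\<Sum>n<Suc N. if n = 1 then m * r else 0) \<le> m * r"
      using assms by (subst sum.delta) auto
  qed (intro mult_left_mono sum_convolution_le_power2 f0 assms)
  also have "\<dots> \<le> m * r + K * (2 * m * r)\<^sup>2"
    using assms Suc f0 by (intro add_left_mono mult_left_mono power_mono sum_nonneg)
  also have "\<dots> = m * r + (4 * K * m * r) * (m * r)"
    by (simp add: power2_eq_square)
  also have "\<dots> \<le> m * r + 1 * (m * r)"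
    using assms by (intro add_left_mono mult_right_mono) auto
  finally show ?case by simp
qed

text \<open>The recursion of the coefficients is the comparison of homogeneous parts in u = M h + Q
  u u; absolute convergence and the Cauchy product turn it back into the equation for the
  sum.\<close>

lemma quadratic_equation_power_series:
  fixes M :: "'f::real_normed_vector \<Rightarrow> 'e::banach"
  assumes M: "bounded_linear M" "\<And>h. norm (M h) \<le> m * norm h"
    and Q: "bounded_bilinear Q" "\<And>x y. norm (Q x y) \<le> K * (norm x * norm y)"
    and nonneg: "0 \<le> m" "0 \<le> K" "0 \<le> r" and r: "4 * K * m * r \<le> 1"
  shows "summable (\<lambda>n. quadratic_bound m K n * r ^ n)"
    and "norm h \<le> r \<Longrightarrow> \<exists>u. (\<lambda>n. quadratic_coeff M Q n (\<lambda>_. h)) sums u \<and> norm u \<le> 2 * m * r \<and>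
      u = M h + Q u u"
proof -
  let ?A = "quadratic_coeff M Q" and ?c = "quadratic_bound m K"
  have c0: "0 \<le> ?c n * r ^ n" for n
    using nonneg by (simp add: quadratic_bound_nonneg)
  show summ: "summable (\<lambda>n. ?c n * r ^ n)"
    by (rule summableI_nonneg_bounded[OF c0]) (rule sum_quadratic_bound_le[OF nonneg r])
  assume h: "norm h \<le> r"
  let ?a = "\<lambda>n. ?A n (\<lambda>_. h)"
  have a: "norm (?a n) \<le> ?c n * r ^ n" for n
  proof -
    have "norm (?a n) \<le> ?c n * (\<Prod>i<n. norm h)"
      using bounded_multilinear_quadratic_coeff[OF M Q nonneg(1,2), of n]
      unfolding bounded_multilinear_def by blast
    then have "norm (?a n) \<le> ?c n * norm h ^ n"
      by simp
    also have "\<dots> \<le> ?c n * r ^ n"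
      using nonneg h by (intro mult_left_mono power_mono) (simp_all add: quadratic_bound_nonneg)
    finally show ?thesis .
  qed
  have sn: "summable (\<lambda>n. norm (?a n))"
    by (rule summable_comparison_test'[OF summ]) (simp add: a)
  define u where "u = suminf ?a"
  have u: "?a sums u"
    unfolding u_def by (rule summable_sums[OF summable_norm_cancel[OF sn]])
  have "norm u \<le> (\<Sum>n. ?c n * r ^ n)"
    using summable_norm[OF sn] suminf_le[OF a sn summ] unfolding u_def by (rule order_trans)
  also have "\<dots> \<le> 2 * m * r"
    by (rule suminf_le_const[OF summ]) (rule sum_quadratic_bound_le[OF nonneg r])
  finally have nu: "norm u \<le> 2 * m * r" .
  interpret Q: bounded_bilinear Q by fact
  \<comment> \<open>The recursion omits the indices 0 and n, the Cauchy product has them; the extra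
    terms contain the coefficient of degree 0, which is zero.\<close>
  have rec: "?a n = (if n = 1 then M h else 0) + (\<Sum>k\<le>n. Q (?a k) (?a (n - k)))" for n
  proof -
    have "(\<Sum>k\<le>n. Q (?a k) (?a (n - k))) = (\<Sum>k\<in>{1..<n}. Q (?a k) (?a (n - k)))"
      by (rule sum.mono_neutral_right)
        (auto simp: quadratic_coeff_0 Q.zero_left Q.zero_right Suc_le_eq not_less dest: le_antisym)
    then show ?thesis
      by (subst quadratic_coeff.simps) simp
  qed
  have "(\<lambda>n. (if n = 1 then M h else 0) + (\<Sum>k\<le>n. Q (?a k) (?a (n - k)))) sums (M h + Q u u)"
    using sums_single[of 1 "\<lambda>_. M h"]
    by (intro sums_add bounded_bilinear_Cauchy_product Q(1) sn u) simp
  then have "?a sums (M h + Q u u)"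
    by (simp only: rec[symmetric])
  then have "u = M h + Q u u"
    by (rule sums_unique2[OF u])
  with u nu show "\<exists>u. ?a sums u \<and> norm u \<le> 2 * m * r \<and> u = M h + Q u u"
    by (intro exI conjI)
qed

section \<open>Building blocks for bounded bilinear maps\<close>

lemma bounded_bilinear_Pair:
  assumes "bounded_bilinear f" "bounded_bilinear g"
  shows "bounded_bilinear (\<lambda>x y. (f x y, g x y))"
proof -
  interpret f: bounded_bilinear f by fact
  interpret g: bounded_bilinear g by fact
  obtain K L where K: "\<And>x y. norm (f x y) \<le> norm x * norm y * K"
    and L: "\<And>x y. norm (g x y) \<le> norm x * norm y * L"
    using f.bounded g.bounded by blast
  have "norm (f x y, g x y) \<le> norm x * norm y * (K + L)" for x y
    using order_trans[OF norm_Pair_le add_mono[OF K L], of x y x y] by (simp add: algebra_simps)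
  then show ?thesis
    by unfold_locales (auto simp: f.add_left f.add_right g.add_left g.add_right f.scaleR_left
      f.scaleR_right g.scaleR_left g.scaleR_right)
qed

lemma bounded_bilinear_compose_left:
  assumes L: "bounded_linear L" and "bounded_bilinear Q"
  shows "bounded_bilinear (\<lambda>x y. L (Q x y))"
proof -
  interpret L: bounded_linear L by fact
  interpret Q: bounded_bilinear Q by fact
  obtain l where l: "0 < l" "\<And>x. norm (L x) \<le> norm x * l"
    using L.pos_bounded by blast
  obtain K where K: "\<And>x y. norm (Q x y) \<le> norm x * norm y * K"
    using Q.bounded by blast
  have "norm (L (Q x y)) \<le> norm x * norm y * (K * l)" for x y
    using order_trans[OF l(2) mult_right_mono[OF K]] l(1) by (simp add: mult.assoc)
  then show ?thesis
    by unfold_locales (auto simp: Q.add_left Q.add_right Q.scaleR_left Q.scaleR_right L.add L.scaleR)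
qed

lemma bounded_bilinear_add:
  assumes "bounded_bilinear f" "bounded_bilinear g"
  shows "bounded_bilinear (\<lambda>x y. f x y + g x y)"
  using bounded_bilinear_compose_left[OF bounded_linear_add[OF bounded_linear_fst bounded_linear_snd]
      bounded_bilinear_Pair[OF assms]] by simp

lemma bounded_linear_small:
  assumes L: "bounded_linear L" and "0 < e"
  shows "\<exists>d>0. \<forall>x. norm x < d \<longrightarrow> norm (L x) < e"
proof -
  obtain K where K: "0 < K" "\<And>x. norm (L x) \<le> norm x * K"
    using bounded_linear.pos_bounded[OF L] by blast
  have "norm (L x) < e" if "norm x < e / K" for x
    using K(1) that by (intro order_le_less_trans[OF K(2)]) (simp add: field_simps)
  then show ?thesis
    using assms K by (intro exI[of _ "e / K"]) simp
qed

section \<open>Inversion of x + Q x x on a ball\<close>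

lemma inj_on_plus_quadratic:
  fixes Q :: "'e::real_normed_vector \<Rightarrow> 'e \<Rightarrow> 'e"
  assumes Q: "bounded_bilinear Q" "\<And>x y. norm (Q x y) \<le> K * (norm x * norm y)"
    and K: "0 \<le> K" "4 * K * \<rho> \<le> 1"
  shows "inj_on (\<lambda>x. x + Q x x) (ball 0 \<rho>)"
proof (rule inj_onI)
  fix x y assume xy: "x \<in> ball 0 \<rho>" "y \<in> ball 0 \<rho>" and eq: "x + Q x x = y + Q y y"
  interpret Q: bounded_bilinear Q by fact
  \<comment> \<open>Factoring Q x x - Q y y through x - y bounds its norm by 2 K \<rho> times that
    of x - y, hence by half of it.\<close>
  have "x - y = - (Q x (x - y) + Q (x - y) y)"
    using eq by (simp add: Q.diff_left Q.diff_right algebra_simps)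
  then have "norm (x - y) = norm (Q x (x - y) + Q (x - y) y)"
    by (metis norm_minus_cancel)
  also have "\<dots> \<le> norm (Q x (x - y)) + norm (Q (x - y) y)"
    by (rule norm_triangle_ineq)
  also have "\<dots> \<le> K * (norm x * norm (x - y)) + K * (norm (x - y) * norm y)"
    by (intro add_mono Q(2))
  also have "\<dots> = K * (norm x + norm y) * norm (x - y)"
    by (simp add: algebra_simps)
  also have "\<dots> \<le> K * (\<rho> + \<rho>) * norm (x - y)"
    using xy K by (intro mult_right_mono mult_left_mono add_mono) auto
  also have "\<dots> = (4 * K * \<rho>) * (norm (x - y) / 2)"
    by simp
  also have "\<dots> \<le> 1 * (norm (x - y) / 2)"
    using K by (intro mult_right_mono) auto
  finally show "x = y" by simp
qed

text \<open>An expansion is required around every point of the image, not only around 0. Writing x'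
  = x + u turns the equation into u + T u + Q u u = h, where T u = Q x u + Q u x has norm at most
  1/2. Applying the inverse M of 1 + T gives u = M h - M (Q u u), which is of the form already
  solved.\<close>

lemma plus_quadratic_local_inverse:
  fixes Q :: "'e::banach \<Rightarrow> 'e \<Rightarrow> 'e"
  assumes Q: "bounded_bilinear Q" "\<And>x y. norm (Q x y) \<le> K * (norm x * norm y)"
    and K: "0 < K" "4 * K * \<rho> \<le> 1" and x: "norm x < \<rho>"
  shows "\<exists>A C. \<exists>r>0. (\<forall>n. bounded_multilinear n (A n) (C n)) \<and> summable (\<lambda>n. C n * r ^ n) \<and>
    (\<forall>h. norm h < r \<longrightarrow> (\<exists>x'. norm x' < \<rho> \<and> x' + Q x' x' = x + Q x x + h \<and> (\<lambda>n. A n (\<lambda>_. h)) sums x'))"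
proof -
  interpret Q: bounded_bilinear Q by fact
  let ?T = "\<lambda>u. Q x u + Q u x"
  have "bounded_linear ?T"
    by (intro bounded_linear_add Q.bounded_linear_left Q.bounded_linear_right)
  moreover have "norm (?T u) \<le> norm u / 2" for u
  proof -
    have "norm (?T u) \<le> K * (norm x * norm u) + K * (norm u * norm x)"
      by (intro order_trans[OF norm_triangle_ineq] add_mono Q(2))
    also have "\<dots> = (4 * K * norm x) * (norm u / 2)"
      by simp
    also have "\<dots> \<le> 1 * (norm u / 2)"
      using K x by (intro mult_right_mono order_trans[OF _ K(2)]) auto
    finally show ?thesis by simp
  qed
  ultimately obtain M where M: "bounded_linear M" "\<And>u. M u + ?T (M u) = u"
    using bounded_linear_Neumann by blast
  interpret M: bounded_linear M by fact
  obtain m where m: "0 < m" "\<And>u. norm (M u) \<le> m * norm u"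
    using M.pos_bounded by (auto simp: mult.commute)
  define Q' where "Q' = (\<lambda>u v. - M (Q u v))"
  have Q': "bounded_bilinear Q'"
    unfolding Q'_def by (rule bounded_bilinear_compose_left[OF bounded_linear_minus[OF M(1)] Q(1)])
  have Q'2: "norm (Q' u v) \<le> (m * K) * (norm u * norm v)" for u v
  proof -
    have "norm (Q' u v) \<le> m * norm (Q u v)"
      by (simp add: Q'_def m)
    also have "\<dots> \<le> m * (K * (norm u * norm v))"
      using m by (intro mult_left_mono Q(2)) auto
    finally show ?thesis by simp
  qed
  \<comment> \<open>The first bound is the convergence condition for the bilinear map
    \<open>Q'\<close> with constant m K; the second keeps x + u inside the ball, since the solution
    satisfies norm u <= 2 m r.\<close>
  define r where "r = min (1 / (4 * (m * K) * m)) ((\<rho> - norm x) / (4 * m))"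
  have r: "0 < r" "4 * (m * K) * m * r \<le> 1" "2 * m * r < \<rho> - norm x"
  proof -
    show "0 < r"
      using x m K by (simp add: r_def)
    have "r \<le> 1 / (4 * (m * K) * m)" "r \<le> (\<rho> - norm x) / (4 * m)"
      by (simp_all add: r_def)
    then show "4 * (m * K) * m * r \<le> 1" "2 * m * r < \<rho> - norm x"
      using m K x by (simp_all add: field_simps)
  qed
  \<comment> \<open>The series of u has no constant term; x is added in degree 0 to expand x' = x +
    u.\<close>
  let ?A = "\<lambda>n v. (if n = 0 then x else 0) + quadratic_coeff M Q' n v"
  let ?C = "\<lambda>n. (if n = 0 then norm x else 0) + quadratic_bound m (m * K) n"
  show ?thesis
  proof (intro exI[of _ ?A] exI[of _ ?C] exI[of _ r] conjI allI impI)
    show "0 < r" by fact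
    show "bounded_multilinear n (?A n) (?C n)" for n
      using bounded_multilinear_quadratic_coeff[OF M(1) m(2) Q' Q'2, of n] m K
      by (auto simp: bounded_multilinear_def quadratic_coeff_0 quadratic_bound_0)
    have "summable (\<lambda>n. (if n = 0 then norm x else 0) * r ^ n)"
      by (rule summable_finite[of "{0}"]) auto
    then show "summable (\<lambda>n. ?C n * r ^ n)"
      unfolding distrib_right using m K r
      by (intro summable_add quadratic_equation_power_series(1)[OF M(1) m(2) Q' Q'2]) auto
    fix h :: 'e assume h: "norm h < r"
    then obtain u where u: "(\<lambda>n. quadratic_coeff M Q' n (\<lambda>_. h)) sums u" "norm u \<le> 2 * m * r"
      "u = M h + Q' u u"
      using quadratic_equation_power_series(2)[OF M(1) m(2) Q' Q'2, of r h] m K r by auto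
    have "norm (x + u) < \<rho>"
      using norm_triangle_ineq[of x u] u(2) r(3) by simp
    moreover have "(x + u) + Q (x + u) (x + u) = x + Q x x + h"
    proof -
      have "u = M (h - Q u u)"
        using u(3) by (simp add: Q'_def M.diff)
      then have "u + ?T u = h - Q u u"
        using M(2)[of "h - Q u u"] by simp
      then show ?thesis
        by (simp add: Q.add_left Q.add_right algebra_simps)
    qed
    moreover have "(\<lambda>n. ?A n (\<lambda>_. h)) sums (x + u)"
      using sums_single[of 0 "\<lambda>_. x"] u(1) by (intro sums_add) simp_all
    ultimately show "\<exists>x'. norm x' < \<rho> \<and> x' + Q x' x' = x + Q x x + h \<and> (\<lambda>n. ?A n (\<lambda>_. h)) sums x'"
      by blast
  qed
qed

text \<open>The local solutions do two things: they show that the image V is open, and, since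
  injectivity identifies the preimage they produce with the value of g, they are the power series of
  g.\<close>

lemma plus_quadratic_inverse:
  fixes Q :: "'e::banach \<Rightarrow> 'e \<Rightarrow> 'e"
  assumes Q: "bounded_bilinear Q" "\<And>x y. norm (Q x y) \<le> K * (norm x * norm y)"
    and K: "0 < K" "4 * K * \<rho> \<le> 1"
  obtains g V where "real_analytic_on g V"
    "\<And>x. norm x < \<rho> \<Longrightarrow> x + Q x x \<in> V \<and> g (x + Q x x) = x"
    "\<And>y. y \<in> V \<Longrightarrow> norm (g y) < \<rho> \<and> g y + Q (g y) (g y) = y"
proof -
  let ?f = "\<lambda>x. x + Q x x"
  define V where "V = ?f ` ball 0 \<rho>"
  define g where "g = inv_into (ball 0 \<rho>) ?f"
  have inj: "inj_on ?f (ball 0 \<rho>)"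
    using inj_on_plus_quadratic[OF Q] K by simp
  have gf: "?f x \<in> V \<and> g (?f x) = x" if "norm x < \<rho>" for x
    using that inv_into_f_f[OF inj] by (simp add: V_def g_def)
  have fg: "norm (g y) < \<rho> \<and> ?f (g y) = y" if "y \<in> V" for y
    using inv_into_into[of y ?f "ball 0 \<rho>"] f_inv_into_f[of y ?f "ball 0 \<rho>"] that
    by (simp add: V_def g_def)
  have series: "\<exists>A C. \<exists>r>0. (\<forall>n. bounded_multilinear n (A n) (C n)) \<and> summable (\<lambda>n. C n * r ^ n) \<and>
      (\<forall>h. norm h < r \<longrightarrow> y + h \<in> V \<and> (\<lambda>n. A n (\<lambda>_. h)) sums g (y + h))" if "y \<in> V" for y
  proof -
    obtain A C r where r: "0 < r" "\<forall>n. bounded_multilinear n (A n) (C n)" "summable (\<lambda>n. C n * r ^ n)"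
      and h: "\<forall>h. norm h < r \<longrightarrow> (\<exists>x'. norm x' < \<rho> \<and> ?f x' = ?f (g y) + h \<and> (\<lambda>n. A n (\<lambda>_. h)) sums x')"
      using plus_quadratic_local_inverse[OF Q K conjunct1[OF fg[OF \<open>y \<in> V\<close>]]] by (elim exE conjE)
    have "y + h \<in> V \<and> (\<lambda>n. A n (\<lambda>_. h)) sums g (y + h)" if nh: "norm h < r" for h
    proof -
      obtain x' where x': "norm x' < \<rho>" "?f x' = y + h" "(\<lambda>n. A n (\<lambda>_. h)) sums x'"
        using h nh fg[OF \<open>y \<in> V\<close>] by auto
      with gf[OF x'(1)] show ?thesis by simp
    qed
    with r show ?thesis by (intro exI[of _ A] exI[of _ C] exI[of _ r]) simp
  qed
  have "open V"
    unfolding open_contains_ball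
  proof
    fix y assume "y \<in> V"
    then obtain r where "0 < r" and r: "\<And>h. norm h < r \<Longrightarrow> y + h \<in> V"
      using series by blast
    have "ball y r \<subseteq> V"
    proof
      fix y' assume "y' \<in> ball y r"
      then show "y' \<in> V"
        using r[of "y' - y"] by (simp add: dist_norm norm_minus_commute)
    qed
    with \<open>0 < r\<close> show "\<exists>e>0. ball y e \<subseteq> V" by blast
  qed
  moreover have "\<exists>A C. \<exists>r>0. (\<forall>n. bounded_multilinear n (A n) (C n)) \<and> summable (\<lambda>n. C n * r ^ n) \<and>
      (\<forall>h. norm h < r \<longrightarrow> (\<lambda>n. A n (\<lambda>_. h)) sums g (y + h))" if "y \<in> V" for y
    using series[OF that] by (elim exE conjE) (intro exI conjI, assumption+, simp)
  ultimately have "real_analytic_on g V"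
    by (simp add: real_analytic_on_def)
  then show ?thesis
    using gf fg by (rule that)
qed

text \<open>A nonzero vector, repeated n times, forces C n >= 0. On a trivial source space the
  products of n >= 1 norms vanish, so C n could be negative there and is replaced by 0. The sign
  matters when bounds are multiplied by further estimates.\<close>

lemma real_analytic_on_nonneg_bounds:
  assumes "real_analytic_on f U" "p \<in> U"
  shows "\<exists>A C. \<exists>r>0. (\<forall>n. bounded_multilinear n (A n) (C n)) \<and> (\<forall>n. 0 \<le> C n) \<and>
    summable (\<lambda>n. C n * r ^ n) \<and> (\<forall>h. norm h < r \<longrightarrow> (\<lambda>n. A n (\<lambda>_. h)) sums f (p + h))"
proof -
  have "\<exists>A C. \<exists>r>0. (\<forall>n. bounded_multilinear n (A n) (C n)) \<and> summable (\<lambda>n. C n * r ^ n) \<and>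
      (\<forall>h. norm h < r \<longrightarrow> (\<lambda>n. A n (\<lambda>_. h)) sums f (p + h))"
    using assms by (simp add: real_analytic_on_def)
  then obtain A C r where r: "0 < r" and A: "\<forall>n. bounded_multilinear n (A n) (C n)"
    and C: "summable (\<lambda>n. C n * r ^ n)" and h: "\<forall>h. norm h < r \<longrightarrow> (\<lambda>n. A n (\<lambda>_. h)) sums f (p + h)"
    by (elim exE conjE)
  have bd: "norm (A n v) \<le> C n * (\<Prod>i<n. norm (v i))" for n v
    using A unfolding bounded_multilinear_def by blast
  show ?thesis
  proof (cases "\<exists>x::'a. x \<noteq> 0")
    case True
    then obtain x :: 'a where x: "x \<noteq> 0" by blast
    have "0 \<le> C n" for n
    proof -
      have "0 \<le> C n * norm x ^ n"
        using order_trans[OF norm_ge_zero bd[of n "\<lambda>_. x"]] by simp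
      moreover have "0 < norm x ^ n"
        using x by simp
      ultimately show ?thesis
        by (simp only: zero_le_mult_iff) linarith
    qed
    then show ?thesis
      using r A C h by (intro exI[of _ A] exI[of _ C] exI[of _ r]) simp
  next
    case False
    let ?C = "\<lambda>n. if n = 0 then C n else 0"
    have "norm (A n v) \<le> ?C n * (\<Prod>i<n. norm (v i))" for n v
    proof (cases n)
      case (Suc k)
      have "(\<Prod>i<n. norm (v i)) = 0"
        using False Suc by (intro prod_zero) auto
      then have "norm (A n v) \<le> 0"
        using bd[of n v] by (simp only: mult_zero_right)
      then show ?thesis
        using Suc by simp
    qed (use bd[of 0 v] in auto)
    then have "bounded_multilinear n (A n) (?C n)" for n
      using A[rule_format, of n] unfolding bounded_multilinear_def by blast
    moreover have "0 \<le> ?C n" for n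
      using order_trans[OF norm_ge_zero bd[of 0 undefined]] by simp
    moreover have "summable (\<lambda>n. ?C n * r ^ n)"
      by (rule summable_finite[of "{0}"]) auto
    ultimately show ?thesis
      using r h by (intro exI[of _ A] exI[of _ ?C] exI[of _ r]) simp
  qed
qed

text \<open>Substituting J multiplies the n-th bound by j^n, which the smaller radius r / j
  compensates; L contributes a constant factor and d only a term of degree 0. This covers the
  embeddings, projections, translations and conjugations applied to the charts.\<close>

lemma real_analytic_on_affine_comp:
  fixes f :: "'a::real_normed_vector \<Rightarrow> 'b::real_normed_vector" and J :: "'d::real_normed_vector \<Rightarrow> 'a"
  assumes f: "real_analytic_on f U" and L: "bounded_linear L" and J: "bounded_linear J"
  shows "real_analytic_on (\<lambda>x. L (f (J x + c)) + d) {x. J x + c \<in> U}"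
  unfolding real_analytic_on_def
proof (intro conjI ballI)
  interpret L: bounded_linear L by fact
  interpret J: bounded_linear J by fact
  have "open U" using f by (simp add: real_analytic_on_def)
  then have "open ((\<lambda>x. J x + c) -` U)"
    by (rule continuous_open_vimage) (intro isCont_add linear_continuous_at J continuous_const)
  then show "open {x. J x + c \<in> U}"
    by (simp add: vimage_def)
  fix p assume p: "p \<in> {x. J x + c \<in> U}"
  then have "J p + c \<in> U" by simp
  from real_analytic_on_nonneg_bounds[OF f this] obtain A C r where
    r: "0 < r" and A: "\<forall>n. bounded_multilinear n (A n) (C n)" and C0: "\<forall>n. 0 \<le> C n"
    and C: "summable (\<lambda>n. C n * r ^ n)"
    and h: "\<forall>h. norm h < r \<longrightarrow> (\<lambda>n. A n (\<lambda>_. h)) sums f (J p + c + h)"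
    by (elim exE conjE)
  obtain l where l: "0 < l" "\<And>x. norm (L x) \<le> l * norm x"
    using L.pos_bounded by (auto simp: mult.commute)
  obtain j where j: "0 < j" "\<And>x. norm (J x) \<le> j * norm x"
    using J.pos_bounded by (auto simp: mult.commute)
  let ?A = "\<lambda>n v. L (A n (\<lambda>i. J (v i))) + (if n = 0 then d else 0)"
  let ?C = "\<lambda>n. l * C n * j ^ n + (if n = 0 then norm d else 0)"
  have "bounded_multilinear n (?A n) (?C n)" for n
    unfolding bounded_multilinear_def
  proof (intro conjI allI impI)
    fix v w :: "nat \<Rightarrow> 'd" assume "\<forall>i<n. v i = w i"
    then have "A n (\<lambda>i. J (v i)) = A n (\<lambda>i. J (w i))"
      using A[rule_format, of n] by (simp add: bounded_multilinear_def)
    then show "?A n v = ?A n w" by simp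
  next
    fix v :: "nat \<Rightarrow> 'd" and i assume i: "i < n"
    have "(\<lambda>k. J ((v(i := x)) k)) = (\<lambda>k. J (v k))(i := J x)" for x
      by auto
    moreover have "linear (\<lambda>x. A n ((\<lambda>k. J (v k))(i := x)))"
      using A[rule_format, of n] i unfolding bounded_multilinear_def by blast
    then have "linear (L \<circ> ((\<lambda>x. A n ((\<lambda>k. J (v k))(i := x))) \<circ> J))"
      by (intro linear_compose L.linear_axioms J.linear_axioms)
    ultimately show "linear (\<lambda>x. ?A n (v(i := x)))"
      using i by (simp add: o_def)
  next
    fix v :: "nat \<Rightarrow> 'd"
    have "norm (?A n v) \<le> norm (L (A n (\<lambda>i. J (v i)))) + norm (if n = 0 then d else 0)"
      by (rule norm_triangle_ineq)
    also have "\<dots> \<le> l * (C n * (j ^ n * (\<Prod>i<n. norm (v i)))) + (if n = 0 then norm d else 0)"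
    proof (rule add_mono)
      have "norm (A n (\<lambda>i. J (v i))) \<le> C n * (\<Prod>i<n. norm (J (v i)))"
        using A[rule_format, of n] unfolding bounded_multilinear_def by blast
      also have "\<dots> \<le> C n * (\<Prod>i<n. j * norm (v i))"
        using j C0 by (intro mult_left_mono prod_mono) auto
      finally have "norm (A n (\<lambda>i. J (v i))) \<le> C n * (j ^ n * (\<Prod>i<n. norm (v i)))"
        by (simp add: prod.distrib)
      then show "norm (L (A n (\<lambda>i. J (v i)))) \<le> l * (C n * (j ^ n * (\<Prod>i<n. norm (v i))))"
        using l by (intro order_trans[OF l(2)] mult_left_mono) auto
    qed auto
    also have "\<dots> = ?C n * (\<Prod>i<n. norm (v i))"
      by (simp add: distrib_right)
    finally show "norm (?A n v) \<le> ?C n * (\<Prod>i<n. norm (v i))" .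
  qed
  moreover have "summable (\<lambda>n. ?C n * (r / j) ^ n)"
  proof -
    have "summable (\<lambda>n. (if n = 0 then norm d else 0) * (r / j) ^ n)"
      by (rule summable_finite[of "{0}"]) auto
    moreover have "l * C n * j ^ n * (r / j) ^ n = l * (C n * r ^ n)" for n
      using j by (simp add: power_divide)
    ultimately show ?thesis
      using summable_add[OF summable_mult[OF C, of l]] by (simp only: distrib_right)
  qed
  moreover have "(\<lambda>n. ?A n (\<lambda>_. x)) sums (L (f (J (p + x) + c)) + d)" if "norm x < r / j" for x
  proof -
    have "norm (J x) < r"
      using j(1) that by (intro order_le_less_trans[OF j(2)]) (simp add: field_simps)
    then have "(\<lambda>n. A n (\<lambda>_. J x)) sums f (J (p + x) + c)"
      using h[rule_format, of "J x"] by (simp add: J.add algebra_simps)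
    then show ?thesis
      using sums_single[of 0 "\<lambda>_. d"] by (intro sums_add L.sums) simp_all
  qed
  ultimately show "\<exists>A C. \<exists>s>0. (\<forall>n. bounded_multilinear n (A n) (C n)) \<and> summable (\<lambda>n. C n * s ^ n) \<and>
      (\<forall>x. norm x < s \<longrightarrow> (\<lambda>n. A n (\<lambda>_. x)) sums (L (f (J (p + x) + c)) + d))"
    using r j by (intro exI[of _ ?A] exI[of _ ?C] exI[of _ "r / j"]) auto
qed

text \<open>A triple (b, w, z) solving w = P v v and z = b + R v v is determined by b and also by z.
  Both descriptions invert a map x + Q x x on the same ball, so \<phi> and \<psi> read off the two
  ends of the same set of triples and are inverse to each other.\<close>

lemma quadratic_implicit:
  fixes P :: "'a::banach \<times> 'w::banach \<times> 'a \<Rightarrow> 'a \<times> 'w \<times> 'a \<Rightarrow> 'w"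
    and R :: "'a \<times> 'w \<times> 'a \<Rightarrow> 'a \<times> 'w \<times> 'a \<Rightarrow> 'a"
  assumes P: "bounded_bilinear P" and R: "bounded_bilinear R" and \<epsilon>: "0 < \<epsilon>"
  obtains U V \<phi> \<psi> \<omega> where "0 \<in> U" "analytic_diffeomorphism U V \<phi> \<psi>"
    "\<And>b v. b \<in> U \<Longrightarrow> v = (b, \<omega> b, \<phi> b) \<Longrightarrow> norm v < \<epsilon> \<and> \<omega> b = P v v \<and> \<phi> b = b + R v v"
proof -
  interpret P: bounded_bilinear P by fact
  interpret R: bounded_bilinear R by fact
  \<comment> \<open>v + \<open>Q1\<close> v v = (b, w - P v v, z - R v v) and v + \<open>Q2\<close>
    v v = (b + R v v, w - P v v, z). The system says that the first equals (b, 0, b), equivalently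
    that the second equals (z, 0, z).\<close>
  define Q1 where "Q1 = (\<lambda>u v. (0::'a, - P u v, - R u v))"
  define Q2 where "Q2 = (\<lambda>u v. (R u v, - P u v, 0::'a))"
  have neg: "bounded_linear (uminus :: 'x::real_normed_vector \<Rightarrow> 'x)"
    by (rule bounded_linear_minus[OF bounded_linear_ident])
  have zero: "bounded_bilinear (\<lambda>(u::'a \<times> 'w \<times> 'a) (v::'a \<times> 'w \<times> 'a). 0::'a)"
    by unfold_locales (auto intro: exI[of _ 0])
  have Q: "bounded_bilinear Q1" "bounded_bilinear Q2"
    unfolding Q1_def Q2_def
    by (rule bounded_bilinear_Pair zero R bounded_bilinear_compose_left[OF neg P]
      bounded_bilinear_compose_left[OF neg R])+
  obtain K1 K2 where K1: "0 < K1" "\<And>u v. norm (Q1 u v) \<le> norm u * norm v * K1"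
    and K2: "0 < K2" "\<And>u v. norm (Q2 u v) \<le> norm u * norm v * K2"
    using bounded_bilinear.pos_bounded[OF Q(1)] bounded_bilinear.pos_bounded[OF Q(2)] by blast
  \<comment> \<open>One constant for both maps gives one radius \<rho>, so that a small triple
    obtained from b is also admissible when it is recovered from z.\<close>
  define K where "K = max K1 K2"
  have K: "0 < K" using K1 by (simp add: K_def)
  have bd: "norm (Q1 u v) \<le> K * (norm u * norm v)" "norm (Q2 u v) \<le> K * (norm u * norm v)" for u v
    by (rule order_trans[OF K1(2)], subst mult.commute, rule mult_right_mono, simp_all add: K_def)
      (rule order_trans[OF K2(2)], subst mult.commute, rule mult_right_mono, simp_all)
  define \<rho> where "\<rho> = min \<epsilon> (1 / (4 * K))"
  have \<rho>: "0 < \<rho>" "\<rho> \<le> \<epsilon>" "4 * K * \<rho> \<le> 1"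
  proof -
    show "0 < \<rho>" "\<rho> \<le> \<epsilon>" using K \<epsilon> by (simp_all add: \<rho>_def)
    have "\<rho> \<le> 1 / (4 * K)" by (simp add: \<rho>_def)
    then show "4 * K * \<rho> \<le> 1" using K by (simp add: field_simps)
  qed
  obtain g1 V1 where g1: "real_analytic_on g1 V1"
    "\<And>x. norm x < \<rho> \<Longrightarrow> x + Q1 x x \<in> V1 \<and> g1 (x + Q1 x x) = x"
    "\<And>y. y \<in> V1 \<Longrightarrow> norm (g1 y) < \<rho> \<and> g1 y + Q1 (g1 y) (g1 y) = y"
    using plus_quadratic_inverse[OF Q(1) bd(1) K \<rho>(3)] by metis
  obtain g2 V2 where g2: "real_analytic_on g2 V2"
    "\<And>x. norm x < \<rho> \<Longrightarrow> x + Q2 x x \<in> V2 \<and> g2 (x + Q2 x x) = x"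
    "\<And>y. y \<in> V2 \<Longrightarrow> norm (g2 y) < \<rho> \<and> g2 y + Q2 (g2 y) (g2 y) = y"
    using plus_quadratic_inverse[OF Q(2) bd(2) K \<rho>(3)] by metis
  let ?J = "\<lambda>b::'a. (b, 0::'w, b)"
  \<comment> \<open>The added zeros here and below match the affine form in
    \<open>real_analytic_on_affine_comp\<close>.\<close>
  define U where "U = {b. ?J b + 0 \<in> V1}"
  define V where "V = {z. ?J z + 0 \<in> V2}"
  define \<phi> where "\<phi> = (\<lambda>b. snd (snd (g1 (?J b + 0))) + 0)"
  define \<psi> where "\<psi> = (\<lambda>z. fst (g2 (?J z + 0)) + 0)"
  define \<omega> where "\<omega> = (\<lambda>b. fst (snd (g1 (?J b))))"
  have J: "bounded_linear ?J"
    by (intro bounded_linear_Pair bounded_linear_ident bounded_linear_zero)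
  have an: "real_analytic_on \<phi> U" "real_analytic_on \<psi> V"
    unfolding \<phi>_def \<psi>_def U_def V_def
    by (rule real_analytic_on_affine_comp[OF g1(1) bounded_linear_compose[OF bounded_linear_snd bounded_linear_snd] J])
      (rule real_analytic_on_affine_comp[OF g2(1) bounded_linear_fst J])
  have 1: "g1 (?J b) = (b, \<omega> b, \<phi> b) \<and> norm (b, \<omega> b, \<phi> b) < \<rho> \<and> \<omega> b = P (b, \<omega> b, \<phi> b) (b, \<omega> b, \<phi> b) \<and>
      \<phi> b = b + R (b, \<omega> b, \<phi> b) (b, \<omega> b, \<phi> b)" if "b \<in> U" for b
  proof -
    obtain b' w z where v: "g1 (?J b) = (b', w, z)" by (metis prod_cases3)
    have "norm (b', w, z) < \<rho>" "(b', w, z) + Q1 (b', w, z) (b', w, z) = ?J b"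
      using g1(3)[of "?J b"] that v by (simp_all add: U_def)
    moreover from this(2) have "b' = b" "w = P (b', w, z) (b', w, z)" "z = b + R (b', w, z) (b', w, z)"
      by (auto simp: Q1_def diff_eq_eq)
    moreover have "\<omega> b = w" "\<phi> b = z"
      using v by (simp_all add: \<omega>_def \<phi>_def)
    ultimately show ?thesis
      using v by simp
  qed
  have 2: "\<exists>w. g2 (?J z) = (\<psi> z, w, z) \<and> norm (\<psi> z, w, z) < \<rho> \<and> w = P (\<psi> z, w, z) (\<psi> z, w, z) \<and>
      z = \<psi> z + R (\<psi> z, w, z) (\<psi> z, w, z)" if "z \<in> V" for z
  proof -
    obtain b w z' where v: "g2 (?J z) = (b, w, z')" by (metis prod_cases3)
    have nv: "norm (b, w, z') < \<rho>" and eq: "(b, w, z') + Q2 (b, w, z') (b, w, z') = ?J z"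
      using g2(3)[of "?J z"] that v by (simp_all add: V_def)
    have b: "\<psi> z = b"
      using v by (simp add: \<psi>_def)
    have z: "z' = z"
      using eq by (simp add: Q2_def)
    have "w = P (b, w, z) (b, w, z)" "z = b + R (b, w, z) (b, w, z)"
      using eq unfolding z by (simp_all add: Q2_def)
    then show ?thesis
      using nv v unfolding z b by (intro exI[of _ w] conjI)
  qed
  have 3: "\<phi> b \<in> V \<and> \<psi> (\<phi> b) = b" if "b \<in> U" for b
  proof -
    let ?v = "(b, \<omega> b, \<phi> b)"
    have "?v + Q2 ?v ?v = ?J (\<phi> b)"
      using 1[OF that] by (simp add: Q2_def)
    with g2(2)[of ?v] 1[OF that] show ?thesis
      by (simp add: V_def \<psi>_def)
  qed
  have 4: "\<psi> z \<in> U \<and> \<phi> (\<psi> z) = z" if z: "z \<in> V" for z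
  proof -
    obtain w where w: "norm (\<psi> z, w, z) < \<rho>" "w = P (\<psi> z, w, z) (\<psi> z, w, z)"
      "z = \<psi> z + R (\<psi> z, w, z) (\<psi> z, w, z)"
      using 2[OF z] by blast
    let ?v = "(\<psi> z, w, z)"
    have "?v + Q1 ?v ?v = ?J (\<psi> z)"
      using w(2,3) by (simp add: Q1_def algebra_simps)
    with g1(2)[of ?v] w(1) show ?thesis
      by (simp add: U_def \<phi>_def)
  qed
  have "0 + Q1 0 0 = ?J 0"
    by (simp add: Q1_def P.zero_left R.zero_left flip: zero_prod_def)
  then have "0 \<in> U"
    using g1(2)[of 0] \<rho>(1) by (simp add: U_def)
  moreover have "analytic_diffeomorphism U V \<phi> \<psi>"
    unfolding analytic_diffeomorphism_def using an 3 4 by (auto intro!: image_eqI)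
  moreover have "norm v < \<epsilon> \<and> \<omega> b = P v v \<and> \<phi> b = b + R v v" if "b \<in> U" "v = (b, \<omega> b, \<phi> b)" for b v
    using 1[OF that(1)] \<rho>(2) unfolding that(2) by auto
  ultimately show ?thesis
    by (rule that)
qed

section \<open>Spectral resolution of algebraic self-adjoint operators\<close>

definition poly_op :: "('a::complex_inner \<Rightarrow>\<^sub>L 'a) \<Rightarrow> complex poly \<Rightarrow> ('a \<Rightarrow>\<^sub>L 'a)" where
  "poly_op A p = fold_coeffs (\<lambda>c T. scaleC_op c id_blinfun + (A o\<^sub>L T)) p 0"

lemma poly_op_0 [simp]: "poly_op A 0 = 0"
  by (simp add: poly_op_def)

lemma poly_op_pCons: "poly_op A (pCons c p) = scaleC_op c id_blinfun + (A o\<^sub>L poly_op A p)"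
  by (cases "c = 0 \<and> p = 0") (auto simp: poly_op_def intro!: blinfun_eqI simp: blinfun.add_left scaleC_op.rep_eq)

lemma poly_op_pCons_apply: "poly_op A (pCons c p) x = c *\<^sub>C x + A (poly_op A p x)"
  by (simp add: poly_op_pCons blinfun.add_left scaleC_op.rep_eq)

lemma poly_op_bounded_ops [simp]: "A \<in> bounded_ops \<Longrightarrow> poly_op A p \<in> bounded_ops"
  by (induction p) (simp_all add: poly_op_pCons)

lemma poly_op_add: "poly_op A (p + q) x = poly_op A p x + poly_op A q x"
  by (induction p q arbitrary: x rule: poly_induct2)
    (simp_all add: poly_op_pCons_apply blinfun.add_right scaleC_add_left)

lemma poly_op_smult: "A \<in> bounded_ops \<Longrightarrow> poly_op A (smult c p) x = c *\<^sub>C poly_op A p x"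
  by (induction p) (simp_all add: poly_op_pCons_apply scaleC_add_right scaleC_scaleC bounded_opsD)

lemma poly_op_mult: "A \<in> bounded_ops \<Longrightarrow> poly_op A (p * q) x = poly_op A p (poly_op A q x)"
  by (induction p) (simp_all add: poly_op_pCons_apply poly_op_add poly_op_smult)

lemma poly_op_sum: "poly_op A (sum f I) x = (\<Sum>i\<in>I. poly_op A (f i) x)"
  by (induction I rule: infinite_finite_induct) (simp_all add: poly_op_add)

lemma poly_op_1: "poly_op A 1 x = x"
  by (simp add: one_pCons poly_op_pCons_apply scaleC_one)

lemma poly_op_linear: "poly_op A [:- c, 1:] x = A x - c *\<^sub>C x"
  by (simp add: poly_op_pCons_apply scaleC_one)

lemma poly_op_commute: "A \<in> bounded_ops \<Longrightarrow> poly_op A p (poly_op A q x) = poly_op A q (poly_op A p x)"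
  by (metis mult.commute poly_op_mult)

lemma poly_op_monom: "A \<in> bounded_ops \<Longrightarrow> poly_op A (monom c n) = scaleC_op c (poly_op A (monom 1 n))"
  by (rule blinfun_eqI) (metis poly_op_smult scaleC_op.rep_eq smult_monom mult.right_neutral)

text \<open>All powers of A lie in the generated algebra, which is spanned by finitely many
  operators; a linear relation between powers is an annihilating polynomial.\<close>

lemma ex_annihilating_poly:
  fixes A :: "'a::complex_hilbert \<Rightarrow>\<^sub>L 'a"
  assumes A: "A \<in> bounded_ops" and fin: "finite_dimensional_ops (cstar_generated A)"
  shows "\<exists>p. p \<noteq> 0 \<and> (\<forall>x. poly_op A p x = 0)"
proof -
  let ?pw = "\<lambda>n. poly_op A (monom 1 n)"
  obtain B where B: "finite B" "cstar_generated A = op_span B"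
    using fin by (auto simp: finite_dimensional_ops_def)
  have C: "cstar_subalgebra (cstar_generated A)"
    by (rule cstar_subalgebra_cstar_generated[OF A])
  have gen: "id_blinfun \<in> cstar_generated A" "A \<in> cstar_generated A"
    unfolding cstar_generated_def using hull_subset[of "{id_blinfun, A}" cstar_subalgebra] by auto
  have "?pw n \<in> cstar_generated A" for n
  proof (induction n)
    case 0
    have "poly_op A (monom 1 0) = id_blinfun"
      by (rule blinfun_eqI) (simp add: poly_op_1)
    then show ?case using gen by simp
  next
    case (Suc n)
    have "poly_op A (monom 1 (Suc n)) = A o\<^sub>L ?pw n"
      by (rule blinfun_eqI) (simp add: monom_Suc poly_op_pCons_apply)
    then show ?case using gen Suc C by (simp add: cstar_subalgebra_def)
  qed
  then have sub: "range ?pw \<subseteq> op_span B"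
    using B by auto
  show ?thesis
  \<comment> \<open>Linear dependence is a property of the set of powers and does not notice
    repetitions. If two powers coincide, the difference of the two monomials annihilates A
    directly.\<close>
  proof (cases "inj ?pw")
    case True
    then have "infinite (range ?pw)"
      by (rule range_inj_infinite)
    then have "complex_op.dependent (range ?pw)"
      using complex_op.independent_span_bound[OF B(1) _ sub] by blast
    then obtain t u where t: "finite t" "t \<subseteq> range ?pw" "(\<Sum>v\<in>t. scaleC_op (u v) v) = 0" "\<exists>v\<in>t. u v \<noteq> 0"
      unfolding complex_op.dependent_explicit by blast
    define N where "N = ?pw -` t"
    have N: "finite N" "?pw ` N = t"
      using t(1,2) True by (auto simp: N_def intro: finite_vimageI)
    let ?p = "\<Sum>n\<in>N. monom (u (?pw n)) n"
    have "poly_op A ?p x = 0" for x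
    proof -
      have "poly_op A ?p x = (\<Sum>n\<in>N. u (?pw n) *\<^sub>C ?pw n x)"
        unfolding poly_op_sum by (subst poly_op_monom[OF A]) (simp add: scaleC_op.rep_eq)
      also have "\<dots> = (\<Sum>v\<in>?pw ` N. u v *\<^sub>C v x)"
        by (subst sum.reindex) (use True in \<open>auto intro: inj_on_subset\<close>)
      also have "\<dots> = (\<Sum>v\<in>t. scaleC_op (u v) v) x"
        unfolding N by (simp add: blinfun.sum_left scaleC_op.rep_eq)
      finally show ?thesis using t(3) by simp
    qed
    moreover have "?p \<noteq> 0"
    proof -
      obtain n where n: "n \<in> N" "u (?pw n) \<noteq> 0"
        using t(4) N(2) by blast
      have "poly.coeff ?p n = (\<Sum>k\<in>N. if k = n then u (?pw n) else 0)"
        unfolding coeff_sum by (intro sum.cong) auto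
      also have "\<dots> = u (?pw n)"
        using n(1) N(1) by simp
      finally show ?thesis using n(2) by auto
    qed
    ultimately show ?thesis by blast
  next
    case False
    then obtain i j where ij: "?pw i = ?pw j" "i \<noteq> j"
      by (auto simp: inj_def)
    let ?p = "monom 1 i + smult (- 1) (monom 1 j) :: complex poly"
    have "poly.coeff ?p i = 1"
      using ij(2) by simp
    then have "?p \<noteq> 0" by (metis coeff_0 zero_neq_one)
    moreover have "poly_op A ?p x = 0" for x
      unfolding poly_op_add poly_op_smult[OF A] ij(1) by (simp add: complex_vec.scale_minus_left scaleC_one)
    ultimately show ?thesis by blast
  qed
qed

text \<open>For a polynomial p of least degree, every root has an eigenvector and is therefore real,
  and no root is multiple because a self-adjoint operator has no nilpotent part. Up to a scalar p is
  then the product over its roots.\<close>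

lemma self_adjoint_annihilating_poly:
  fixes A :: "'a::complex_hilbert \<Rightarrow>\<^sub>L 'a"
  assumes A: "A \<in> bounded_ops" "adj A = A" and p: "p \<noteq> 0" "\<forall>x. poly_op A p x = 0"
  shows "\<exists>\<Lambda>. finite \<Lambda> \<and> \<Lambda> \<subseteq> \<real> \<and> (\<forall>x. poly_op A (\<Prod>\<mu>\<in>\<Lambda>. [:- \<mu>, 1:]) x = 0)"
proof -
  let ?I = "\<lambda>p. p \<noteq> 0 \<and> (\<forall>x. poly_op A p x = 0)"
  obtain p where p: "p \<noteq> 0" "\<forall>x. poly_op A p x = 0"
    and min: "\<And>q. ?I q \<Longrightarrow> degree p \<le> degree q"
    using ex_has_least_nat[of ?I p degree] p by blast
  have sa: "cinner (A x) y = cinner x (A y)" for x y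
    using cinner_adj[OF A(1)] A(2) by simp
  \<comment> \<open>Minimality of the degree: the cofactor of a linear factor does not annihilate A.
    The resulting nonzero vectors serve as eigenvectors and as generalised eigenvectors.\<close>
  have smaller: "\<exists>x. poly_op A q x \<noteq> 0" if "p = [:- \<mu>, 1:] * q" for q \<mu>
  proof (rule ccontr)
    assume "\<not> (\<exists>x. poly_op A q x \<noteq> 0)"
    moreover have "q \<noteq> 0" using that p by auto
    ultimately have "degree p \<le> degree q"
      using min by blast
    moreover have "degree p = Suc (degree q)"
      using \<open>q \<noteq> 0\<close> unfolding that by (subst degree_mult_eq) auto
    ultimately show False by simp
  qed
  have real: "\<mu> \<in> \<real>" if root: "poly p \<mu> = 0" for \<mu>
  proof -
    obtain q where q: "p = [:- \<mu>, 1:] * q"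
      using root by (auto simp: poly_eq_0_iff_dvd dvd_def)
    obtain x where x: "poly_op A q x \<noteq> 0"
      using smaller[OF q] by blast
    let ?y = "poly_op A q x"
    have "A ?y = \<mu> *\<^sub>C ?y"
      using p(2) unfolding q poly_op_mult[OF A(1)] poly_op_linear by simp
    then have "\<mu> * cinner ?y ?y = cnj \<mu> * cinner ?y ?y"
      using sa[of ?y ?y] by (simp add: cinner_scaleC_left cinner_scaleC_right)
    then have "\<mu> = cnj \<mu>"
      using x by (simp add: cinner_self)
    then show ?thesis
      by (metis Reals_cnj_iff)
  qed
  \<comment> \<open>With y = q(A) x and z = (A - \<mu>) y, a double root would give (A - \<mu>) z =
    0, hence <z, z> = <y, (A - \<mu>) z> = 0 although z is nonzero.\<close>
  have "\<not> [:- \<mu>, 1:] ^ 2 dvd p" for \<mu>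
  proof
    assume dvd: "[:- \<mu>, 1:] ^ 2 dvd p"
    then obtain q where q: "p = [:- \<mu>, 1:] * ([:- \<mu>, 1:] * q)"
      unfolding dvd_def power2_eq_square mult.assoc by blast
    then have "poly p \<mu> = 0" by simp
    then have \<mu>: "cnj \<mu> = \<mu>" using real by (simp add: Reals_cnj_iff)
    obtain x where x: "poly_op A ([:- \<mu>, 1:] * q) x \<noteq> 0"
      using smaller[OF q] by blast
    let ?y = "poly_op A q x" and ?z = "poly_op A ([:- \<mu>, 1:] * q) x"
    have z: "?z = A ?y - \<mu> *\<^sub>C ?y"
      by (simp only: poly_op_mult[OF A(1)] poly_op_linear)
    have "A ?z - \<mu> *\<^sub>C ?z = 0"
      using p(2) unfolding q poly_op_mult[OF A(1), of "[:- \<mu>, 1:]" "[:- \<mu>, 1:] * q"] poly_op_linear by simp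
    moreover have "cinner ?z ?z = cinner ?y (A ?z - \<mu> *\<^sub>C ?z)"
      by (subst z) (simp add: cinner_diff_left cinner_diff_right sa cinner_scaleC_left cinner_scaleC_right \<mu>)
    ultimately have "cinner ?z ?z = 0" by simp
    with x show False by (simp add: cinner_self)
  qed
  then have "order \<mu> p < 2" for \<mu>
    using p(1) order_divides[of \<mu> 2 p] by (meson not_le)
  then have "rsquarefree p"
    unfolding rsquarefree_def using p(1) by (metis less_2_cases One_nat_def)
  then have decomp: "smult (lead_coeff p) (\<Prod>z | poly p z = 0. [:-z, 1:]) = p"
    by (rule complex_poly_decompose_rsquarefree)
  have "poly_op A (\<Prod>z | poly p z = 0. [:-z, 1:]) x = 0" for x
  proof -
    have "lead_coeff p *\<^sub>C poly_op A (\<Prod>z | poly p z = 0. [:-z, 1:]) x = 0"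
      using p(2) unfolding poly_op_smult[OF A(1), symmetric] decomp by blast
    then show ?thesis
      using p(1) by simp
  qed
  then show ?thesis
    using real poly_roots_finite[OF p(1)] by (intro exI[of _ "{z. poly p z = 0}"]) auto
qed

section \<open>Spectral projections by Lagrange interpolation\<close>

definition lagrange_poly :: "complex set \<Rightarrow> complex \<Rightarrow> complex poly" where
  "lagrange_poly \<Lambda> \<eta> = (\<Prod>\<mu>\<in>\<Lambda> - {\<eta>}. smult (1 / (\<eta> - \<mu>)) [:- \<mu>, 1:])"

lemma poly_lagrange_poly:
  assumes "finite \<Lambda>" "\<eta> \<in> \<Lambda>" "\<nu> \<in> \<Lambda>"
  shows "poly (lagrange_poly \<Lambda> \<eta>) \<nu> = (if \<nu> = \<eta> then 1 else 0)"
proof -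
  have "poly (smult (1 / (\<eta> - \<mu>)) [:- \<mu>, 1:]) \<nu> = (\<nu> - \<mu>) / (\<eta> - \<mu>)" for \<mu>
    by (simp add: diff_divide_distrib)
  then have "poly (lagrange_poly \<Lambda> \<eta>) \<nu> = (\<Prod>\<mu>\<in>\<Lambda> - {\<eta>}. (\<nu> - \<mu>) / (\<eta> - \<mu>))"
    unfolding lagrange_poly_def poly_prod by (rule prod.cong[OF refl])
  then show ?thesis
    using assms by (auto intro!: prod.neutral prod_zero bexI[of _ \<nu>])
qed

lemma degree_lagrange_poly:
  assumes "finite \<Lambda>" "\<eta> \<in> \<Lambda>"
  shows "degree (lagrange_poly \<Lambda> \<eta>) < card \<Lambda>"
proof -
  have "degree (lagrange_poly \<Lambda> \<eta>) \<le> (\<Sum>\<mu>\<in>\<Lambda> - {\<eta>}. degree (smult (1 / (\<eta> - \<mu>)) [:- \<mu>, 1:]))"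
    unfolding lagrange_poly_def
    using assms(1) degree_prod_sum_le[of "\<Lambda> - {\<eta>}" "\<lambda>\<mu>. smult (1 / (\<eta> - \<mu>)) [:- \<mu>, 1:]"] by (simp only: o_def finite_Diff)
  also have "\<dots> \<le> (\<Sum>\<mu>\<in>\<Lambda> - {\<eta>}. 1)"
    by (intro sum_mono order_trans[OF degree_smult_le]) simp
  also have "\<dots> = card (\<Lambda> - {\<eta>})"
    by (rule card_eq_sum[symmetric])
  also have "\<dots> < card \<Lambda>"
    using assms by (rule card_Diff1_less)
  finally show ?thesis .
qed

text \<open>Both sides have degree below card \<Lambda> and agree at the points of
  \<Lambda>.\<close>

lemma sum_lagrange_poly:
  assumes "finite \<Lambda>" "\<Lambda> \<noteq> {}"
  shows "(\<Sum>\<eta>\<in>\<Lambda>. lagrange_poly \<Lambda> \<eta>) = 1"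
proof (rule poly_eqI_degree[of \<Lambda>])
  show "poly (\<Sum>\<eta>\<in>\<Lambda>. lagrange_poly \<Lambda> \<eta>) x = poly 1 x" if "x \<in> \<Lambda>" for x
    using assms that by (simp add: poly_sum poly_lagrange_poly)
  show "degree (\<Sum>\<eta>\<in>\<Lambda>. lagrange_poly \<Lambda> \<eta>) < card \<Lambda>"
    using assms by (intro degree_sum_less degree_lagrange_poly) (auto simp: card_gt_0_iff)
qed (use assms in \<open>auto simp: card_gt_0_iff\<close>)

text \<open>The laws of A = \<Sum> \<eta> E \<eta> in pointwise form. The eigenvalues are kept as
  complex numbers fixed by conjugation, so that they act directly through the complex scalar
  multiplication.\<close>

locale spectral_resolution =
  fixes A :: "'a::complex_hilbert \<Rightarrow>\<^sub>L 'a" and \<Lambda> :: "complex set" and E :: "complex \<Rightarrow> 'a \<Rightarrow>\<^sub>L 'a"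
  assumes finite_spectrum: "finite \<Lambda>"
    and E_bounded_ops [simp]: "E \<eta> \<in> bounded_ops"
    and adj_E: "\<eta> \<in> \<Lambda> \<Longrightarrow> adj (E \<eta>) = E \<eta>"
    and E_orthogonal: "\<eta> \<in> \<Lambda> \<Longrightarrow> \<mu> \<in> \<Lambda> \<Longrightarrow> E \<eta> (E \<mu> x) = (if \<eta> = \<mu> then E \<eta> x else 0)"
    and sum_E: "(\<Sum>\<eta>\<in>\<Lambda>. E \<eta> x) = x"
    and cnj_spectrum: "\<eta> \<in> \<Lambda> \<Longrightarrow> cnj \<eta> = \<eta>"
    and A_E: "\<eta> \<in> \<Lambda> \<Longrightarrow> A (E \<eta> x) = \<eta> *\<^sub>C E \<eta> x"
    and E_A: "\<eta> \<in> \<Lambda> \<Longrightarrow> E \<eta> (A x) = \<eta> *\<^sub>C E \<eta> x"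

text \<open>E \<eta> is the Lagrange polynomial of \<eta> evaluated at A. Multiplied by X - \<eta>,
  that polynomial becomes a multiple of the annihilating product, so the range of E \<eta> consists
  of eigenvectors. Comparing eigenvalues gives orthogonality, and the sum 1 of the polynomials gives
  the resolution of the identity.\<close>

lemma ex_spectral_resolution:
  fixes A :: "'a::complex_hilbert \<Rightarrow>\<^sub>L 'a"
  assumes A: "A \<in> bounded_ops" "adj A = A" and fin: "finite_dimensional_ops (cstar_generated A)"
  shows "\<exists>\<Lambda> E. spectral_resolution A \<Lambda> E"
proof -
  obtain p where "p \<noteq> 0" "\<forall>x. poly_op A p x = 0"
    using ex_annihilating_poly[OF A(1) fin] by blast
  from self_adjoint_annihilating_poly[OF A this] obtain \<Lambda> where
    \<Lambda>: "finite \<Lambda>" "\<Lambda> \<subseteq> \<real>" and ann: "\<And>x. poly_op A (\<Prod>\<mu>\<in>\<Lambda>. [:- \<mu>, 1:]) x = 0" by blast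
  have sa: "cinner (A x) y = cinner x (A y)" for x y
    using cinner_adj[OF A(1)] A(2) by simp
  define E where "E = (\<lambda>\<eta>. poly_op A (lagrange_poly \<Lambda> \<eta>))"
  have E_bd: "E \<eta> \<in> bounded_ops" for \<eta>
    using A by (simp add: E_def)
  have cnj: "cnj \<eta> = \<eta>" if "\<eta> \<in> \<Lambda>" for \<eta>
    using \<Lambda>(2) that by (auto simp: Reals_cnj_iff)
  have sumE: "(\<Sum>\<eta>\<in>\<Lambda>. E \<eta> x) = x" for x
  \<comment> \<open>For empty \<Lambda> the annihilating product is 1, so the space is zero and the
    empty sum is right.\<close>
  proof (cases "\<Lambda> = {}")
    case True
    then show ?thesis
      using ann[of x] by (simp add: poly_op_1)
  next
    case False
    then show ?thesis
      unfolding E_def poly_op_sum[symmetric] sum_lagrange_poly[OF \<Lambda>(1) False] by (simp add: poly_op_1)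
  qed
  have AE: "A (E \<eta> x) = \<eta> *\<^sub>C E \<eta> x" if "\<eta> \<in> \<Lambda>" for \<eta> x
  proof -
    have "lagrange_poly \<Lambda> \<eta> = smult (\<Prod>\<mu>\<in>\<Lambda> - {\<eta>}. 1 / (\<eta> - \<mu>)) (\<Prod>\<mu>\<in>\<Lambda> - {\<eta>}. [:- \<mu>, 1:])"
      unfolding lagrange_poly_def by (rule prod_smult)
    then have "[:- \<eta>, 1:] * lagrange_poly \<Lambda> \<eta> = smult (\<Prod>\<mu>\<in>\<Lambda> - {\<eta>}. 1 / (\<eta> - \<mu>)) (\<Prod>\<mu>\<in>\<Lambda>. [:- \<mu>, 1:])"
      using \<Lambda>(1) that by (simp only: prod.remove[of \<Lambda> \<eta>] mult_smult_right)
    then have "poly_op A [:- \<eta>, 1:] (E \<eta> x) = 0"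
      unfolding E_def poly_op_mult[OF A(1), symmetric] by (simp only: poly_op_smult[OF A(1)] ann) simp
    then show ?thesis
      by (simp only: poly_op_linear) simp
  qed
  have comm: "E \<eta> (A x) = A (E \<eta> x)" for \<eta> x
  proof -
    have "A x = poly_op A [:- 0, 1:] x" for x
      by (simp only: poly_op_linear) simp
    then show ?thesis
      unfolding E_def by (metis poly_op_commute[OF A(1)])
  qed
  have EA: "E \<eta> (A x) = \<eta> *\<^sub>C E \<eta> x" if "\<eta> \<in> \<Lambda>" for \<eta> x
    using AE[OF that] comm by simp
  have diff: "E \<eta> (E \<mu> x) = 0" if "\<eta> \<in> \<Lambda>" "\<mu> \<in> \<Lambda>" "\<eta> \<noteq> \<mu>" for \<eta> \<mu> x
  proof -
    have "\<eta> *\<^sub>C E \<eta> (E \<mu> x) = \<mu> *\<^sub>C E \<eta> (E \<mu> x)"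
      using EA[OF that(1), of "E \<mu> x"] AE[OF that(2), of x] by (auto simp: bounded_opsD[OF E_bd])
    then show ?thesis
      using that(3) by simp
  qed
  have orth: "cinner (E \<eta> x) (E \<mu> y) = 0" if "\<eta> \<in> \<Lambda>" "\<mu> \<in> \<Lambda>" "\<eta> \<noteq> \<mu>" for \<eta> \<mu> x y
  proof -
    have "\<eta> * cinner (E \<eta> x) (E \<mu> y) = \<mu> * cinner (E \<eta> x) (E \<mu> y)"
      using sa[of "E \<eta> x" "E \<mu> y"] AE[OF that(1)] AE[OF that(2)] cnj[OF that(2)]
      by (simp add: cinner_scaleC_left cinner_scaleC_right)
    then show ?thesis
      using that(3) by simp
  qed
  have idem: "E \<eta> (E \<eta> x) = E \<eta> x" if "\<eta> \<in> \<Lambda>" for \<eta> x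
  proof -
    have "E \<eta> x = E \<eta> (\<Sum>\<mu>\<in>\<Lambda>. E \<mu> x)"
      by (simp only: sumE)
    also have "\<dots> = (\<Sum>\<mu>\<in>\<Lambda>. if \<mu> = \<eta> then E \<eta> (E \<eta> x) else 0)"
      unfolding blinfun.sum_right using diff[OF that] by (intro sum.cong) auto
    finally show ?thesis
      using \<Lambda>(1) that by simp
  qed
  \<comment> \<open>Inserting the resolution of the identity on either side leaves <E \<eta> x, E
    \<eta> y>, because different eigenspaces are orthogonal.\<close>
  have "adj (E \<eta>) = E \<eta>" if "\<eta> \<in> \<Lambda>" for \<eta>
  proof (rule adj_unique)
    fix x y
    have "cinner (E \<eta> x) y = cinner (E \<eta> x) (\<Sum>\<mu>\<in>\<Lambda>. E \<mu> y)"
      by (simp only: sumE)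
    also have "\<dots> = (\<Sum>\<mu>\<in>\<Lambda>. if \<mu> = \<eta> then cinner (E \<eta> x) (E \<eta> y) else 0)"
      unfolding cinner_sum_right using orth[OF that] by (intro sum.cong) auto
    also have "\<dots> = (\<Sum>\<mu>\<in>\<Lambda>. cinner (E \<mu> x) (E \<eta> y))"
      using orth[OF _ that] by (intro sum.cong) auto
    also have "\<dots> = cinner x (E \<eta> y)"
      unfolding cinner_sum_left[symmetric] sumE ..
    finally show "cinner (E \<eta> x) y = cinner x (E \<eta> y)" .
  qed
  then have "spectral_resolution A \<Lambda> E"
    using \<Lambda> E_bd cnj sumE AE EA diff idem by unfold_locales auto
  then show ?thesis by blast
qed

section \<open>Products on the self-adjoint Hilbert-Schmidt operators\<close>

text \<open>A quarter of the squared norm of \<open>hs_sa\<close>, but available for operators that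
  are not self-adjoint, such as the separate terms of a symmetrised product.\<close>

definition hs_sq :: "('a::complex_hilbert \<Rightarrow>\<^sub>L 'a) \<Rightarrow> real" where
  "hs_sq x = (\<Sum>\<^sub>\<infinity>e\<in>some_onb. (norm (x e))\<^sup>2)"

lemma norm_hs_sa_sq: "(norm x)\<^sup>2 = 4 * hs_sq (hs_op x)"
  using infsumI[OF norm_hs_sa_has_sum[of x]] by (simp add: hs_sq_def infsum_cmult_right')

lemma hs_sq_adj: "hilbert_schmidt x \<Longrightarrow> hs_sq (adj x) = hs_sq x"
  unfolding hs_sq_def by (intro hs_sum_adj_eq is_onb_some_onb)

lemma norm_adj_le:
  fixes T :: "'a::complex_hilbert \<Rightarrow>\<^sub>L 'a"
  assumes T: "T \<in> bounded_ops"
  shows "norm (adj T) \<le> norm T"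
proof (rule norm_blinfun_bound)
  fix y
  show "norm (adj T y) \<le> norm T * norm y"
  proof (cases "adj T y = 0")
    case False
    have "(norm (adj T y))\<^sup>2 = inner (adj T y) (adj T y)"
      by (rule power2_norm_eq_inner)
    also have "\<dots> = inner (T (adj T y)) y"
      by (simp only: cinner_adj[OF T] flip: Re_cinner)
    also have "\<dots> \<le> (norm T * norm (adj T y)) * norm y"
      by (intro order_trans[OF norm_cauchy_schwarz] mult_right_mono norm_blinfun) simp
    finally show ?thesis
      using False by (simp add: power2_eq_square mult_ac)
  qed simp
qed simp

lemma hs_sq_comp_left:
  fixes x T :: "'a::complex_hilbert \<Rightarrow>\<^sub>L 'a"
  assumes x: "hilbert_schmidt x" and T: "T \<in> bounded_ops"
  shows "hs_sq (T o\<^sub>L x) \<le> (norm T)\<^sup>2 * hs_sq x"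
proof -
  have "hs_sq (T o\<^sub>L x) \<le> (\<Sum>\<^sub>\<infinity>e\<in>some_onb. (norm T)\<^sup>2 * (norm (x e))\<^sup>2)"
    unfolding hs_sq_def
  proof (rule infsum_mono)
    show "(\<lambda>e. (norm ((T o\<^sub>L x) e))\<^sup>2) summable_on some_onb"
      by (intro hilbert_schmidt_summable hilbert_schmidt_comp_left x T is_onb_some_onb)
    show "(\<lambda>e. (norm T)\<^sup>2 * (norm (x e))\<^sup>2) summable_on some_onb"
      by (intro summable_on_cmult_right hilbert_schmidt_summable x is_onb_some_onb)
    show "(norm ((T o\<^sub>L x) e))\<^sup>2 \<le> (norm T)\<^sup>2 * (norm (x e))\<^sup>2" for e
      using norm_blinfun[of T "x e"] by (simp add: power_mono flip: power_mult_distrib)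
  qed
  then show ?thesis
    by (simp add: hs_sq_def infsum_cmult_right')
qed

lemma hs_sq_nonneg: "0 \<le> hs_sq x"
  by (simp add: hs_sq_def infsum_nonneg)

text \<open>A sum over basis vectors controls left factors only; the invariance of
  \<open>hs_sq\<close> under adjoints moves T to the left.\<close>

lemma hs_sq_comp_right:
  fixes x T :: "'a::complex_hilbert \<Rightarrow>\<^sub>L 'a"
  assumes x: "hilbert_schmidt x" and T: "T \<in> bounded_ops"
  shows "hs_sq (x o\<^sub>L T) \<le> (norm T)\<^sup>2 * hs_sq x"
proof -
  have "hs_sq (x o\<^sub>L T) = hs_sq (adj T o\<^sub>L adj x)"
    using hs_sq_adj[OF hilbert_schmidt_comp_right[OF x T]] x T
    by (simp add: adj_comp hilbert_schmidt_bounded_ops)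
  also have "\<dots> \<le> (norm (adj T))\<^sup>2 * hs_sq (adj x)"
    by (intro hs_sq_comp_left hilbert_schmidt_adj x adj_in_bounded_ops T)
  also have "\<dots> \<le> (norm T)\<^sup>2 * hs_sq x"
    unfolding hs_sq_adj[OF x] by (intro mult_right_mono power_mono norm_adj_le T hs_sq_nonneg) simp
  finally show ?thesis .
qed

lemma hs_sq_add_le:
  fixes x y :: "'a::complex_hilbert \<Rightarrow>\<^sub>L 'a"
  assumes x: "hilbert_schmidt x" and y: "hilbert_schmidt y"
  shows "hs_sq (x + y) \<le> 2 * hs_sq x + 2 * hs_sq y"
proof -
  have sx: "(\<lambda>e. 2 * (norm (x e))\<^sup>2) summable_on some_onb" and sy: "(\<lambda>e. 2 * (norm (y e))\<^sup>2) summable_on some_onb"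
    by (intro summable_on_cmult_right hilbert_schmidt_summable x y is_onb_some_onb)+
  have "hs_sq (x + y) \<le> (\<Sum>\<^sub>\<infinity>e\<in>some_onb. 2 * (norm (x e))\<^sup>2 + 2 * (norm (y e))\<^sup>2)"
    unfolding hs_sq_def
  proof (rule infsum_mono)
    show "(\<lambda>e. (norm ((x + y) e))\<^sup>2) summable_on some_onb"
      by (intro hilbert_schmidt_summable hilbert_schmidt_add x y is_onb_some_onb)
    show "(\<lambda>e. 2 * (norm (x e))\<^sup>2 + 2 * (norm (y e))\<^sup>2) summable_on some_onb"
      by (intro summable_on_add sx sy)
    fix e
    have "0 \<le> inner (x e - y e) (x e - y e)" by simp
    then show "(norm ((x + y) e))\<^sup>2 \<le> 2 * (norm (x e))\<^sup>2 + 2 * (norm (y e))\<^sup>2"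
      by (simp only: blinfun.add_left power2_norm_eq_inner) (simp add: algebra_simps inner_commute)
  qed
  also have "\<dots> = 2 * hs_sq x + 2 * hs_sq y"
    by (simp add: infsum_add[OF sx sy] hs_sq_def infsum_cmult_right')
  finally show ?thesis .
qed

section \<open>Symmetrised products\<close>

lemma hs_sa_eqI: "(\<And>v. hs_op x v = hs_op y v) \<Longrightarrow> x = y"
  by (metis blinfun_eqI hs_op_inject)

lemma hs_op_sum: "hs_op (sum f I) = (\<Sum>i\<in>I. hs_op (f i))"
  by (induction I rule: infinite_finite_induct) (simp_all add: hs_op_simps)

text \<open>S x T plus its adjoint, which keeps the result self-adjoint. The Jordan product, the
  commutator, the unitary conjugation, the block projection and the generator are all obtained from
  it, so that boundedness is proved once.\<close>

definition sandwich :: "('a::complex_hilbert \<Rightarrow>\<^sub>L 'a) \<Rightarrow> 'a hs_sa \<Rightarrow> ('a \<Rightarrow>\<^sub>L 'a) \<Rightarrow> 'a hs_sa" where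
  "sandwich S x T = Abs_hs_sa ((S o\<^sub>L hs_op x o\<^sub>L T) + (adj T o\<^sub>L hs_op x o\<^sub>L adj S))"

context
  fixes S T :: "'a::complex_hilbert \<Rightarrow>\<^sub>L 'a"
  assumes S: "S \<in> bounded_ops" and T: "T \<in> bounded_ops"
begin

lemma hilbert_schmidt_sandwich:
  "hilbert_schmidt (S o\<^sub>L hs_op x o\<^sub>L T)" "hilbert_schmidt (adj T o\<^sub>L hs_op x o\<^sub>L adj S)"
  by (intro hilbert_schmidt_comp_right hilbert_schmidt_comp_left hilbert_schmidt_hs_op adj_in_bounded_ops S T)+

lemma hs_op_sandwich: "hs_op (sandwich S x T) = (S o\<^sub>L hs_op x o\<^sub>L T) + (adj T o\<^sub>L hs_op x o\<^sub>L adj S)"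
  unfolding sandwich_def
proof (rule Abs_hs_sa_inverse, intro CollectI conjI)
  show "adj ((S o\<^sub>L hs_op x o\<^sub>L T) + (adj T o\<^sub>L hs_op x o\<^sub>L adj S)) = (S o\<^sub>L hs_op x o\<^sub>L T) + (adj T o\<^sub>L hs_op x o\<^sub>L adj S)"
    by (rule adj_unique)
      (simp add: blinfun.add_left cinner_add_left cinner_add_right S T cinner_adj adj_adj adj_hs_op)
qed (intro hilbert_schmidt_add hilbert_schmidt_sandwich)

lemma sandwich_apply: "hs_op (sandwich S x T) v = S (hs_op x (T v)) + adj T (hs_op x (adj S v))"
  by (simp add: hs_op_sandwich blinfun.add_left)

lemma norm_sandwich_le: "norm (sandwich S x T) \<le> 2 * norm S * norm x * norm T"
proof -
  have 1: "hs_sq (S' o\<^sub>L hs_op x o\<^sub>L T') \<le> (norm S)\<^sup>2 * (norm T)\<^sup>2 * hs_sq (hs_op x)"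
    if "S' \<in> bounded_ops" "T' \<in> bounded_ops" "norm S' * norm T' \<le> norm S * norm T" for S' T'
  proof -
    have "hs_sq (S' o\<^sub>L hs_op x o\<^sub>L T') \<le> (norm T')\<^sup>2 * hs_sq (S' o\<^sub>L hs_op x)"
      by (intro hs_sq_comp_right hilbert_schmidt_comp_left hilbert_schmidt_hs_op that)
    also have "\<dots> \<le> (norm T')\<^sup>2 * ((norm S')\<^sup>2 * hs_sq (hs_op x))"
      by (intro mult_left_mono hs_sq_comp_left hilbert_schmidt_hs_op that) simp
    also have "\<dots> = (norm S' * norm T')\<^sup>2 * hs_sq (hs_op x)"
      by (simp add: power_mult_distrib)
    also have "\<dots> \<le> (norm S * norm T)\<^sup>2 * hs_sq (hs_op x)"
      by (intro mult_right_mono power_mono that hs_sq_nonneg) simp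
    finally show ?thesis by (simp add: power_mult_distrib)
  qed
  have "norm (adj T) * norm (adj S) \<le> norm S * norm T"
    using mult_mono[OF norm_adj_le[OF T] norm_adj_le[OF S]] by (simp add: mult.commute)
  then have 2: "hs_sq (adj T o\<^sub>L hs_op x o\<^sub>L adj S) \<le> (norm S)\<^sup>2 * (norm T)\<^sup>2 * hs_sq (hs_op x)"
    by (intro 1 adj_in_bounded_ops S T)
  have "hs_sq (hs_op (sandwich S x T)) \<le> 2 * hs_sq (S o\<^sub>L hs_op x o\<^sub>L T) + 2 * hs_sq (adj T o\<^sub>L hs_op x o\<^sub>L adj S)"
    unfolding hs_op_sandwich by (intro hs_sq_add_le hilbert_schmidt_sandwich)
  also have "\<dots> \<le> 4 * ((norm S)\<^sup>2 * (norm T)\<^sup>2 * hs_sq (hs_op x))"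
    using 1[OF S T order_refl] 2 by linarith
  finally have "(norm (sandwich S x T))\<^sup>2 \<le> (2 * norm S * norm x * norm T)\<^sup>2"
    by (simp add: norm_hs_sa_sq power_mult_distrib mult_ac)
  then show ?thesis
    by (rule power2_le_imp_le) simp
qed

lemma bounded_linear_sandwich: "bounded_linear (\<lambda>x. sandwich S x T)"
proof (rule bounded_linear_intro)
  show "norm (sandwich S x T) \<le> norm x * (2 * norm S * norm T)" for x
    using norm_sandwich_le[of x] by (simp add: mult_ac)
qed (rule hs_sa_eqI, simp add: sandwich_apply hs_op_simps blinfun.bilinear_simps algebra_simps)+

end

lemma bounded_bilinear_sandwich:
  assumes S: "S \<in> bounded_ops" and L: "bounded_linear L" "\<And>y. L y \<in> bounded_ops"
  shows "bounded_bilinear (\<lambda>x y. sandwich S x (L y))"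
proof -
  interpret L: bounded_linear L by fact
  obtain l where l: "0 < l" "\<And>y. norm (L y) \<le> norm y * l"
    using L.pos_bounded by blast
  note simps = hs_op_simps blinfun.bilinear_simps adj_add adj_scaleR L.add L.scaleR sandwich_apply[OF S L(2)] L(2)
  show ?thesis
  proof
    show "sandwich S (x + x') (L y) = sandwich S x (L y) + sandwich S x' (L y)" for x x' y
      by (rule hs_sa_eqI) (simp add: simps algebra_simps)
    show "sandwich S (r *\<^sub>R x) (L y) = r *\<^sub>R sandwich S x (L y)" for r x y
      by (rule hs_sa_eqI) (simp add: simps algebra_simps)
    show "sandwich S x (L (y + y')) = sandwich S x (L y) + sandwich S x (L y')" for x y y'
      by (rule hs_sa_eqI) (simp add: hs_op_simps blinfun.bilinear_simps adj_add L.add sandwich_apply S L(2) algebra_simps)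
    show "sandwich S x (L (r *\<^sub>R y)) = r *\<^sub>R sandwich S x (L y)" for r x y
      by (rule hs_sa_eqI) (simp add: hs_op_simps blinfun.bilinear_simps adj_scaleR L.scaleR sandwich_apply S L(2) algebra_simps)
    have "norm (sandwich S x (L y)) \<le> norm x * norm y * (2 * norm S * l)" for x y
    proof -
      have "norm (sandwich S x (L y)) \<le> 2 * norm S * norm x * norm (L y)"
        by (rule norm_sandwich_le[OF S L(2)])
      also have "\<dots> \<le> 2 * norm S * norm x * (norm y * l)"
        by (intro mult_left_mono l) simp
      finally show ?thesis by (simp add: mult_ac)
    qed
    then show "\<exists>K. \<forall>x y. norm (sandwich S x (L y)) \<le> norm x * norm y * K" by blast
  qed
qed

lemma bounded_linear_hs_op: "bounded_linear hs_op"
  by (rule bounded_linear_intro[where K = 1]) (simp_all add: hs_op_simps norm_hs_op_le)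

lemma norm_scaleC_op_le: "norm (scaleC_op c T) \<le> cmod c * norm T"
  by (rule norm_blinfun_bound) (simp_all add: scaleC_op.rep_eq norm_scaleC mult.assoc mult_left_mono norm_blinfun)

lemma bounded_linear_scaleC_op: "bounded_linear (scaleC_op c)"
proof (rule bounded_linear_intro)
  show "norm (scaleC_op c T) \<le> norm T * cmod c" for T :: "'a \<Rightarrow>\<^sub>L 'a"
    using norm_scaleC_op_le by (simp add: mult.commute)
  show "scaleC_op c (r *\<^sub>R T) = r *\<^sub>R scaleC_op c T" for r and T :: "'a \<Rightarrow>\<^sub>L 'a"
    by (simp add: scaleR_op mult.commute)
qed (rule complex_op.scale_right_distrib)

text \<open>The product x y + y x without the customary factor 1/2; thus \<open>jordan k k\<close>
  is 2 k^2.\<close>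

definition jordan :: "'a::complex_hilbert hs_sa \<Rightarrow> 'a hs_sa \<Rightarrow> 'a hs_sa" where
  "jordan x y = sandwich id_blinfun x (hs_op y)"

text \<open>Up to the factor \<open>\<i>\<close>, the commutator of self-adjoint operators.\<close>

definition lie :: "'a::complex_hilbert hs_sa \<Rightarrow> 'a hs_sa \<Rightarrow> 'a hs_sa" where
  "lie x y = sandwich id_blinfun x (scaleC_op \<i> (hs_op y))"

lemma bounded_bilinear_jordan: "bounded_bilinear (jordan :: 'a::complex_hilbert hs_sa \<Rightarrow> _)"
  unfolding jordan_def by (intro bounded_bilinear_sandwich bounded_linear_hs_op) simp_all

lemma bounded_bilinear_lie: "bounded_bilinear (lie :: 'a::complex_hilbert hs_sa \<Rightarrow> _)"
  unfolding lie_def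
  by (intro bounded_bilinear_sandwich bounded_linear_compose[OF bounded_linear_scaleC_op bounded_linear_hs_op]) simp_all

lemma jordan_apply: "hs_op (jordan x y) v = hs_op x (hs_op y v) + hs_op y (hs_op x v)"
  by (simp add: jordan_def sandwich_apply adj_hs_op adj_id)

lemma lie_apply: "hs_op (lie x y) v = \<i> *\<^sub>C (hs_op x (hs_op y v) - hs_op y (hs_op x v))"
  by (simp add: lie_def sandwich_apply adj_hs_op adj_id adj_scaleC scaleC_op.rep_eq bounded_opsD
      complex_vec.scale_right_diff_distrib blinfun.minus_left)

section \<open>Unitary conjugation and the Cayley transform\<close>

lemma unitary_hs_cancel:
  assumes "g \<in> unitary_hs"
  shows "adj g (g v) = v" "g (adj g v) = v"
proof -
  have "adj g o\<^sub>L g = id_blinfun" "g o\<^sub>L adj g = id_blinfun"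
    using assms by (simp_all add: unitary_hs_def)
  then show "adj g (g v) = v" "g (adj g v) = v"
    by (metis blinfun_apply_blinfun_compose id_blinfun.rep_eq id_apply)+
qed

lemma unitary_hs_adj:
  assumes g: "g \<in> unitary_hs"
  shows "adj g \<in> unitary_hs"
proof -
  obtain x where x: "hilbert_schmidt x" "g = id_blinfun + x"
    using g by (auto simp: unitary_hs_def)
  then have "adj g = id_blinfun + adj x"
    by (simp add: adj_add adj_id hilbert_schmidt_bounded_ops)
  then show ?thesis
    using g hilbert_schmidt_adj[OF x(1)] adj_adj[OF unitary_hs_bounded_ops[OF g]]
    by (auto simp: unitary_hs_def)
qed

lemma unitary_hs_comp:
  assumes g: "g \<in> unitary_hs" and h: "h \<in> unitary_hs"
  shows "g o\<^sub>L h \<in> unitary_hs"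
proof -
  obtain x y where x: "hilbert_schmidt x" "g = id_blinfun + x" and y: "hilbert_schmidt y" "h = id_blinfun + y"
    using g h by (auto simp: unitary_hs_def)
  have adj: "adj (g o\<^sub>L h) = adj h o\<^sub>L adj g"
    by (rule adj_comp[OF unitary_hs_bounded_ops[OF g] unitary_hs_bounded_ops[OF h]])
  have "g o\<^sub>L h = id_blinfun + (x + (y + (x o\<^sub>L y)))"
    unfolding x(2) y(2) by (rule blinfun_eqI) (simp add: blinfun.bilinear_simps algebra_simps)
  moreover have "hilbert_schmidt (x + (y + (x o\<^sub>L y)))"
    using x(1) y(1) by (intro hilbert_schmidt_add hilbert_schmidt_comp_left hilbert_schmidt_bounded_ops)
  moreover have "(adj h o\<^sub>L adj g) o\<^sub>L (g o\<^sub>L h) = id_blinfun" "(g o\<^sub>L h) o\<^sub>L (adj h o\<^sub>L adj g) = id_blinfun"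
    by (rule blinfun_eqI, simp add: unitary_hs_cancel[OF g] unitary_hs_cancel[OF h])+
  ultimately show ?thesis
    unfolding unitary_hs_def mem_Collect_eq adj by blast
qed

lemma mem_unitary_orbit_iff:
  fixes a b :: "'a::complex_hilbert hs_sa"
  shows
  "b \<in> unitary_orbit a \<longleftrightarrow> (\<exists>g\<in>unitary_hs. \<forall>v. hs_op b v = g (hs_op a (adj g v)))"
proof -
  have "S = T \<longleftrightarrow> (\<forall>v. S v = T v)" for S T :: "'a \<Rightarrow>\<^sub>L 'a"
    by (metis blinfun_eqI)
  then show ?thesis
    by (simp add: unitary_orbit_def)
qed

text \<open>The unitary is the Cayley transform \<open>(1 - K)\<^sup>-\<^sup>1 (1 + K)\<close> of \<open>K = \<i> k\<close>.\<close>

lemma Cayley_conjugation: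
  fixes k :: "'a::complex_hilbert hs_sa"
  assumes k: "norm k \<le> 1 / 2"
    and eq: "\<And>v. B (v + \<i> *\<^sub>C hs_op k v) - \<i> *\<^sub>C hs_op k (B (v + \<i> *\<^sub>C hs_op k v)) =
      X (v - \<i> *\<^sub>C hs_op k v) + \<i> *\<^sub>C hs_op k (X (v - \<i> *\<^sub>C hs_op k v))"
  shows "\<exists>u\<in>unitary_hs. \<forall>v. B v = u (X (adj u v))"
proof -
  define K where "K = scaleC_op \<i> (hs_op k)"
  have K: "K \<in> bounded_ops" "adj K = - K"
    by (simp_all add: K_def adj_scaleC adj_hs_op complex_op.scale_minus_left)
  have "norm (K v) \<le> norm v / 2" for v
  proof -
    have "norm (K v) \<le> norm (hs_op k) * norm v"
      by (simp add: K_def scaleC_op.rep_eq norm_scaleC norm_blinfun)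
    also have "\<dots> \<le> 1 / 2 * norm v"
      using k by (intro mult_right_mono order_trans[OF norm_hs_op_le]) auto
    finally show ?thesis by simp
  qed
  \<comment> \<open>The perturbation is T = - K, so the map obtained is M = (1 - K)^-1.\<close>
  then have "bounded_linear (\<lambda>v. - K v)" "norm (- K v) \<le> norm v / 2" for v
    by (simp_all add: bounded_linear_minus blinfun.bounded_linear_right)
  from bounded_linear_Neumann[OF this] obtain m where m: "bounded_linear m"
    "\<And>v. m v - K (m v) = v" "\<And>v. m (v - K v) = v"
    by (metis add_uminus_conv_diff)
  define M where "M = Blinfun m"
  have M: "M v - K (M v) = v" "M (v - K v) = v" for v
    using m by (simp_all add: M_def bounded_linear_Blinfun_apply)
  have M_bd: "M \<in> bounded_ops"
    unfolding bounded_ops_def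
  proof (intro CollectI allI)
    fix c v
    have "M (c *\<^sub>C v) = M (c *\<^sub>C (M v - K (M v)))"
      by (simp only: M)
    also have "\<dots> = M (c *\<^sub>C M v - K (c *\<^sub>C M v))"
      by (simp add: bounded_opsD[OF K(1)] complex_vec.scale_right_diff_distrib)
    also have "\<dots> = c *\<^sub>C M v"
      by (rule M)
    finally show "M (c *\<^sub>C v) = c *\<^sub>C M v" .
  qed
  \<comment> \<open>Since K is skew-adjoint, N is (1 + K)^-1; \<open>KN\<close> and
    \<open>NK\<close> establish this by testing against all vectors.\<close>
  define N where "N = adj M"
  have N_bd: "N \<in> bounded_ops"
    using M_bd by (simp add: N_def)
  have KM: "K (M v) = M v - v" and MK: "M (K v) = M v - v" for v
    using M[of v] by (simp_all add: blinfun.diff_right algebra_simps)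
  have cK: "cinner (K x) y = - cinner x (K y)" for x y
    using cinner_adj[OF K(1), of x y] by (simp add: K(2) blinfun.minus_left cinner_minus_right)
  have cN: "cinner x (N y) = cinner (M x) y" for x y
    using cinner_adj[OF M_bd] by (simp add: N_def)
  have KN: "K (N v) = v - N v" for v
  proof (rule cinner_eqI')
    fix y
    have "cinner y (K (N v)) = - cinner (M (K y)) v"
      using cK[of y "N v"] cN[of "K y" v] by simp
    also have "\<dots> = cinner y (v - N v)"
      by (simp add: MK cN cinner_diff_left cinner_diff_right)
    finally show "cinner y (K (N v)) = cinner y (v - N v)" .
  qed
  have NK: "N (K v) = v - N v" for v
  proof (rule cinner_eqI')
    fix y
    have "cinner y (N (K v)) = - cinner (K (M y)) v"
      using cK[of "M y" v] by (simp add: cN)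
    also have "\<dots> = cinner y (v - N v)"
      by (simp add: KM cN cinner_diff_left cinner_diff_right)
    finally show "cinner y (N (K v)) = cinner y (v - N v)" .
  qed
  \<comment> \<open>Partial fractions: 2 / (1 - K^2) = 1 / (1 + K) + 1 / (1 - K). Unitarity of u
    follows from this identity alone.\<close>
  have NM: "2 *\<^sub>R N (M v) = N v + M v" for v
    using NK[of "M v"] by (simp add: KM blinfun.diff_right scaleR_2 algebra_simps)
  have MN: "2 *\<^sub>R M (N v) = N v + M v" for v
    using MK[of "N v"] by (simp add: KN blinfun.diff_right scaleR_2 algebra_simps)
  \<comment> \<open>(1 - K)^-1 (1 + K) = 2 (1 - K)^-1 - 1, because 1 + K = 2 - (1 - K).\<close>
  define u where "u = 2 *\<^sub>R M - id_blinfun"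
  have u: "u v = 2 *\<^sub>R M v - v" for v
    by (simp add: u_def blinfun.bilinear_simps)
  have adj_u: "adj u = 2 *\<^sub>R N - id_blinfun"
    by (rule adj_unique) (simp add: u_def blinfun.bilinear_simps cinner_diff_left cinner_diff_right
      cinner_add_left cinner_add_right scaleR_2 cN)
  then have u': "adj u v = 2 *\<^sub>R N v - v" for v
    by (simp add: blinfun.bilinear_simps)
  have uu: "u (adj u v) = v" "adj u (u v) = v" for v
  proof -
    have "u (adj u v) = 2 *\<^sub>R (2 *\<^sub>R M (N v)) - 2 *\<^sub>R N v - (2 *\<^sub>R M v - v)"
      by (simp only: u u' blinfun.diff_right blinfun.scaleR_right scaleR_diff_right)
    then show "u (adj u v) = v"
      unfolding MN by (simp add: scaleR_add_right)
    have "adj u (u v) = 2 *\<^sub>R (2 *\<^sub>R N (M v)) - 2 *\<^sub>R M v - (2 *\<^sub>R N v - v)"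
      by (simp only: u u' blinfun.diff_right blinfun.scaleR_right scaleR_diff_right)
    then show "adj u (u v) = v"
      unfolding NM by (simp add: scaleR_add_right)
  qed
  have "u \<in> unitary_hs"
    unfolding unitary_hs_def
  \<comment> \<open>u - 1 = 2 (M - 1) = 2 M K is Hilbert-Schmidt because K is.\<close>
  proof (intro CollectI conjI exI[of _ "2 *\<^sub>R (M o\<^sub>L K)"])
    show "hilbert_schmidt (2 *\<^sub>R (M o\<^sub>L K))"
      unfolding K_def
      by (intro hilbert_schmidt_scaleR hilbert_schmidt_comp_left hilbert_schmidt_scaleC hilbert_schmidt_hs_op M_bd)
    show "u = id_blinfun + 2 *\<^sub>R (M o\<^sub>L K)"
      by (rule blinfun_eqI) (simp add: u blinfun.bilinear_simps MK scaleR_diff_right scaleR_2)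
  qed (rule blinfun_eqI, simp add: uu)+
  moreover have "B v = u (X (adj u v))" for v
  proof -
    \<comment> \<open>Evaluating the hypothesis at N v removes 1 + K on the left side and produces
      adj u on the right; applying M then removes 1 - K and produces u.\<close>
    have "N v + K (N v) = v" "N v - K (N v) = adj u v"
      by (simp_all add: KN u' scaleR_2)
    then have "B v - K (B v) = X (adj u v) + K (X (adj u v))"
      using eq[of "N v"] by (simp add: K_def scaleC_op.rep_eq)
    then have "M (B v - K (B v)) = M (X (adj u v) + K (X (adj u v)))"
      by simp
    then show ?thesis
      by (simp only: M u blinfun.add_right MK scaleR_2) (simp add: algebra_simps)
  qed
  ultimately show ?thesis by blast
qed

section \<open>The chart at the base point\<close>

context spectral_resolution
begin

text \<open>The pinching \<Sum> E \<eta> z E \<eta>, which projects onto the operators commuting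
  with every E \<eta>. The factor 1/2 offsets the doubling in \<open>sandwich\<close>.\<close>

definition block_diag :: "'a hs_sa \<Rightarrow> 'a hs_sa" where
  "block_diag z = (\<Sum>\<eta>\<in>\<Lambda>. sandwich ((1/2) *\<^sub>R E \<eta>) z (E \<eta>))"

text \<open>
  The diagonal terms vanish because of the division by zero. Up to the factor \<open>\<i>\<close>, this inverts
  the commutator with \<open>A\<close> on the operators without diagonal blocks.
\<close>

definition generator :: "'a hs_sa \<Rightarrow> 'a hs_sa" where
  "generator z = (\<Sum>\<eta>\<in>\<Lambda>. \<Sum>\<mu>\<in>\<Lambda>. sandwich (scaleC_op (\<i> / (4 * (\<eta> - \<mu>))) (E \<eta>)) z (E \<mu>))"

lemma bounded_linear_block_diag: "bounded_linear block_diag"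
  unfolding block_diag_def[abs_def] by (intro bounded_linear_sum bounded_linear_sandwich) simp_all

lemma bounded_linear_generator: "bounded_linear generator"
  unfolding generator_def[abs_def] by (intro bounded_linear_sum bounded_linear_sandwich) simp_all

lemma block_diag_apply: "hs_op (block_diag z) v = (\<Sum>\<eta>\<in>\<Lambda>. E \<eta> (hs_op z (E \<eta> v)))"
  unfolding block_diag_def hs_op_sum blinfun.sum_left
proof (rule sum.cong[OF refl])
  fix \<eta> assume "\<eta> \<in> \<Lambda>"
  then show "hs_op (sandwich ((1/2) *\<^sub>R E \<eta>) z (E \<eta>)) v = E \<eta> (hs_op z (E \<eta> v))"
    by (simp add: sandwich_apply adj_scaleR adj_E blinfun.bilinear_simps flip: scaleR_add_left)
qed

text \<open>The block E \<eta> z E \<mu> occurs twice, from the pair (\<eta>, \<mu>) and as the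
  adjoint term of (\<mu>, \<eta>). Real eigenvalues make the two coefficients equal, which turns the
  4 of the definition into 2.\<close>

lemma generator_apply:
  "hs_op (generator z) v = (\<Sum>\<eta>\<in>\<Lambda>. \<Sum>\<mu>\<in>\<Lambda>. (\<i> / (2 * (\<eta> - \<mu>))) *\<^sub>C E \<eta> (hs_op z (E \<mu> v)))"
proof -
  let ?c = "\<lambda>\<eta> \<mu>. \<i> / (4 * (\<eta> - \<mu>))" and ?z = "\<lambda>\<eta> \<mu>. E \<eta> (hs_op z (E \<mu> v))"
  have c: "cnj (?c \<mu> \<eta>) = ?c \<eta> \<mu>" if "\<eta> \<in> \<Lambda>" "\<mu> \<in> \<Lambda>" for \<eta> \<mu>
    using minus_divide_right[of \<i> "4 * (\<mu> - \<eta>)"] by (simp add: cnj_spectrum that algebra_simps)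
  have cc: "\<i> / (4 * w) + \<i> / (4 * w) = \<i> / (2 * w)" for w
    by (cases "w = 0") (simp_all add: field_simps)
  have "hs_op (generator z) v = (\<Sum>\<eta>\<in>\<Lambda>. \<Sum>\<mu>\<in>\<Lambda>. ?c \<eta> \<mu> *\<^sub>C ?z \<eta> \<mu> + cnj (?c \<eta> \<mu>) *\<^sub>C ?z \<mu> \<eta>)"
    unfolding generator_def hs_op_sum blinfun.sum_left
    by (intro sum.cong refl) (simp only: sandwich_apply adj_scaleC adj_E scaleC_op.rep_eq E_bounded_ops
      bounded_ops_simps bounded_opsD hs_op_bounded_ops)
  also have "\<dots> = (\<Sum>\<eta>\<in>\<Lambda>. \<Sum>\<mu>\<in>\<Lambda>. ?c \<eta> \<mu> *\<^sub>C ?z \<eta> \<mu>) + (\<Sum>\<eta>\<in>\<Lambda>. \<Sum>\<mu>\<in>\<Lambda>. cnj (?c \<eta> \<mu>) *\<^sub>C ?z \<mu> \<eta>)"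
    by (simp only: sum.distrib)
  also have "(\<Sum>\<eta>\<in>\<Lambda>. \<Sum>\<mu>\<in>\<Lambda>. cnj (?c \<eta> \<mu>) *\<^sub>C ?z \<mu> \<eta>) = (\<Sum>\<eta>\<in>\<Lambda>. \<Sum>\<mu>\<in>\<Lambda>. ?c \<eta> \<mu> *\<^sub>C ?z \<eta> \<mu>)"
    by (subst sum.swap, intro sum.cong refl) (simp only: c)
  also have "(\<Sum>\<eta>\<in>\<Lambda>. \<Sum>\<mu>\<in>\<Lambda>. ?c \<eta> \<mu> *\<^sub>C ?z \<eta> \<mu>) + (\<Sum>\<eta>\<in>\<Lambda>. \<Sum>\<mu>\<in>\<Lambda>. ?c \<eta> \<mu> *\<^sub>C ?z \<eta> \<mu>) =
      (\<Sum>\<eta>\<in>\<Lambda>. \<Sum>\<mu>\<in>\<Lambda>. (\<i> / (2 * (\<eta> - \<mu>))) *\<^sub>C ?z \<eta> \<mu>)"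
    by (simp only: cc[symmetric] sum.distrib scaleC_add_left)
  finally show ?thesis .
qed

lemma E_block_diag:
  assumes "\<eta> \<in> \<Lambda>" "\<nu> \<in> \<Lambda>"
  shows "E \<eta> (hs_op (block_diag z) (E \<nu> v)) = (if \<eta> = \<nu> then E \<eta> (hs_op z (E \<nu> v)) else 0)"
proof -
  have "E \<eta> (hs_op (block_diag z) (E \<nu> v)) = (\<Sum>\<mu>\<in>\<Lambda>. E \<eta> (E \<mu> (hs_op z (E \<mu> (E \<nu> v)))))"
    by (simp add: block_diag_apply blinfun.sum_right)
  also have "\<dots> = (\<Sum>\<mu>\<in>\<Lambda>. if \<mu> = \<eta> then (if \<eta> = \<nu> then E \<eta> (hs_op z (E \<nu> v)) else 0) else 0)"
    using assms by (intro sum.cong) (auto simp: E_orthogonal blinfun.zero_right)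
  finally show ?thesis
    using assms finite_spectrum by simp
qed

lemma E_generator:
  assumes "\<eta> \<in> \<Lambda>" "\<nu> \<in> \<Lambda>"
  shows "E \<eta> (hs_op (generator z) (E \<nu> v)) = (\<i> / (2 * (\<eta> - \<nu>))) *\<^sub>C E \<eta> (hs_op z (E \<nu> v))"
proof -
  have "E \<eta> (hs_op (generator z) (E \<nu> v)) =
      (\<Sum>\<xi>\<in>\<Lambda>. \<Sum>\<mu>\<in>\<Lambda>. (\<i> / (2 * (\<xi> - \<mu>))) *\<^sub>C E \<eta> (E \<xi> (hs_op z (E \<mu> (E \<nu> v)))))"
    by (simp add: generator_apply blinfun.sum_right bounded_opsD)
  also have "\<dots> = (\<Sum>\<xi>\<in>\<Lambda>. if \<xi> = \<eta> then (\<Sum>\<mu>\<in>\<Lambda>. if \<mu> = \<nu> then (\<i> / (2 * (\<eta> - \<nu>))) *\<^sub>C E \<eta> (hs_op z (E \<nu> v)) else 0) else 0)"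
    using assms by (intro sum.cong refl) (auto simp: E_orthogonal blinfun.zero_right intro!: sum.cong)
  finally show ?thesis
    using assms finite_spectrum by simp
qed

lemma op_eqI_blocks:
  fixes S T :: "'a \<Rightarrow>\<^sub>L 'a"
  assumes "\<And>\<eta> \<nu> v. \<eta> \<in> \<Lambda> \<Longrightarrow> \<nu> \<in> \<Lambda> \<Longrightarrow> E \<eta> (S (E \<nu> v)) = E \<eta> (T (E \<nu> v))"
  shows "S = T"
proof (rule blinfun_eqI)
  fix v
  have *: "S v = (\<Sum>\<eta>\<in>\<Lambda>. \<Sum>\<nu>\<in>\<Lambda>. E \<eta> (S (E \<nu> v)))" for S :: "'a \<Rightarrow>\<^sub>L 'a"
  proof -
    have "S v = (\<Sum>\<eta>\<in>\<Lambda>. E \<eta> (S (\<Sum>\<nu>\<in>\<Lambda>. E \<nu> v)))"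
      by (simp only: sum_E)
    then show ?thesis
      by (simp only: blinfun.sum_right)
  qed
  show "S v = T v"
    unfolding *[of S] *[of T] using assms by (intro sum.cong refl)
qed

lemma E_block_diag_commute:
  assumes "\<eta> \<in> \<Lambda>"
  shows "E \<eta> (hs_op (block_diag z) v) = hs_op (block_diag z) (E \<eta> v)"
proof -
  have "E \<eta> o\<^sub>L hs_op (block_diag z) = hs_op (block_diag z) o\<^sub>L E \<eta>"
    using assms by (intro op_eqI_blocks) (simp add: E_orthogonal E_block_diag blinfun.zero_right)
  then show ?thesis
    by (metis blinfun_apply_blinfun_compose)
qed

text \<open>This is z = d - 2 [A, K], checked block by block: the commutator multiplies a block by
  (\<eta> - \<nu>) \<i> \<i> / (2 (\<eta> - \<nu>)), which is - 1/2 off the diagonal and 0 on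
  it.\<close>

lemma block_diag_generator:
  "hs_op z v = hs_op (block_diag z) v -
    2 *\<^sub>R (A (\<i> *\<^sub>C hs_op (generator z) v) - \<i> *\<^sub>C hs_op (generator z) (A v))"
proof -
  let ?k = "hs_op (generator z)"
  have "hs_op z = hs_op (block_diag z) - 2 *\<^sub>R ((A o\<^sub>L scaleC_op \<i> ?k) - (scaleC_op \<i> ?k o\<^sub>L A))"
  proof (rule op_eqI_blocks)
    fix \<eta> \<nu> v assume \<eta>\<nu>: "\<eta> \<in> \<Lambda>" "\<nu> \<in> \<Lambda>"
    let ?c = "\<i> * (\<i> / (2 * (\<eta> - \<nu>)))" and ?x = "E \<eta> (hs_op z (E \<nu> v))"
    have "E \<eta> (A (\<i> *\<^sub>C ?k (E \<nu> v))) = (\<eta> * ?c) *\<^sub>C ?x"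
      using \<eta>\<nu> by (simp only: E_A bounded_opsD[OF E_bounded_ops] E_generator scaleC_scaleC)
    moreover have "E \<eta> (\<i> *\<^sub>C ?k (A (E \<nu> v))) = (\<nu> * ?c) *\<^sub>C ?x"
      using \<eta>\<nu> by (simp only: A_E bounded_opsD[OF E_bounded_ops] bounded_opsD[OF hs_op_bounded_ops]
        E_generator scaleC_scaleC mult_ac)
    ultimately have "E \<eta> (A (\<i> *\<^sub>C ?k (E \<nu> v))) - E \<eta> (\<i> *\<^sub>C ?k (A (E \<nu> v))) = ((\<eta> - \<nu>) * ?c) *\<^sub>C ?x"
      by (simp only: complex_vec.scale_left_diff_distrib left_diff_distrib)
    also have "(\<eta> - \<nu>) * (\<i> * (\<i> / (2 * (\<eta> - \<nu>)))) = complex_of_real (if \<eta> = \<nu> then 0 else - 1/2)"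
      by (simp add: field_simps)
    finally have *: "E \<eta> (A (\<i> *\<^sub>C ?k (E \<nu> v))) - E \<eta> (\<i> *\<^sub>C ?k (A (E \<nu> v))) =
        (if \<eta> = \<nu> then 0 else - 1/2) *\<^sub>R E \<eta> (hs_op z (E \<nu> v))"
      by (simp only: scaleC_of_real)
    have "E \<eta> ((hs_op (block_diag z) - 2 *\<^sub>R ((A o\<^sub>L scaleC_op \<i> ?k) - (scaleC_op \<i> ?k o\<^sub>L A))) (E \<nu> v)) =
        E \<eta> (hs_op (block_diag z) (E \<nu> v)) -
        2 *\<^sub>R (E \<eta> (A (\<i> *\<^sub>C ?k (E \<nu> v))) - E \<eta> (\<i> *\<^sub>C ?k (A (E \<nu> v))))"
      by (simp only: blinfun.diff_left blinfun.diff_right blinfun.scaleR_left blinfun.scaleR_right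
        blinfun_apply_blinfun_compose scaleC_op.rep_eq)
    then show "E \<eta> (hs_op z (E \<nu> v)) =
        E \<eta> ((hs_op (block_diag z) - 2 *\<^sub>R ((A o\<^sub>L scaleC_op \<i> ?k) - (scaleC_op \<i> ?k o\<^sub>L A))) (E \<nu> v))"
      using \<eta>\<nu> by (simp add: * E_block_diag)
  qed
  then have "hs_op z v = (hs_op (block_diag z) - 2 *\<^sub>R ((A o\<^sub>L scaleC_op \<i> ?k) - (scaleC_op \<i> ?k o\<^sub>L A))) v"
    by simp
  then show ?thesis
    by (simp only: blinfun.diff_left blinfun.scaleR_left blinfun_apply_blinfun_compose scaleC_op.rep_eq)
qed

section \<open>Rigidity under small block diagonal perturbations\<close>

lemma ex_spectral_gap: "\<exists>\<delta>>0. \<forall>\<eta>\<in>\<Lambda>. \<forall>\<mu>\<in>\<Lambda>. \<eta> \<noteq> \<mu> \<longrightarrow> \<delta> \<le> cmod (\<eta> - \<mu>)"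
proof -
  \<comment> \<open>The element 1 makes the minimum exist when there are fewer than two
    eigenvalues.\<close>
  define D where "D = insert 1 ((\<lambda>(\<eta>, \<mu>). cmod (\<eta> - \<mu>)) ` {(\<eta>, \<mu>) \<in> \<Lambda> \<times> \<Lambda>. \<eta> \<noteq> \<mu>})"
  have "finite {(\<eta>, \<mu>) \<in> \<Lambda> \<times> \<Lambda>. \<eta> \<noteq> \<mu>}"
    by (rule finite_subset[of _ "\<Lambda> \<times> \<Lambda>"]) (auto simp: finite_spectrum)
  then have "finite D"
    by (simp add: D_def)
  moreover have "0 < d" if "d \<in> D" for d
    using that by (auto simp: D_def)
  moreover have "D \<noteq> {}"
    by (simp add: D_def)
  ultimately have "0 < Min D" "\<And>d. d \<in> D \<Longrightarrow> Min D \<le> d"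
    by simp_all
  moreover have "cmod (\<eta> - \<mu>) \<in> D" if "\<eta> \<in> \<Lambda>" "\<mu> \<in> \<Lambda>" "\<eta> \<noteq> \<mu>" for \<eta> \<mu>
    unfolding D_def using that by (intro insertI2 image_eqI[of _ _ "(\<eta>, \<mu>)"]) auto
  ultimately show ?thesis
    by blast
qed

text \<open>The spaces h (E \<mu> H) are eigenspaces of A + D with the old eigenvalues. As D
  commutes with E \<eta>, it acts on E \<eta> h (E \<mu> H) as the scalar \<mu> - \<eta>; for \<mu>
  different from \<eta> this exceeds the norm of D unless the space is zero. Only \<mu> = \<eta>
  remains, where D acts as 0.\<close>

lemma small_block_diagonal_perturbation_rigid:
  fixes D :: "'a \<Rightarrow>\<^sub>L 'a"
  assumes gap: "\<forall>\<eta>\<in>\<Lambda>. \<forall>\<mu>\<in>\<Lambda>. \<eta> \<noteq> \<mu> \<longrightarrow> \<delta> \<le> cmod (\<eta> - \<mu>)"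
    and D: "norm D < \<delta>" "\<And>\<eta> v. \<eta> \<in> \<Lambda> \<Longrightarrow> E \<eta> (D v) = D (E \<eta> v)"
    and h: "h \<in> unitary_hs" "\<And>v. A v + D v = h (A (adj h v))"
  shows "D v = 0"
proof -
  let ?Q = "\<lambda>\<mu> v. h (E \<mu> (adj h v))"
  have AQ: "A (?Q \<mu> v) + D (?Q \<mu> v) = \<mu> *\<^sub>C ?Q \<mu> v" if "\<mu> \<in> \<Lambda>" for \<mu> v
    using that by (simp add: h unitary_hs_cancel[OF h(1)] A_E bounded_opsD[OF unitary_hs_bounded_ops[OF h(1)]])
  have DEQ: "D (E \<eta> (?Q \<mu> v)) = (\<mu> - \<eta>) *\<^sub>C E \<eta> (?Q \<mu> v)" if "\<eta> \<in> \<Lambda>" "\<mu> \<in> \<Lambda>" for \<eta> \<mu> v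
  proof -
    have "\<eta> *\<^sub>C E \<eta> (?Q \<mu> v) + D (E \<eta> (?Q \<mu> v)) = E \<eta> (A (?Q \<mu> v) + D (?Q \<mu> v))"
      using that by (simp add: blinfun.add_right E_A D(2))
    also have "\<dots> = \<mu> *\<^sub>C E \<eta> (?Q \<mu> v)"
      using that by (simp add: AQ bounded_opsD)
    finally show ?thesis
      by (simp add: complex_vec.scale_left_diff_distrib algebra_simps)
  qed
  have EQ: "E \<eta> (?Q \<mu> v) = 0" if "\<eta> \<in> \<Lambda>" "\<mu> \<in> \<Lambda>" "\<eta> \<noteq> \<mu>" for \<eta> \<mu> v
  proof (rule ccontr)
    let ?x = "E \<eta> (?Q \<mu> v)"
    assume x: "?x \<noteq> 0"
    have "\<delta> * norm ?x \<le> cmod (\<mu> - \<eta>) * norm ?x"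
      using gap that by (intro mult_right_mono) auto
    also have "\<dots> = norm (D ?x)"
      by (simp only: DEQ[OF that(1,2)] norm_scaleC)
    also have "\<dots> \<le> norm D * norm ?x"
      by (rule norm_blinfun)
    also have "\<dots> < \<delta> * norm ?x"
      using D(1) x by (intro mult_strict_right_mono) auto
    finally show False by simp
  qed
  have DE: "D (E \<eta> v) = 0" if "\<eta> \<in> \<Lambda>" for \<eta>
  proof -
    have "v = h (\<Sum>\<mu>\<in>\<Lambda>. E \<mu> (adj h v))"
      by (simp add: sum_E unitary_hs_cancel[OF h(1)])
    then have "E \<eta> v = (\<Sum>\<mu>\<in>\<Lambda>. E \<eta> (?Q \<mu> v))"
      by (metis blinfun.sum_right)
    also have "\<dots> = (\<Sum>\<mu>\<in>\<Lambda>. if \<mu> = \<eta> then E \<eta> (?Q \<eta> v) else 0)"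
      using EQ[OF that] by (intro sum.cong) auto
    finally have "E \<eta> v = E \<eta> (?Q \<eta> v)"
      using that finite_spectrum by simp
    then show ?thesis
      using DEQ[OF that that] by simp
  qed
  have "D v = D (\<Sum>\<eta>\<in>\<Lambda>. E \<eta> v)"
    by (simp only: sum_E)
  also have "\<dots> = 0"
    by (simp add: blinfun.sum_right DE)
  finally show ?thesis .
qed

text \<open>
  With \<open>K = \<i> k\<close>, \<open>k = generator z\<close> and \<open>d = block_diag z\<close>, the identity
  \<open>(1 - K) (A + b) (1 + K) = (1 + K) (A + d) (1 - K)\<close> says
  \<open>z = b + [b + d, K] + K (d - b) K\<close>, and \<open>K m K = - k m k\<close>. The cubic term is expressed through the Jordan
  products \<open>k m + m k\<close> and \<open>2 k\<^sup>2\<close>, so that the equation becomes quadratic.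
\<close>

lemma Cayley_relation_imp_conjugate:
  fixes b z :: "'a hs_sa"
  defines "k \<equiv> generator z" and "d \<equiv> block_diag z"
  assumes rel: "z = b + (lie (b + d) k + (- (1/2)) *\<^sub>R jordan (jordan k (d - b)) k
      + (1/4) *\<^sub>R jordan (jordan k k) (d - b))"
    and k: "norm k \<le> 1 / 2" and A: "A \<in> bounded_ops"
  shows "\<exists>u\<in>unitary_hs. \<forall>v. A v + hs_op b v = u (A (adj u v) + hs_op d (adj u v))"
proof -
  let ?k = "hs_op k" and ?b = "hs_op b" and ?d = "hs_op d"
  note D = A[THEN bounded_opsD] bounded_opsD[OF hs_op_bounded_ops]
  have z1: "hs_op z v = ?b v + \<i> *\<^sub>C (?b (?k v) + ?d (?k v) - ?k (?b v) - ?k (?d v)) - ?k (?d (?k v) - ?b (?k v))" for v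
  proof -
    have "hs_op z v = ?b v + \<i> *\<^sub>C (?b (?k v) + ?d (?k v) - ?k (?b v) - ?k (?d v))
      - (1/2) *\<^sub>R (hs_op (jordan (jordan k (d - b)) k) v) + (1/4) *\<^sub>R hs_op (jordan (jordan k k) (d - b)) v"
      by (subst rel) (simp add: hs_op_simps blinfun.bilinear_simps lie_apply algebra_simps)
    \<comment> \<open>With m = d - b: half of (k m + m k) k + k (k m + m k) is k m k + (m k^2 + k^2
      m) / 2, and the second Jordan term removes the unwanted half sum.\<close>
    moreover have "(1/2) *\<^sub>R (hs_op (jordan (jordan k (d - b)) k) v) - (1/4) *\<^sub>R hs_op (jordan (jordan k k) (d - b)) v
       = ?k (?d (?k v) - ?b (?k v))"
      by (simp add: jordan_apply hs_op_simps blinfun.bilinear_simps algebra_simps flip: scaleR_add_left)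
    ultimately show ?thesis
      by (simp add: algebra_simps)
  qed
  have z2: "hs_op z v = ?d v - 2 *\<^sub>R (A (\<i> *\<^sub>C ?k v) - \<i> *\<^sub>C ?k (A v))" for v
    unfolding k_def d_def by (rule block_diag_generator)
  have "\<exists>u\<in>unitary_hs. \<forall>v. (A + ?b) v = u ((A + ?d) (adj u v))"
  proof (rule Cayley_conjugation[OF k])
    fix v
    \<comment> \<open>Equating the two expressions for z is the cleared identity: the terms A and K
      A K cancel between its sides, so A enters only through its commutator with K.\<close>
    have *: "?b v + \<i> *\<^sub>C (?b (?k v) + ?d (?k v) - ?k (?b v) - ?k (?d v)) - ?k (?d (?k v) - ?b (?k v))
       = ?d v - 2 *\<^sub>R (A (\<i> *\<^sub>C ?k v) - \<i> *\<^sub>C ?k (A v))"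
      using z1 z2 by metis
    show "(A + ?b) (v + \<i> *\<^sub>C ?k v) - \<i> *\<^sub>C ?k ((A + ?b) (v + \<i> *\<^sub>C ?k v)) =
      (A + ?d) (v - \<i> *\<^sub>C ?k v) + \<i> *\<^sub>C ?k ((A + ?d) (v - \<i> *\<^sub>C ?k v))"
      using * by (simp add: blinfun.bilinear_simps D scaleC_add_right complex_vec.scale_right_diff_distrib
        scaleC_scaleC scaleR_2 complex_vec.scale_minus_left scaleC_one algebra_simps)
  qed
  then show ?thesis
    by (simp add: blinfun.add_left)
qed

text \<open>The auxiliary unknown is the pair of Jordan products of k with d - b and with itself.
  One more product of each with a map linear in the unknowns gives the cubic terms, so P and R are
  bilinear in the triple.\<close>

lemma ex_Cayley_chart:
  assumes "0 < \<epsilon>"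
  obtains U V \<phi> \<psi> where "0 \<in> U" "analytic_diffeomorphism U V \<phi> \<psi>"
    "\<And>b. b \<in> U \<Longrightarrow> norm (\<phi> b) < \<epsilon>"
    "\<And>b k d. b \<in> U \<Longrightarrow> k = generator (\<phi> b) \<Longrightarrow> d = block_diag (\<phi> b) \<Longrightarrow>
      \<phi> b = b + (lie (b + d) k + (- (1/2)) *\<^sub>R jordan (jordan k (d - b)) k
        + (1/4) *\<^sub>R jordan (jordan k k) (d - b))"
proof -
  \<comment> \<open>\<open>?E\<close> is the identity; its annotation fixes the type of the triple
    (b, (w, w'), z), from which the other abbreviations project.\<close>
  let ?E = "\<lambda>v :: 'a hs_sa \<times> ('a hs_sa \<times> 'a hs_sa) \<times> 'a hs_sa. v"
  let ?b = "\<lambda>v. fst (?E v)" and ?w = "\<lambda>v. fst (fst (snd (?E v)))" and ?w' = "\<lambda>v. snd (fst (snd (?E v)))"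
    and ?k = "\<lambda>v. generator (snd (snd (?E v)))" and ?d = "\<lambda>v. block_diag (snd (snd (?E v)))"
  define P where "P = (\<lambda>u v. (jordan (?k u) (?d v - ?b v), jordan (?k u) (?k v)))"
  define R where "R = (\<lambda>u v. lie (?b u + ?d u) (?k v) + (- (1/2)) *\<^sub>R jordan (?w u) (?k v)
      + (1/4) *\<^sub>R jordan (?w' u) (?d v - ?b v))"
  have z: "bounded_linear (\<lambda>v. snd (snd (?E v)))"
    by (rule bounded_linear_compose[OF bounded_linear_snd bounded_linear_snd])
  have fs: "bounded_linear (\<lambda>v. fst (snd (?E v)))"
    by (rule bounded_linear_compose[OF bounded_linear_fst bounded_linear_snd])
  note lin = bounded_linear_compose[OF bounded_linear_generator z] bounded_linear_compose[OF bounded_linear_block_diag z]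
    bounded_linear_compose[OF bounded_linear_fst fs] bounded_linear_compose[OF bounded_linear_snd fs] bounded_linear_fst
  note lin' = lin bounded_linear_add[OF lin(5) lin(2)] bounded_linear_sub[OF lin(2) lin(5)]
  note jl = bounded_bilinear.comp[OF bounded_bilinear_jordan] bounded_bilinear.comp[OF bounded_bilinear_lie]
  have P: "bounded_bilinear P"
    unfolding P_def by (intro bounded_bilinear_Pair jl lin')
  have R: "bounded_bilinear R"
    unfolding R_def
    by (intro bounded_bilinear_add bounded_bilinear_compose_left[OF bounded_linear_scaleR_right] jl lin')
  obtain U V \<phi> \<psi> \<omega> where U: "0 \<in> U" "analytic_diffeomorphism U V \<phi> \<psi>"
    and imp: "\<And>b v. b \<in> U \<Longrightarrow> v = (b, \<omega> b, \<phi> b) \<Longrightarrow> norm v < \<epsilon> \<and> \<omega> b = P v v \<and> \<phi> b = b + R v v"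
    using quadratic_implicit[OF P R assms] by blast
  show ?thesis
  proof (rule that[OF U])
    fix b assume b: "b \<in> U"
    have "norm (\<phi> b) \<le> norm (\<omega> b, \<phi> b)" "norm (\<omega> b, \<phi> b) \<le> norm (b, \<omega> b, \<phi> b)"
      by (rule norm_snd_le)+
    then show "norm (\<phi> b) < \<epsilon>"
      using imp[OF b refl] by linarith
    fix k d assume kd: "k = generator (\<phi> b)" "d = block_diag (\<phi> b)"
    have w: "\<omega> b = (jordan k (d - b), jordan k k)"
      using imp[OF b refl] by (simp add: P_def kd)
    have "\<phi> b = b + R (b, \<omega> b, \<phi> b) (b, \<omega> b, \<phi> b)"
      using imp[OF b refl] by blast
    then show "\<phi> b = b + (lie (b + d) k + (- (1/2)) *\<^sub>R jordan (jordan k (d - b)) k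
        + (1/4) *\<^sub>R jordan (jordan k k) (d - b))"
      by (simp only: R_def w fst_conv snd_conv kd)
  qed
qed

text \<open>In the chart domain a + b is conjugate to a + d by u. If a + b is also conjugate to a,
  by any g in the group, then a + d is conjugate to a by adj u g, and rigidity forces d = 0.\<close>

lemma ex_orbit_chart:
  assumes A: "A = hs_op a"
  obtains U V \<phi> \<psi> where "0 \<in> U" "analytic_diffeomorphism U V \<phi> \<psi>"
    "\<And>b. b \<in> U \<Longrightarrow> a + b \<in> unitary_orbit a \<longleftrightarrow> block_diag (\<phi> b) = 0"
proof -
  have A_bd: "A \<in> bounded_ops" by (simp add: A)
  obtain \<delta> where \<delta>: "0 < \<delta>" "\<forall>\<eta>\<in>\<Lambda>. \<forall>\<mu>\<in>\<Lambda>. \<eta> \<noteq> \<mu> \<longrightarrow> \<delta> \<le> cmod (\<eta> - \<mu>)"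
    using ex_spectral_gap by blast
  \<comment> \<open>\<open>e1\<close> puts d below the spectral gap, as rigidity requires;
    \<open>e2\<close> bounds k by 1/2, so that the Cayley transform exists.\<close>
  obtain e1 e2 where e: "0 < e1" "\<And>x. norm x < e1 \<Longrightarrow> norm (block_diag x) < \<delta>"
    "0 < e2" "\<And>x. norm x < e2 \<Longrightarrow> norm (generator x) < 1/2"
    using bounded_linear_small[OF bounded_linear_block_diag \<delta>(1)]
      bounded_linear_small[OF bounded_linear_generator, of "1/2"] by auto
  have "0 < min e1 e2" using e by simp
  from ex_Cayley_chart[OF this] obtain U V \<phi> \<psi> where U: "0 \<in> U" "analytic_diffeomorphism U V \<phi> \<psi>"
    and small: "\<And>b. b \<in> U \<Longrightarrow> norm (\<phi> b) < min e1 e2"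
    and rel: "\<And>b k d. b \<in> U \<Longrightarrow> k = generator (\<phi> b) \<Longrightarrow> d = block_diag (\<phi> b) \<Longrightarrow>
      \<phi> b = b + (lie (b + d) k + (- (1/2)) *\<^sub>R jordan (jordan k (d - b)) k
        + (1/4) *\<^sub>R jordan (jordan k k) (d - b))" by blast
  show ?thesis
  proof (rule that[OF U])
    fix b assume b: "b \<in> U"
    let ?d = "block_diag (\<phi> b)"
    have "norm (generator (\<phi> b)) \<le> 1/2" and d: "norm ?d < \<delta>"
      using small[OF b] e by (auto intro: less_imp_le)
    from Cayley_relation_imp_conjugate[OF rel[OF b refl refl] this(1) A_bd]
    obtain u where u: "u \<in> unitary_hs" "\<And>v. A v + hs_op b v = u (A (adj u v) + hs_op ?d (adj u v))"
      by blast
    show "a + b \<in> unitary_orbit a \<longleftrightarrow> ?d = 0"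
    proof
      assume "?d = 0"
      then have "\<forall>v. hs_op (a + b) v = u (hs_op a (adj u v))"
        using u(2) by (simp add: A hs_op_simps blinfun.add_left)
      then show "a + b \<in> unitary_orbit a"
        using u(1) by (auto simp: mem_unitary_orbit_iff)
    next
      assume "a + b \<in> unitary_orbit a"
      then obtain g where g: "g \<in> unitary_hs" "\<And>v. A v + hs_op b v = g (A (adj g v))"
        by (auto simp: mem_unitary_orbit_iff A hs_op_simps blinfun.add_left)
      let ?h = "adj u o\<^sub>L g"
      have h: "?h \<in> unitary_hs"
        by (intro unitary_hs_comp unitary_hs_adj u g)
      have adj_h: "adj ?h = adj g o\<^sub>L u"
        using u(1) g(1) by (simp add: adj_comp adj_adj unitary_hs_bounded_ops)
      have "A v + hs_op ?d v = ?h (A (adj ?h v))" for v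
      proof -
        have "u (A v + hs_op ?d v) = A (u v) + hs_op b (u v)"
          by (simp only: u(2) unitary_hs_cancel[OF u(1)])
        then have "A v + hs_op ?d v = adj u (g (A (adj g (u v))))"
          by (metis g(2) unitary_hs_cancel(1)[OF u(1)])
        then show ?thesis
          by (simp add: adj_h)
      qed
      moreover have "norm (hs_op ?d) < \<delta>"
        using norm_hs_op_le[of ?d] d by linarith
      ultimately have "hs_op ?d v = 0" for v
        by (intro small_block_diagonal_perturbation_rigid[OF \<delta>(2) _ E_block_diag_commute h])
      then show "?d = 0"
        by (intro hs_sa_eqI) (simp add: hs_op_simps)
    qed
  qed
qed

end

section \<open>The orbit\<close>

lemma conj_unitary:
  assumes g: "g \<in> unitary_hs"
  obtains c where "bounded_linear c" "\<And>x v. hs_op (c x) v = g (hs_op x (adj g v))"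
proof
  have g': "g \<in> bounded_ops" "adj g \<in> bounded_ops" "adj (adj g) = g"
    using unitary_hs_bounded_ops[OF g] by (simp_all add: adj_adj)
  show "bounded_linear (\<lambda>x. sandwich ((1/2) *\<^sub>R g) x (adj g))"
    by (intro bounded_linear_sandwich bounded_ops_simps g')
  show "hs_op (sandwich ((1/2) *\<^sub>R g) x (adj g)) v = g (hs_op x (adj g v))" for x v
    by (simp add: sandwich_apply g' adj_scaleR blinfun.bilinear_simps flip: scaleR_add_left)
qed

lemma conj_mem_unitary_orbit:
  assumes g: "g \<in> unitary_hs" and y: "\<And>v. hs_op y v = g (hs_op x (adj g v))" and x: "x \<in> unitary_orbit a"
  shows "y \<in> unitary_orbit a"
proof -
  obtain h where h: "h \<in> unitary_hs" "\<And>v. hs_op x v = h (hs_op a (adj h v))"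
    using x by (auto simp: mem_unitary_orbit_iff)
  have "adj (g o\<^sub>L h) = adj h o\<^sub>L adj g"
    by (rule adj_comp[OF unitary_hs_bounded_ops[OF g] unitary_hs_bounded_ops[OF h(1)]])
  then have "hs_op y v = (g o\<^sub>L h) (hs_op a (adj (g o\<^sub>L h) v))" for v
    by (simp add: y h(2))
  then show ?thesis
    using unitary_hs_comp[OF g h(1)] unfolding mem_unitary_orbit_iff by blast
qed

theorem theorem2p3:
  fixes a :: "'h::{complex_hilbert, second_countable_topology} hs_sa"
  assumes "finite_dimensional_ops (cstar_generated (hs_op a))"
  shows "analytic_submanifold (unitary_orbit a)"
proof -
  obtain \<Lambda> E where "spectral_resolution (hs_op a) \<Lambda> E"
    using ex_spectral_resolution[OF hs_op_bounded_ops adj_hs_op assms] by blast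
  then interpret spectral_resolution "hs_op a" \<Lambda> E .
  interpret block_diag: bounded_linear block_diag
    by (rule bounded_linear_block_diag)
  obtain U V \<phi> \<psi> where U: "0 \<in> U" and diffeo: "analytic_diffeomorphism U V \<phi> \<psi>"
    and flat: "\<And>b. b \<in> U \<Longrightarrow> a + b \<in> unitary_orbit a \<longleftrightarrow> block_diag (\<phi> b) = 0"
    using ex_orbit_chart[OF refl] by blast
  \<comment> \<open>By \<open>block_diag_generator\<close> the elements of this kernel are
    commutators of a with skew-adjoint operators, the directions tangent to the orbit at a.\<close>
  let ?F = "{z. block_diag z = 0}"
  have "subspace ?F"
    by (auto simp: subspace_def block_diag.add block_diag.scaleR block_diag.zero)
  moreover have "closed ?F"
    by (intro closed_Collect_eq continuous_on_const block_diag.continuous_on continuous_on_id)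
  moreover have "\<exists>U V \<phi> \<psi>. p \<in> U \<and> analytic_diffeomorphism U V \<phi> \<psi> \<and> \<phi> ` (unitary_orbit a \<inter> U) = ?F \<inter> V"
    if p: "p \<in> unitary_orbit a" for p
  proof -
    obtain g where g: "g \<in> unitary_hs" and pg: "\<And>v. hs_op p v = g (hs_op a (adj g v))"
      using p by (auto simp: mem_unitary_orbit_iff)
    have adj_g: "adj (adj g) = g" "adj g \<in> unitary_hs"
      using adj_adj[OF unitary_hs_bounded_ops[OF g]] unitary_hs_adj[OF g] by simp_all
    obtain c where c: "bounded_linear c" "\<And>x v. hs_op (c x) v = g (hs_op x (adj g v))"
      using conj_unitary[OF g] by blast
    obtain c' where c': "bounded_linear c'" "\<And>x v. hs_op (c' x) v = adj g (hs_op x (g v))"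
      using conj_unitary[OF adj_g(2)] unfolding adj_g(1) by blast
    interpret c: bounded_linear c by (rule c)
    interpret c': bounded_linear c' by (rule c')
    have inv: "c' (c x) = x" "c (c' x) = x" for x
      by (rule hs_sa_eqI, simp add: c c' unitary_hs_cancel[OF g])+
    have "c a = p"
      by (rule hs_sa_eqI) (simp add: c pg)
    then have c'p: "c' p = a"
      using inv by metis
    have orbit: "c' x \<in> unitary_orbit a \<longleftrightarrow> x \<in> unitary_orbit a" for x
    proof
      assume "c' x \<in> unitary_orbit a"
      then show "x \<in> unitary_orbit a"
        by (rule conj_mem_unitary_orbit[OF g, rotated]) (simp add: c' unitary_hs_cancel[OF g])
    next
      assume "x \<in> unitary_orbit a"
      then show "c' x \<in> unitary_orbit a"
        by (rule conj_mem_unitary_orbit[OF adj_g(2), rotated]) (simp add: c' adj_g)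
    qed
    \<comment> \<open>The map \<open>c'\<close> undoes the conjugation by g and takes p to a. Only
      the source of the chart is moved, so the target V and the model space are the same at every
      p.\<close>
    define U' where "U' = {x. c' x + - a \<in> U}"
    define \<phi>' where "\<phi>' = (\<lambda>x. \<phi> (c' x + - a))"
    define \<psi>' where "\<psi>' = (\<lambda>z. c (\<psi> z) + c a)"
    note D = diffeo[unfolded analytic_diffeomorphism_def]
    have "real_analytic_on \<phi>' U'"
      using real_analytic_on_affine_comp[OF _ bounded_linear_ident c'(1), of \<phi> U "- a" 0] D
      by (simp add: \<phi>'_def U'_def)
    moreover have "real_analytic_on \<psi>' V"
      using real_analytic_on_affine_comp[OF _ c(1) bounded_linear_ident, of \<psi> V 0 "c a"] D
      by (simp add: \<psi>'_def)
    moreover have \<phi>': "\<phi>' x \<in> V" "\<psi>' (\<phi>' x) = x" if "x \<in> U'" for x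
    proof -
      show "\<phi>' x \<in> V"
        using D that by (auto simp: \<phi>'_def U'_def)
      have "\<psi> (\<phi>' x) = c' x + - a"
        using D that by (auto simp: \<phi>'_def U'_def)
      then show "\<psi>' (\<phi>' x) = x"
        unfolding \<psi>'_def by (simp add: inv flip: c.add)
    qed
    moreover have \<psi>': "\<psi>' z \<in> U'" "\<phi>' (\<psi>' z) = z" if "z \<in> V" for z
    proof -
      have "c' (\<psi>' z) + - a = \<psi> z"
        by (simp add: \<psi>'_def inv c'.add)
      moreover have "\<psi> z \<in> U" "\<phi> (\<psi> z) = z"
        using D that by auto
      ultimately show "\<psi>' z \<in> U'" "\<phi>' (\<psi>' z) = z"
        by (simp_all add: U'_def \<phi>'_def)
    qed
    moreover have "\<phi>' ` U' = V"
      using \<phi>'(1) \<psi>' by (intro equalityI image_subsetI subsetI) (auto intro: rev_image_eqI[OF \<psi>'(1)])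
    moreover have "\<psi>' ` V = U'"
      using \<psi>'(1) \<phi>' by (intro equalityI image_subsetI subsetI) (auto intro: rev_image_eqI[OF \<phi>'(1)])
    ultimately have diffeo': "analytic_diffeomorphism U' V \<phi>' \<psi>'"
      unfolding analytic_diffeomorphism_def by blast
    have flat': "x \<in> unitary_orbit a \<longleftrightarrow> block_diag (\<phi>' x) = 0" if "x \<in> U'" for x
      using flat[of "c' x + - a"] that orbit[of x] by (simp add: U'_def \<phi>'_def)
    have "\<phi>' ` (unitary_orbit a \<inter> U') = ?F \<inter> V"
    proof (intro equalityI subsetI)
      fix z assume "z \<in> ?F \<inter> V"
      then show "z \<in> \<phi>' ` (unitary_orbit a \<inter> U')"
        using \<psi>'[of z] flat'[of "\<psi>' z"] by (intro rev_image_eqI[of "\<psi>' z"]) auto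
    qed (use \<phi>' flat' in auto)
    moreover have "p \<in> U'"
      using U by (simp add: U'_def c'p)
    ultimately show ?thesis
      using diffeo' by blast
  qed
  ultimately show ?thesis
    unfolding analytic_submanifold_def by blast
qed

end
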